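(* Let $(M,\Sigma,g_c)$ be a sub-Riemannian manifold. If $\Sigma$ satisfies the Chow condition (i.e. is bracket generating) and $M$ is connected, then for any two points $p,q\in M$ there exists at least one broken geodesic joining $p$ to $q$.
   Context: A sub-Riemannian manifold $(M,\Sigma,g_c)$ is a smooth manifold $M$ of dimension $m$ with a smooth (non-integrable) distribution $\Sigma\subset TM$ of rank $k<m$ and a smooth inner product $g_c$ on $\Sigma$. Throughout, $g_c=g|_\Sigma$ for a fixed Riemannian metric $g$ on $M$, $TM=\Sigma\oplus\Sigma^\perp$ is the $g$-orthogonal decomposition, $\mathcal P$ is the projection onto $\Sigma$, and $\nabla$ is the Levi-Civita connection of $g$. The horizontal connection is $D_XY:=\mathcal P(\nabla_XY)$ for $X,Y\in\Gamma(\Sigma)$ (smooth sections of $\Sigma$); it induces differentiation of horizontal vector fields along horizontal curves. A piecewise smooth curve $\gamma$ is horizontal if $\dot\gamma(t)\in\Sigma_{\gamma(t)}$ for a.e. $t$. A nonholonomic geodesic is a smooth horizontal curve with $D_{\dot\gamma}\dot\gamma=\mathcal P(\nabla_{\dot\gamma}\dot\gamma)=0$. A broken geodesic is a continuous horizontal curve consisting of finitely many segments each of which is a nonholonomic geodesic. Let $\Sigma_i$ be the set of vector fields spanned by all iterated commutators of order $\le i$ of vector fields in $\Sigma$, and $\Sigma_i(p)\subset T_pM$ the subspace of their values at $p$. $\Sigma$ satisfies the Chow (Hörmander) condition, or is bracket generating, if for every $p\in M$ there is an integer $l(p)$ with $\Sigma_{l(p)}(p)=T_pM$. *)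

theory Defs
  imports "HOL-Analysis.Analysis"
begin

section \<open>Smooth maps between Euclidean spaces\<close>

text \<open>Both notions are meant for open \<open>S\<close> only: they use the two-sided derivative.\<close>

primrec diff_class :: "nat \<Rightarrow> 'e::euclidean_space set \<Rightarrow> ('e \<Rightarrow> 'b::real_normed_vector) \<Rightarrow> bool" where
  "diff_class 0 S f \<longleftrightarrow> continuous_on S f"
| "diff_class (Suc n) S f \<longleftrightarrow>
     (\<forall>x\<in>S. f differentiable (at x)) \<and>
     (\<forall>v. diff_class n S (\<lambda>x. frechet_derivative f (at x) v))"

definition smooth_on :: "'e::euclidean_space set \<Rightarrow> ('e \<Rightarrow> 'b::real_normed_vector) \<Rightarrow> bool" where
  "smooth_on S f \<longleftrightarrow> (\<forall>n. diff_class n S f)"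


section \<open>Smooth manifolds\<close>

text \<open>
  The manifold \<open>M\<close> is the whole type \<open>'a\<close> (Hausdorff and second countable), modelled on a
  Euclidean space \<open>'e\<close>, so that \<open>m = DIM('e)\<close>. A chart \<open>(U, \<phi>)\<close> is a domain together with a
  coordinate map; the values of \<open>\<phi>\<close> outside \<open>U\<close> are irrelevant.
\<close>

type_synonym ('a, 'e) chart = "'a set \<times> ('a \<Rightarrow> 'e)"

definition cdom :: "('a, 'e) chart \<Rightarrow> 'a set" where
  "cdom c = fst c"

definition cmap :: "('a, 'e) chart \<Rightarrow> 'a \<Rightarrow> 'e" where
  "cmap c = snd c"

definition cimg :: "('a, 'e) chart \<Rightarrow> 'e set" where
  "cimg c = cmap c ` cdom c"

definition cinv :: "('a, 'e) chart \<Rightarrow> 'e \<Rightarrow> 'a" where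
  "cinv c = inv_into (cdom c) (cmap c)"

definition is_chart :: "('a::topological_space, 'e::euclidean_space) chart \<Rightarrow> bool" where
  "is_chart c \<longleftrightarrow>
     open (cdom c) \<and> open (cimg c) \<and> homeomorphism (cdom c) (cimg c) (cmap c) (cinv c)"

definition overlap :: "('a, 'e) chart \<Rightarrow> ('a, 'e) chart \<Rightarrow> 'e set" where
  "overlap c d = cmap c ` (cdom c \<inter> cdom d)"

definition transition :: "('a, 'e) chart \<Rightarrow> ('a, 'e) chart \<Rightarrow> 'e \<Rightarrow> 'e" where
  "transition c d = (\<lambda>x. cmap d (cinv c x))"

definition compatible :: "('a, 'e::euclidean_space) chart \<Rightarrow> ('a, 'e) chart \<Rightarrow> bool" where
  "compatible c d \<longleftrightarrow>
     smooth_on (overlap c d) (transition c d) \<and> smooth_on (overlap d c) (transition d c)"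

text \<open>A smooth structure is a maximal smooth atlas.\<close>

definition smooth_structure ::
    "('a::{t2_space, second_countable_topology}, 'e::euclidean_space) chart set \<Rightarrow> bool" where
  "smooth_structure A \<longleftrightarrow>
     (\<forall>c\<in>A. is_chart c) \<and>
     (\<Union>c\<in>A. cdom c) = UNIV \<and>
     (\<forall>c\<in>A. \<forall>d\<in>A. compatible c d) \<and>
     (\<forall>c. is_chart c \<and> (\<forall>d\<in>A. compatible c d) \<longrightarrow> c \<in> A)"


section \<open>Vector fields and distributions\<close>

text \<open>
  Tangent vectors are handled through their coordinates: a chart \<open>c\<close> at \<open>p\<close> identifies \<open>T\<^sub>pM\<close>
  with \<open>'e\<close>, and two charts \<open>c\<close>, \<open>d\<close> are related by the derivative of \<open>transition c d\<close> at
  \<open>cmap c p\<close>. A geometric object is the family of its representations in the charts of the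
  atlas, as a function of the coordinate point \<open>x \<in> cimg c\<close>, subject to the transformation law
  of its type. Values at \<open>x \<notin> cimg c\<close> or for \<open>c\<close> outside the atlas are irrelevant.
\<close>

definition dtrans :: "('a, 'e::euclidean_space) chart \<Rightarrow> ('a, 'e) chart \<Rightarrow> 'e \<Rightarrow> 'e \<Rightarrow> 'e" where
  "dtrans c d x = frechet_derivative (transition c d) (at x)"

type_synonym ('a, 'e) field = "('a, 'e) chart \<Rightarrow> 'e \<Rightarrow> 'e"
type_synonym ('a, 'e) distr = "('a, 'e) chart \<Rightarrow> 'e \<Rightarrow> 'e set"

definition vector_field ::
    "('a, 'e::euclidean_space) chart set \<Rightarrow> ('a, 'e) field \<Rightarrow> bool" where
  "vector_field A X \<longleftrightarrow>
     (\<forall>c\<in>A. smooth_on (cimg c) (X c)) \<and>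
     (\<forall>c\<in>A. \<forall>d\<in>A. \<forall>x\<in>overlap c d. X d (transition c d x) = dtrans c d x (X c x))"

definition distribution ::
    "('a, 'e::euclidean_space) chart set \<Rightarrow> nat \<Rightarrow> ('a, 'e) distr \<Rightarrow> bool" where
  "distribution A k \<Sigma> \<longleftrightarrow>
     (\<forall>c\<in>A. \<forall>x\<in>cimg c. subspace (\<Sigma> c x) \<and> dim (\<Sigma> c x) = k) \<and>
     (\<forall>c\<in>A. \<forall>d\<in>A. \<forall>x\<in>overlap c d. \<Sigma> d (transition c d x) = dtrans c d x ` \<Sigma> c x) \<and>
     (\<forall>c\<in>A. \<forall>x\<in>cimg c. \<exists>V E. open V \<and> x \<in> V \<and> V \<subseteq> cimg c \<and>
        (\<forall>i<k. smooth_on V (E i)) \<and>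
        (\<forall>y\<in>V. \<Sigma> c y = span ((\<lambda>i. E i y) ` {..<k})))"

text \<open>Integrability: near every point there are coordinates in which the distribution is constant.\<close>

definition integrable_distribution ::
    "('a, 'e::euclidean_space) chart set \<Rightarrow> ('a, 'e) distr \<Rightarrow> bool" where
  "integrable_distribution A \<Sigma> \<longleftrightarrow>
     (\<forall>p. \<exists>c\<in>A. p \<in> cdom c \<and> (\<exists>S. \<forall>x\<in>cimg c. \<Sigma> c x = S))"

definition horizontal_field ::
    "('a, 'e::euclidean_space) chart set \<Rightarrow> ('a, 'e) distr \<Rightarrow> ('a, 'e) field \<Rightarrow> bool" where
  "horizontal_field A \<Sigma> X \<longleftrightarrow> vector_field A X \<and> (\<forall>c\<in>A. \<forall>x\<in>cimg c. X c x \<in> \<Sigma> c x)"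

definition coord_bracket ::
    "('e::euclidean_space \<Rightarrow> 'e) \<Rightarrow> ('e \<Rightarrow> 'e) \<Rightarrow> 'e \<Rightarrow> 'e" where
  "coord_bracket X Y x =
     frechet_derivative Y (at x) (X x) - frechet_derivative X (at x) (Y x)"

definition lie_bracket ::
    "('a, 'e::euclidean_space) field \<Rightarrow> ('a, 'e) field \<Rightarrow> ('a, 'e) field" where
  "lie_bracket X Y = (\<lambda>c. coord_bracket (X c) (Y c))"

text \<open>Iterated commutators with arbitrary nesting; the order is the number of entries.\<close>

inductive iterated_commutator ::
    "('a, 'e::euclidean_space) chart set \<Rightarrow> ('a, 'e) distr \<Rightarrow> nat \<Rightarrow> ('a, 'e) field \<Rightarrow> bool"
  for A \<Sigma> where
  base: "horizontal_field A \<Sigma> X \<Longrightarrow> iterated_commutator A \<Sigma> 1 X"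
| bracket: "iterated_commutator A \<Sigma> i X \<Longrightarrow> iterated_commutator A \<Sigma> j Y \<Longrightarrow>
     iterated_commutator A \<Sigma> (i + j) (lie_bracket X Y)"

text \<open>The vector fields in \<open>\<Sigma>\<^sub>i\<close>. Linear combinations over \<open>\<real>\<close> and over the smooth functions
  have the same values at each point.\<close>

inductive sigma_field ::
    "('a, 'e::euclidean_space) chart set \<Rightarrow> ('a, 'e) distr \<Rightarrow> nat \<Rightarrow> ('a, 'e) field \<Rightarrow> bool"
  for A \<Sigma> i where
  comm: "iterated_commutator A \<Sigma> j X \<Longrightarrow> j \<le> i \<Longrightarrow> sigma_field A \<Sigma> i X"
| add: "sigma_field A \<Sigma> i X \<Longrightarrow> sigma_field A \<Sigma> i Y \<Longrightarrow>
     sigma_field A \<Sigma> i (\<lambda>c x. X c x + Y c x)"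
| scale: "sigma_field A \<Sigma> i X \<Longrightarrow> sigma_field A \<Sigma> i (\<lambda>c x. r *\<^sub>R X c x)"

definition sigma_at ::
    "('a, 'e::euclidean_space) chart set \<Rightarrow> ('a, 'e) distr \<Rightarrow> nat \<Rightarrow> ('a, 'e) distr" where
  "sigma_at A \<Sigma> i c x = {X c x | X. sigma_field A \<Sigma> i X}"

definition bracket_generating ::
    "('a, 'e::euclidean_space) chart set \<Rightarrow> ('a, 'e) distr \<Rightarrow> bool" where
  "bracket_generating A \<Sigma> \<longleftrightarrow>
     (\<forall>p. \<exists>l. \<forall>c\<in>A. p \<in> cdom c \<longrightarrow> sigma_at A \<Sigma> l c (cmap c p) = UNIV)"


section \<open>Metrics, sub-Riemannian manifolds\<close>

type_synonym ('a, 'e) metric = "('a, 'e) chart \<Rightarrow> 'e \<Rightarrow> 'e \<Rightarrow> 'e \<Rightarrow> real"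

definition inner_product_on :: "'e::real_vector set \<Rightarrow> ('e \<Rightarrow> 'e \<Rightarrow> real) \<Rightarrow> bool" where
  "inner_product_on E h \<longleftrightarrow>
     (\<forall>u\<in>E. \<forall>v\<in>E. h u v = h v u) \<and>
     (\<forall>u\<in>E. \<forall>v\<in>E. \<forall>w\<in>E. h (u + v) w = h u w + h v w) \<and>
     (\<forall>r. \<forall>u\<in>E. \<forall>v\<in>E. h (r *\<^sub>R u) v = r * h u v) \<and>
     (\<forall>u\<in>E. u \<noteq> 0 \<longrightarrow> h u u > 0)"

text \<open>A smooth inner product on the subbundle \<open>E\<close> of \<open>TM\<close>.\<close>

definition bundle_metric ::
    "('a, 'e::euclidean_space) chart set \<Rightarrow> ('a, 'e) distr \<Rightarrow> ('a, 'e) metric \<Rightarrow> bool" where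
  "bundle_metric A E h \<longleftrightarrow>
     (\<forall>c\<in>A. \<forall>x\<in>cimg c. inner_product_on (E c x) (h c x)) \<and>
     (\<forall>c\<in>A. \<forall>d\<in>A. \<forall>x\<in>overlap c d. \<forall>u\<in>E c x. \<forall>v\<in>E c x.
        h d (transition c d x) (dtrans c d x u) (dtrans c d x v) = h c x u v) \<and>
     (\<forall>c\<in>A. \<forall>V X Y. open V \<and> V \<subseteq> cimg c \<and> smooth_on V X \<and> smooth_on V Y \<and>
        (\<forall>x\<in>V. X x \<in> E c x \<and> Y x \<in> E c x) \<longrightarrow>
        smooth_on V (\<lambda>x. h c x (X x) (Y x)))"

definition riemannian_metric ::
    "('a, 'e::euclidean_space) chart set \<Rightarrow> ('a, 'e) metric \<Rightarrow> bool" where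
  "riemannian_metric A g \<longleftrightarrow> bundle_metric A (\<lambda>_ _. UNIV) g"

definition metric_restricts ::
    "('a, 'e::euclidean_space) chart set \<Rightarrow> ('a, 'e) distr \<Rightarrow> ('a, 'e) metric \<Rightarrow>
     ('a, 'e) metric \<Rightarrow> bool" where
  "metric_restricts A \<Sigma> g gc \<longleftrightarrow>
     (\<forall>c\<in>A. \<forall>x\<in>cimg c. \<forall>u\<in>\<Sigma> c x. \<forall>v\<in>\<Sigma> c x. gc c x u v = g c x u v)"

definition sub_riemannian_manifold ::
    "('a::{t2_space, second_countable_topology}, 'e::euclidean_space) chart set \<Rightarrow> nat \<Rightarrow>
     ('a, 'e) distr \<Rightarrow> ('a, 'e) metric \<Rightarrow> bool" where
  "sub_riemannian_manifold A k \<Sigma> gc \<longleftrightarrow>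
     smooth_structure A \<and> distribution A k \<Sigma> \<and> k < DIM('e) \<and>
     \<not> integrable_distribution A \<Sigma> \<and> bundle_metric A \<Sigma> gc"


section \<open>The Levi-Civita connection and the horizontal connection\<close>

text \<open>
  An affine connection is given by its coefficients: \<open>\<Gamma> c x u v\<close> is the vector with components
  \<open>\<Gamma>\<^bsup>k\<^esup>\<^bsub>ij\<^esub> u\<^bsup>i\<^esup> v\<^bsup>j\<^esup>\<close>, so that \<open>\<nabla>\<^sub>X Y\<close> is \<open>DY(X) + \<Gamma>(X, Y)\<close> in the chart \<open>c\<close>. The transformation
  law says precisely that \<open>\<nabla>\<^sub>X Y\<close> transforms like a vector field.
\<close>

type_synonym ('a, 'e) conn = "('a, 'e) chart \<Rightarrow> 'e \<Rightarrow> 'e \<Rightarrow> 'e \<Rightarrow> 'e"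

definition affine_connection ::
    "('a, 'e::euclidean_space) chart set \<Rightarrow> ('a, 'e) conn \<Rightarrow> bool" where
  "affine_connection A \<Gamma> \<longleftrightarrow>
     (\<forall>c\<in>A. \<forall>x\<in>cimg c. bilinear (\<Gamma> c x)) \<and>
     (\<forall>c\<in>A. \<forall>u v. smooth_on (cimg c) (\<lambda>x. \<Gamma> c x u v)) \<and>
     (\<forall>c\<in>A. \<forall>d\<in>A. \<forall>x\<in>overlap c d. \<forall>u v.
        \<Gamma> d (transition c d x) (dtrans c d x u) (dtrans c d x v) =
        dtrans c d x (\<Gamma> c x u v) - frechet_derivative (\<lambda>y. dtrans c d y v) (at x) u)"

definition cov_deriv ::
    "('a, 'e::euclidean_space) conn \<Rightarrow> ('a, 'e) chart \<Rightarrow> ('e \<Rightarrow> 'e) \<Rightarrow> ('e \<Rightarrow> 'e) \<Rightarrow> 'e \<Rightarrow> 'e" where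
  "cov_deriv \<Gamma> c X Y x = frechet_derivative Y (at x) (X x) + \<Gamma> c x (X x) (Y x)"

text \<open>Torsion-free and compatible with the metric, on all local vector fields.\<close>

definition levi_civita ::
    "('a, 'e::euclidean_space) chart set \<Rightarrow> ('a, 'e) metric \<Rightarrow> ('a, 'e) conn \<Rightarrow> bool" where
  "levi_civita A g \<Gamma> \<longleftrightarrow>
     affine_connection A \<Gamma> \<and>
     (\<forall>c\<in>A. \<forall>V X Y. open V \<and> V \<subseteq> cimg c \<and> smooth_on V X \<and> smooth_on V Y \<longrightarrow>
        (\<forall>x\<in>V. cov_deriv \<Gamma> c X Y x - cov_deriv \<Gamma> c Y X x = coord_bracket X Y x)) \<and>
     (\<forall>c\<in>A. \<forall>V X Y Z. open V \<and> V \<subseteq> cimg c \<and>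
        smooth_on V X \<and> smooth_on V Y \<and> smooth_on V Z \<longrightarrow>
        (\<forall>x\<in>V. frechet_derivative (\<lambda>y. g c y (Y y) (Z y)) (at x) (X x) =
           g c x (cov_deriv \<Gamma> c X Y x) (Z x) + g c x (Y x) (cov_deriv \<Gamma> c X Z x)))"

text \<open>The \<open>g\<close>-orthogonal projection onto \<open>\<Sigma>\<close>.\<close>

definition hor_proj ::
    "('a, 'e::euclidean_space) distr \<Rightarrow> ('a, 'e) metric \<Rightarrow> ('a, 'e) chart \<Rightarrow> 'e \<Rightarrow> 'e \<Rightarrow> 'e" where
  "hor_proj \<Sigma> g c x v = (THE w. w \<in> \<Sigma> c x \<and> (\<forall>u\<in>\<Sigma> c x. g c x (v - w) u = 0))"

definition velocity ::
    "('a, 'e::euclidean_space) chart \<Rightarrow> (real \<Rightarrow> 'a) \<Rightarrow> real \<Rightarrow> 'e" where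
  "velocity c \<sigma> t = vector_derivative (\<lambda>s. cmap c (\<sigma> s)) (at t)"

text \<open>The derivative induced by \<open>D = \<P> \<circ> \<nabla>\<close> of a vector field \<open>W\<close> along a curve \<open>\<sigma>\<close>, where \<open>W\<close> is
  given by its components in the chart \<open>c\<close>; it equals \<open>\<P>(\<nabla>\<^sub>\<sigma>\<^sub>' Y)\<close> if \<open>W = Y \<circ> \<sigma>\<close>.\<close>

definition hor_deriv_along ::
    "('a, 'e::euclidean_space) distr \<Rightarrow> ('a, 'e) metric \<Rightarrow> ('a, 'e) conn \<Rightarrow> ('a, 'e) chart \<Rightarrow>
     (real \<Rightarrow> 'a) \<Rightarrow> (real \<Rightarrow> 'e) \<Rightarrow> real \<Rightarrow> 'e" where
  "hor_deriv_along \<Sigma> g \<Gamma> c \<sigma> W t =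
     hor_proj \<Sigma> g c (cmap c (\<sigma> t))
       (vector_derivative W (at t) + \<Gamma> c (cmap c (\<sigma> t)) (velocity c \<sigma> t) (W t))"


section \<open>Curves\<close>

definition smooth_curve ::
    "('a::topological_space, 'e::euclidean_space) chart set \<Rightarrow> real set \<Rightarrow> (real \<Rightarrow> 'a) \<Rightarrow> bool" where
  "smooth_curve A J \<sigma> \<longleftrightarrow>
     open J \<and> continuous_on J \<sigma> \<and>
     (\<forall>c\<in>A. smooth_on {t\<in>J. \<sigma> t \<in> cdom c} (\<lambda>t. cmap c (\<sigma> t)))"

text \<open>Smoothness on a compact interval means extendability to a smooth curve \<open>\<sigma>\<close> on an open
  neighbourhood; the derivatives of \<open>\<sigma>\<close> on \<open>{a..b}\<close> are determined by \<open>\<gamma>\<close> when \<open>a < b\<close>.\<close>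

definition smooth_extension ::
    "('a::topological_space, 'e::euclidean_space) chart set \<Rightarrow> real \<Rightarrow> real \<Rightarrow> (real \<Rightarrow> 'a) \<Rightarrow>
     (real \<Rightarrow> 'a) \<Rightarrow> bool" where
  "smooth_extension A a b \<gamma> \<sigma> \<longleftrightarrow>
     (\<exists>J. {a..b} \<subseteq> J \<and> smooth_curve A J \<sigma>) \<and> (\<forall>t\<in>{a..b}. \<gamma> t = \<sigma> t)"

definition nonholonomic_geodesic ::
    "('a::topological_space, 'e::euclidean_space) chart set \<Rightarrow> ('a, 'e) distr \<Rightarrow> ('a, 'e) metric \<Rightarrow>
     ('a, 'e) conn \<Rightarrow> real \<Rightarrow> real \<Rightarrow> (real \<Rightarrow> 'a) \<Rightarrow> bool" where
  "nonholonomic_geodesic A \<Sigma> g \<Gamma> a b \<gamma> \<longleftrightarrow>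
     (\<exists>\<sigma>. smooth_extension A a b \<gamma> \<sigma> \<and>
       (\<forall>t\<in>{a..b}. \<forall>c\<in>A. \<sigma> t \<in> cdom c \<longrightarrow>
          velocity c \<sigma> t \<in> \<Sigma> c (cmap c (\<sigma> t)) \<and>
          hor_deriv_along \<Sigma> g \<Gamma> c \<sigma> (velocity c \<sigma>) t = 0))"

definition subdivision :: "real \<Rightarrow> real \<Rightarrow> nat \<Rightarrow> (nat \<Rightarrow> real) \<Rightarrow> bool" where
  "subdivision a b n s \<longleftrightarrow> s 0 = a \<and> s n = b \<and> (\<forall>i<n. s i < s (Suc i))"

definition piecewise_smooth_curve ::
    "('a::topological_space, 'e::euclidean_space) chart set \<Rightarrow> real \<Rightarrow> real \<Rightarrow> (real \<Rightarrow> 'a) \<Rightarrow>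
     bool" where
  "piecewise_smooth_curve A a b \<gamma> \<longleftrightarrow>
     continuous_on {a..b} \<gamma> \<and>
     (\<exists>n s. subdivision a b n s \<and> (\<forall>i<n. \<exists>\<sigma>. smooth_extension A (s i) (s (Suc i)) \<gamma> \<sigma>))"

definition horizontal_curve ::
    "('a::topological_space, 'e::euclidean_space) chart set \<Rightarrow> ('a, 'e) distr \<Rightarrow> real \<Rightarrow> real \<Rightarrow>
     (real \<Rightarrow> 'a) \<Rightarrow> bool" where
  "horizontal_curve A \<Sigma> a b \<gamma> \<longleftrightarrow>
     piecewise_smooth_curve A a b \<gamma> \<and>
     (AE t in lebesgue. t \<in> {a..b} \<longrightarrow>
        (\<forall>c\<in>A. \<gamma> t \<in> cdom c \<longrightarrow> velocity c \<gamma> t \<in> \<Sigma> c (cmap c (\<gamma> t))))"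

definition broken_geodesic ::
    "('a::topological_space, 'e::euclidean_space) chart set \<Rightarrow> ('a, 'e) distr \<Rightarrow> ('a, 'e) metric \<Rightarrow>
     ('a, 'e) conn \<Rightarrow> real \<Rightarrow> real \<Rightarrow> (real \<Rightarrow> 'a) \<Rightarrow> bool" where
  "broken_geodesic A \<Sigma> g \<Gamma> a b \<gamma> \<longleftrightarrow>
     continuous_on {a..b} \<gamma> \<and> horizontal_curve A \<Sigma> a b \<gamma> \<and>
     (\<exists>n s. subdivision a b n s \<and>
        (\<forall>i<n. nonholonomic_geodesic A \<Sigma> g \<Gamma> (s i) (s (Suc i)) \<gamma>))"

end

theory Submission
  imports Defs
begin

text \<open>
  Call \<open>q\<close> reachable from \<open>p\<close> if finitely many nonholonomic geodesic segments lead from \<open>p\<close> to \<open>q\<close>. The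
  theorem follows from a local statement: every point has a neighbourhood in which any two points are
  reachable from each other. Then the set of points reachable from \<open>p\<close> is open and closed, hence
  everything (\<open>reachable_neighbourhood\<close>, \<open>all_reachable\<close>).

  The local statement is an analogue of Chow's theorem. Geodesic segments are not orbits of a flow
  on \<open>M\<close>: each new segment starts with a velocity of its own choice, and the reverse of a segment
  is not obtained by reversing the field that prescribed its initial velocity. So instead of
  composing flows, the argument imitates vector fields approximately. A field \<open>Z\<close> is
  \<open>attainable\<close> if for all short times \<open>h\<close> there are moves along chains of geodesics, depending
  continuously on the starting point, that lead from \<open>y\<close> to \<open>y + h Z(y) + o(h)\<close>. Horizontal fields are
  attainable, by the geodesics with initial velocity \<open>Z(y)\<close> (\<open>horizontal_attainable\<close>). Sums are
  attainable by moving along one field after the other. For brackets, first order information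
  has to be improved to second order: many moves of length \<open>s/N\<close> follow the flow of the field for
  time \<open>s\<close> as closely as desired (\<open>second_order_attainable_iterate\<close>), and the commutator of two such imitated
  flows displaces by \<open>s\<^sup>2[X, Y] + O(s\<^sup>3)\<close> (\<open>attainable_bracket\<close>). By the bracket generating condition there are attainable
  fields with every prescribed value at a given point; Brouwer's fixed point theorem turns the
  approximate moves along their combinations into exact ones (\<open>local_controllability\<close>). Brouwer's
  theorem asks for continuity of the moves, which comes from the Lipschitz dependence of geodesics on
  their initial data (\<open>picard_lindeloef\<close>).

  Geodesics exist because the orthogonal projection \<open>P\<close> onto the distribution is smooth
  (\<open>smooth_projection\<close>), which makes the geodesic equation an ordinary differential equation
  for the position and a vector \<open>a\<close> with velocity \<open>P a\<close>.
\<close>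

section \<open>Calculus of smooth maps\<close>

lemma diff_class_Suc_imp: "diff_class (Suc n) S f \<Longrightarrow> diff_class n S f"
proof (induction n arbitrary: f)
  case 0
  then show ?case
    by (auto intro!: continuous_at_imp_continuous_on differentiable_imp_continuous_within)
next
  case (Suc n)
  then show ?case by (metis diff_class.simps(2))
qed

lemma diff_class_subset: "diff_class n S f \<Longrightarrow> T \<subseteq> S \<Longrightarrow> diff_class n T f"
  by (induction n arbitrary: f) (auto intro: continuous_on_subset)

lemma frechet_derivative_cong_open:
  assumes "open S" "x \<in> S" "\<And>y. y \<in> S \<Longrightarrow> f y = g y" "f differentiable (at x)"
  shows "g differentiable (at x)" "frechet_derivative g (at x) = frechet_derivative f (at x)"
proof -
  have "(f has_derivative frechet_derivative f (at x)) (at x)"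
    using assms(4) frechet_derivative_works by blast
  then have *: "(g has_derivative frechet_derivative f (at x)) (at x)"
    by (rule has_derivative_transform_within_open[OF _ assms(1,2)]) (use assms(3) in auto)
  show "g differentiable (at x)" using * by (auto simp: differentiable_def)
  show "frechet_derivative g (at x) = frechet_derivative f (at x)"
    using frechet_derivative_at[OF *] by simp
qed

lemma diff_class_cong:
  "diff_class n S f \<Longrightarrow> open S \<Longrightarrow> (\<And>x. x \<in> S \<Longrightarrow> f x = g x) \<Longrightarrow> diff_class n S g"
proof (induction n arbitrary: f g)
  case 0
  then show ?case by (simp cong: continuous_on_cong)
next
  case (Suc n)
  have d: "f differentiable (at x)" if "x \<in> S" for x using Suc.prems(1) that by simp
  have "g differentiable (at x)" if "x \<in> S" for x
    using frechet_derivative_cong_open(1)[OF Suc.prems(2) that Suc.prems(3) d[OF that]] by simp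
  moreover have "diff_class n S (\<lambda>x. frechet_derivative g (at x) v)" for v
  proof (rule Suc.IH)
    show "diff_class n S (\<lambda>x. frechet_derivative f (at x) v)" using Suc.prems(1) by simp
    show "frechet_derivative f (at x) v = frechet_derivative g (at x) v" if "x \<in> S" for x
      using frechet_derivative_cong_open(2)[OF Suc.prems(2) that Suc.prems(3) d[OF that]] by simp
  qed fact
  ultimately show ?case by simp
qed

lemma diff_class_SucI:
  assumes "open S" "\<And>x. x \<in> S \<Longrightarrow> (f has_derivative f' x) (at x)"
    "\<And>v. diff_class n S (\<lambda>x. f' x v)"
  shows "diff_class (Suc n) S f"
proof -
  have "diff_class n S (\<lambda>x. frechet_derivative f (at x) v)" for v
    by (rule diff_class_cong[OF assms(3)[of v] assms(1)])
       (metis assms(2) frechet_derivative_at)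
  then show ?thesis using assms(2) by (auto simp: differentiable_def)
qed

lemma diff_class_SucD:
  assumes "diff_class (Suc n) S f"
  shows "x \<in> S \<Longrightarrow> (f has_derivative frechet_derivative f (at x)) (at x)"
    "diff_class n S (\<lambda>x. frechet_derivative f (at x) v)"
  using assms by (auto simp: frechet_derivative_works)

lemma diff_class_const: "open S \<Longrightarrow> diff_class n S (\<lambda>x. c)"
proof (induction n arbitrary: c)
  case (Suc n)
  show ?case
    by (rule diff_class_SucI[where f' = "\<lambda>_ _. 0"]) (use Suc in auto)
qed auto

lemma diff_class_add:
  "open S \<Longrightarrow> diff_class n S f \<Longrightarrow> diff_class n S g \<Longrightarrow> diff_class n S (\<lambda>x. f x + g x)"
proof (induction n arbitrary: f g)
  case 0 then show ?case by (auto intro: continuous_intros)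
next
  case (Suc n)
  note f = diff_class_SucD[OF Suc.prems(2)] and g = diff_class_SucD[OF Suc.prems(3)]
  show ?case
    by (rule diff_class_SucI[OF Suc.prems(1) has_derivative_add[OF f(1) g(1)]])
       (auto intro!: Suc.IH f(2) g(2) Suc.prems(1))
qed

lemma diff_class_sum:
  "open S \<Longrightarrow> (\<And>i. i \<in> I \<Longrightarrow> diff_class n S (f i)) \<Longrightarrow> diff_class n S (\<lambda>x. \<Sum>i\<in>I. f i x)"
  by (induction I rule: infinite_finite_induct) (auto intro: diff_class_add diff_class_const)

lemma diff_class_bounded_linear:
  assumes "bounded_linear L" "open S"
  shows "diff_class n S f \<Longrightarrow> diff_class n S (\<lambda>x. L (f x))"
proof (induction n arbitrary: f)
  case 0 then show ?case
    using bounded_linear.continuous_on[OF assms(1)] by simp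
next
  case (Suc n)
  note f = diff_class_SucD[OF Suc.prems]
  show ?case
    by (rule diff_class_SucI[OF assms(2) bounded_linear.has_derivative[OF assms(1) f(1)]])
       (auto intro!: Suc.IH f(2))
qed

lemma diff_class_bilinear:
  assumes "bounded_bilinear B" "open S"
  shows "diff_class n S f \<Longrightarrow> diff_class n S g \<Longrightarrow> diff_class n S (\<lambda>x. B (f x) (g x))"
proof (induction n arbitrary: f g)
  case 0 then show ?case
    using bounded_bilinear.continuous_on[OF assms(1)] by simp
next
  case (Suc n)
  note f = diff_class_SucD[OF Suc.prems(1)] and g = diff_class_SucD[OF Suc.prems(2)]
  show ?case
    by (rule diff_class_SucI[OF assms(2) bounded_bilinear.FDERIV[OF assms(1) f(1) g(1)]])
       (auto intro!: diff_class_add assms Suc.IH f(2) g(2) diff_class_Suc_imp[OF Suc.prems(1)]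
           diff_class_Suc_imp[OF Suc.prems(2)])
qed

lemmas diff_class_scaleR = diff_class_bilinear[OF bounded_bilinear_scaleR]
  and diff_class_mult = diff_class_bilinear[OF bounded_bilinear_mult]

lemma diff_class_inner: "open S \<Longrightarrow> diff_class n S f \<Longrightarrow> diff_class n S (\<lambda>x. f x \<bullet> b)"
  by (rule diff_class_bounded_linear[OF bounded_linear_inner_left])

lemma diff_class_id: "open S \<Longrightarrow> diff_class n S (\<lambda>x. x)"
proof (cases n)
  case (Suc m)
  assume "open S"
  show ?thesis unfolding Suc
    by (rule diff_class_SucI[where f' = "\<lambda>_ v. v"]) (use \<open>open S\<close> in \<open>auto intro: diff_class_const\<close>)
qed auto

lemma linear_expand_Basis:
  fixes L :: "'e::euclidean_space \<Rightarrow> 'b::real_vector"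
  assumes "linear L"
  shows "L v = (\<Sum>b\<in>Basis. (v \<bullet> b) *\<^sub>R L b)"
proof -
  have "L v = L (\<Sum>b\<in>Basis. (v \<bullet> b) *\<^sub>R b)" by (simp add: euclidean_representation)
  also have "\<dots> = (\<Sum>b\<in>Basis. (v \<bullet> b) *\<^sub>R L b)"
    using assms by (simp add: linear_sum linear_scale)
  finally show ?thesis .
qed

text \<open>
  The induction on the order needs the derivative of the composition as a combination of maps of
  lower order; expanding the inner derivative in the basis turns the chain rule into a sum of products
  of directional derivatives.
\<close>

lemma diff_class_compose:
  fixes g :: "'d::euclidean_space \<Rightarrow> 'e::euclidean_space" and f :: "'e \<Rightarrow> 'b::real_normed_vector"
  assumes "open S" "open T"
  shows "diff_class n S f \<Longrightarrow> diff_class n T g \<Longrightarrow> g ` T \<subseteq> S \<Longrightarrow> diff_class n T (\<lambda>x. f (g x))"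
proof (induction n arbitrary: f g)
  case 0
  then show ?case by (auto intro: continuous_on_compose2)
next
  case (Suc n)
  note f = diff_class_SucD[OF Suc.prems(1)] and g = diff_class_SucD[OF Suc.prems(2)]
  let ?F = "\<lambda>x. frechet_derivative f (at x)" and ?G = "\<lambda>x. frechet_derivative g (at x)"
  show ?case
  proof (rule diff_class_SucI[where f' = "\<lambda>x v. ?F (g x) (?G x v)"])
    show "((\<lambda>x. f (g x)) has_derivative (\<lambda>v. ?F (g x) (?G x v))) (at x)" if "x \<in> T" for x
      using diff_chain_at[OF g(1)[OF that] f(1)] that Suc.prems(3) by (auto simp: o_def)
    show "diff_class n T (\<lambda>x. ?F (g x) (?G x v))" for v
    proof (rule diff_class_cong[of _ _ "\<lambda>x. \<Sum>b\<in>Basis. (?G x v \<bullet> b) *\<^sub>R ?F (g x) b"])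
      have "diff_class n T (\<lambda>x. ?F (g x) b)" for b
        by (rule Suc.IH[OF f(2) diff_class_Suc_imp[OF Suc.prems(2)] Suc.prems(3)])
      then show "diff_class n T (\<lambda>x. \<Sum>b\<in>Basis. (?G x v \<bullet> b) *\<^sub>R ?F (g x) b)"
        by (intro diff_class_sum diff_class_scaleR diff_class_inner g(2) assms)
      fix x assume "x \<in> T"
      then have "linear (?F (g x))"
        using f(1)[of "g x"] Suc.prems(3) has_derivative_linear by blast
      then show "(\<Sum>b\<in>Basis. (?G x v \<bullet> b) *\<^sub>R ?F (g x) b) = ?F (g x) (?G x v)"
        by (metis linear_expand_Basis)
    qed fact
  qed fact
qed

lemma diff_class_inverse:
  fixes a :: "'e::euclidean_space \<Rightarrow> real"
  assumes "open S" "\<And>x. x \<in> S \<Longrightarrow> a x \<noteq> 0"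
  shows "diff_class n S a \<Longrightarrow> diff_class n S (\<lambda>x. inverse (a x))"
proof (induction n)
  case 0 then show ?case using assms by (auto intro: continuous_intros)
next
  case (Suc n)
  note a = diff_class_SucD[OF Suc.prems]
  have i: "diff_class n S (\<lambda>x. inverse (a x))" using Suc diff_class_Suc_imp by blast
  show ?case
  proof (rule diff_class_SucI[OF assms(1)])
    show "((\<lambda>x. inverse (a x)) has_derivative
        (\<lambda>v. - (inverse (a x) * frechet_derivative a (at x) v * inverse (a x)))) (at x)"
      if "x \<in> S" for x by (rule Deriv.has_derivative_inverse[OF assms(2)[OF that] a(1)[OF that]])
    show "diff_class n S (\<lambda>x. - (inverse (a x) * frechet_derivative a (at x) v * inverse (a x)))" for v
      by (intro diff_class_bounded_linear[OF bounded_linear_minus[OF bounded_linear_ident]]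
          diff_class_mult i a(2) assms)
  qed
qed

lemma smooth_on_cong: "smooth_on S f \<Longrightarrow> open S \<Longrightarrow> (\<And>x. x \<in> S \<Longrightarrow> f x = g x) \<Longrightarrow> smooth_on S g"
  and smooth_on_subset: "smooth_on S f \<Longrightarrow> T \<subseteq> S \<Longrightarrow> smooth_on T f"
  and smooth_on_const: "open S \<Longrightarrow> smooth_on S (\<lambda>x. c)"
  and smooth_on_id: "open S \<Longrightarrow> smooth_on S (\<lambda>x. x)"
  and smooth_on_add: "open S \<Longrightarrow> smooth_on S f \<Longrightarrow> smooth_on S g \<Longrightarrow> smooth_on S (\<lambda>x. f x + g x)"
  and smooth_on_sum: "open S \<Longrightarrow> (\<And>i. i \<in> I \<Longrightarrow> smooth_on S (F i)) \<Longrightarrow>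
    smooth_on S (\<lambda>x. \<Sum>i\<in>I. F i x)"
  and smooth_on_inverse: "open S \<Longrightarrow> (\<And>x. x \<in> S \<Longrightarrow> a x \<noteq> 0) \<Longrightarrow> smooth_on S a \<Longrightarrow>
    smooth_on S (\<lambda>x. inverse (a x :: real))"
  unfolding smooth_on_def
  by (auto intro: diff_class_cong diff_class_subset diff_class_const diff_class_id diff_class_add
      diff_class_sum diff_class_inverse)

lemma smooth_on_bounded_linear:
  "bounded_linear L \<Longrightarrow> open S \<Longrightarrow> smooth_on S f \<Longrightarrow> smooth_on S (\<lambda>x. L (f x))"
  and smooth_on_bilinear:
  "bounded_bilinear B \<Longrightarrow> open S \<Longrightarrow> smooth_on S f \<Longrightarrow> smooth_on S g \<Longrightarrow> smooth_on S (\<lambda>x. B (f x) (g x))"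
  unfolding smooth_on_def by (auto intro: diff_class_bounded_linear diff_class_bilinear)

lemmas smooth_on_scaleR = smooth_on_bilinear[OF bounded_bilinear_scaleR]
  and smooth_on_mult = smooth_on_bilinear[OF bounded_bilinear_mult]
  and smooth_on_inner = smooth_on_bounded_linear[OF bounded_linear_inner_left]
  and smooth_on_uminus = smooth_on_bounded_linear[OF bounded_linear_minus[OF bounded_linear_ident]]
  and smooth_on_scaleR_const = smooth_on_bounded_linear[OF bounded_linear_scaleR_right]
  and smooth_on_fst = smooth_on_bounded_linear[OF bounded_linear_fst]
  and smooth_on_snd = smooth_on_bounded_linear[OF bounded_linear_snd]

lemma smooth_on_diff:
  "open S \<Longrightarrow> smooth_on S f \<Longrightarrow> smooth_on S g \<Longrightarrow> smooth_on S (\<lambda>x. f x - g x)"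
  using smooth_on_add[OF _ _ smooth_on_uminus] by fastforce

lemma smooth_on_Pair:
  assumes "open S" "smooth_on S f" "smooth_on S g"
  shows "smooth_on S (\<lambda>x. (f x, g x))"
proof -
  have "bounded_linear (\<lambda>u. (u, 0::'c))" "bounded_linear (\<lambda>u. (0::'b, u))"
    by (auto intro!: bounded_linear_intros)
  from smooth_on_add[OF assms(1) this[THEN smooth_on_bounded_linear[OF _ assms(1)]], OF assms(2,3)]
  show ?thesis by simp
qed

lemma smooth_on_compose:
  "open S \<Longrightarrow> open T \<Longrightarrow> smooth_on S f \<Longrightarrow> smooth_on T g \<Longrightarrow> g ` T \<subseteq> S \<Longrightarrow>
    smooth_on T (\<lambda>x. f (g x))"
  unfolding smooth_on_def by (auto intro: diff_class_compose)

lemma smooth_on_imp_derivative: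
  assumes "smooth_on S f"
  shows "x \<in> S \<Longrightarrow> (f has_derivative frechet_derivative f (at x)) (at x)"
    "smooth_on S (\<lambda>x. frechet_derivative f (at x) v)"
proof -
  have *: "diff_class (Suc n) S f" for n using assms by (simp only: smooth_on_def)
  show "x \<in> S \<Longrightarrow> (f has_derivative frechet_derivative f (at x)) (at x)"
    using diff_class_SucD(1)[OF *] by blast
  show "smooth_on S (\<lambda>x. frechet_derivative f (at x) v)"
    using diff_class_SucD(2)[OF *] unfolding smooth_on_def by blast
qed

lemma smooth_on_imp_continuous_on: "smooth_on S f \<Longrightarrow> continuous_on S f"
  unfolding smooth_on_def using diff_class.simps(1) by blast

text \<open>
  Only the values of the operators on basis vectors have to be smooth. This is how the
  projection, the derivatives and the connection coefficients are handled below.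
\<close>

lemma smooth_on_apply_linear:
  assumes "open S" "\<And>x. x \<in> S \<Longrightarrow> linear (L x)" "\<And>b. b \<in> Basis \<Longrightarrow> smooth_on S (\<lambda>x. L x b)"
    "smooth_on S (u :: _ \<Rightarrow> 'd::euclidean_space)"
  shows "smooth_on S (\<lambda>x. L x (u x))"
proof (rule smooth_on_cong[of _ "\<lambda>x. \<Sum>b\<in>Basis. (u x \<bullet> b) *\<^sub>R L x b"])
  show "smooth_on S (\<lambda>x. \<Sum>b\<in>Basis. (u x \<bullet> b) *\<^sub>R L x b)"
    by (intro smooth_on_sum smooth_on_scaleR smooth_on_inner assms)
  show "(\<Sum>b\<in>Basis. (u x \<bullet> b) *\<^sub>R L x b) = L x (u x)" if "x \<in> S" for x
    using linear_expand_Basis[OF assms(2)[OF that], of "u x"] by simp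
qed fact

lemma smooth_on_coord_bracket:
  assumes "open S" "smooth_on S X" "smooth_on S Y"
  shows "smooth_on S (coord_bracket X Y)"
proof -
  have *: "smooth_on S (\<lambda>x. frechet_derivative U (at x) (W x))" if "smooth_on S U" "smooth_on S W"
    for U W :: "'a \<Rightarrow> 'a"
    by (rule smooth_on_apply_linear)
       (use that assms in \<open>auto intro: smooth_on_imp_derivative has_derivative_linear\<close>)
  have "coord_bracket X Y = (\<lambda>x. frechet_derivative Y (at x) (X x) - frechet_derivative X (at x) (Y x))"
    by (auto simp: coord_bracket_def)
  then show ?thesis using assms * by (simp add: smooth_on_diff)
qed

section \<open>Flows of smooth vector fields\<close>

lemma vector_derivative_bound:
  fixes f :: "real \<Rightarrow> 'b::real_normed_vector"
  assumes "convex S" "\<And>t. t \<in> S \<Longrightarrow> (f has_vector_derivative f' t) (at t within S)"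
    "\<And>t. t \<in> S \<Longrightarrow> norm (f' t) \<le> B" "x \<in> S" "y \<in> S"
  shows "norm (f x - f y) \<le> B * norm (x - y)"
proof (rule differentiable_bound[OF assms(1)])
  show "(f has_derivative (\<lambda>s. s *\<^sub>R f' t)) (at t within S)" if "t \<in> S" for t
    using assms(2)[OF that] by (simp add: has_vector_derivative_def)
  show "onorm (\<lambda>s. s *\<^sub>R f' t) \<le> B" if "t \<in> S" for t
    by (rule onorm_le) (use assms(3)[OF that] in \<open>simp add: mult.commute[of B] mult_left_mono\<close>)
qed (use assms in auto)

text \<open>
  Picard iteration as a contraction of the space of bounded continuous functions. Time is clamped
  to a short interval, so that the curves are defined on all of \<open>\<real>\<close>. The contraction factor \<open>1/2\<close> also yields
  the Lipschitz dependence on the initial value.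
\<close>

lemma picard_lindeloef:
  fixes f :: "'z::euclidean_space \<Rightarrow> 'z"
  assumes L: "L-lipschitz_on UNIV f"
  obtains h :: real and \<phi> :: "'z \<Rightarrow> real \<Rightarrow> 'z" where "h > 0" "\<And>z. \<phi> z 0 = z"
    "\<And>z t. \<bar>t\<bar> < h \<Longrightarrow> (\<phi> z has_vector_derivative f (\<phi> z t)) (at t)"
    "\<And>z w t. norm (\<phi> z t - \<phi> w t) \<le> 2 * norm (z - w)"
proof -
  have L0: "0 \<le> L" using L lipschitz_on_nonneg by blast
  define h where "h = 1 / (2 * L + 2)"
  have h: "h > 0" "L * h \<le> 1/2" using L0 by (auto simp: h_def field_simps)
  define clamp where "clamp t = max (-h) (min h t)" for t :: real
  have clamp: "clamp t \<in> {-h..h}" for t using h by (auto simp: clamp_def)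
  define I where "I u t = integral {-h..t} (\<lambda>s. f (apply_bcontfun u s))" for u :: "real \<Rightarrow>\<^sub>C 'z" and t
  have fc: "continuous_on X f" for X
    using lipschitz_on_continuous_on[OF L] continuous_on_subset by blast
  have uc: "continuous_on X (\<lambda>s. f (apply_bcontfun u s))" for X u
    by (rule continuous_on_compose2[OF fc[of UNIV] continuous_on_apply_bcontfun]) auto
  have dI: "(I u has_vector_derivative f (apply_bcontfun u t)) (at t within {-h..h})"
    if "t \<in> {-h..h}" for u t
    unfolding I_def by (rule integral_has_vector_derivative[OF uc that])
  define G where "G z u t = z + (I u (clamp t) - I u 0)" for z u t
  have cI: "continuous_on {-h..h} (I u)" for u
    by (rule continuous_on_vector_derivative[OF dI])
  have cG: "continuous_on UNIV (G z u)" for z u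
    unfolding G_def using clamp
    by (intro continuous_intros continuous_on_compose2[OF cI])
       (auto simp: clamp_def intro!: continuous_intros)
  have Gdiff: "norm (G z u t - G w v t) \<le> norm (z - w) + dist u v / 2" for z w u v t
  proof -
    have "norm ((I u (clamp t) - I v (clamp t)) - (I u 0 - I v 0)) \<le> (L * dist u v) * norm (clamp t - 0)"
    proof (rule vector_derivative_bound[where S = "{-h..h}" and f = "\<lambda>s. I u s - I v s"])
      show "norm (f (apply_bcontfun u s) - f (apply_bcontfun v s)) \<le> L * dist u v" for s
        using lipschitz_onD[OF L, of "apply_bcontfun u s" "apply_bcontfun v s"] dist_bounded[of u s v] L0
        by (auto simp: dist_norm intro: order_trans mult_left_mono)
    qed (use clamp h in \<open>auto intro!: has_vector_derivative_diff dI\<close>)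
    also have "\<dots> \<le> (L * dist u v) * h"
      using clamp[of t] L0 by (intro mult_left_mono) auto
    also have "\<dots> = (L * h) * dist u v" by simp
    also have "\<dots> \<le> 1/2 * dist u v" by (rule mult_right_mono) (use h in auto)
    finally have *: "norm ((I u (clamp t) - I v (clamp t)) - (I u 0 - I v 0)) \<le> dist u v / 2" by simp
    have "G z u t - G w v t = (z - w) + ((I u (clamp t) - I v (clamp t)) - (I u 0 - I v 0))"
      by (simp add: G_def)
    then show ?thesis using * norm_triangle_ineq order_trans by (metis add_left_mono)
  qed
  have "\<exists>b. \<forall>t. norm (G z u t) \<le> b" for z u
  proof -
    have "bounded (I u ` {-h..h})"
      by (intro compact_imp_bounded compact_continuous_image cI) auto
    then obtain b where b: "\<And>t. t \<in> {-h..h} \<Longrightarrow> norm (I u t) \<le> b" unfolding bounded_iff by blast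
    have "norm (G z u t) \<le> norm z + (b + norm (I u 0))" for t
      unfolding G_def using b[OF clamp] 
      by (intro order_trans[OF norm_triangle_ineq] add_left_mono order_trans[OF norm_triangle_ineq4] add_right_mono)
    then show ?thesis by blast
  qed
  then have Gb: "G z u \<in> bcontfun" for z u using cG bcontfun_normI by blast
  define T where "T z u = Bcontfun (G z u)" for z u
  have aT: "apply_bcontfun (T z u) = G z u" for z u
    unfolding T_def using Gb Bcontfun_inverse by blast
  have Td: "dist (T z u) (T w v) \<le> norm (z - w) + dist u v / 2" for z w u v
    by (rule dist_bound) (use Gdiff in \<open>simp add: aT dist_norm\<close>)
  have "\<exists>!u. T z u = u" for z
    by (rule banach_fix_type[of "1/2"]) (use Td[of z _ z] in auto)
  then obtain U where U: "\<And>z. T z (U z) = U z" by metis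
  define \<phi> where "\<phi> z = apply_bcontfun (U z)" for z
  have \<phi>: "\<phi> z t = z + (I (U z) (clamp t) - I (U z) 0)" for z t
    unfolding \<phi>_def using aT[of z "U z"] U[of z] by (simp add: G_def)
  show thesis
  proof (rule that[OF h(1)])
    show "\<phi> z 0 = z" for z using h by (simp add: \<phi> clamp_def)
    show "(\<phi> z has_vector_derivative f (\<phi> z t)) (at t)" if "\<bar>t\<bar> < h" for z t
    proof (rule has_vector_derivative_transform_within_open[of "\<lambda>t. z + (I (U z) t - I (U z) 0)"])
      have "(I (U z) has_vector_derivative f (\<phi> z t)) (at t)"
        using dI[of t "U z"] that at_within_Icc_at[of "-h" t h] by (auto simp: \<phi>_def abs_less_iff)
      then show "((\<lambda>t. z + (I (U z) t - I (U z) 0)) has_vector_derivative f (\<phi> z t)) (at t)"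
        by (auto intro!: derivative_eq_intros)
      show "z + (I (U z) s - I (U z) 0) = \<phi> z s" if "s \<in> {-h<..<h}" for s
        using that by (simp add: \<phi> clamp_def)
    qed (use that in auto)
    show "norm (\<phi> z t - \<phi> w t) \<le> 2 * norm (z - w)" for z w t
    proof -
      have "dist (U z) (U w) \<le> 2 * norm (z - w)" using Td[of z "U z" w "U w"] U by simp
      then show ?thesis using dist_bounded[of "U z" t "U w"] by (simp add: \<phi>_def dist_norm)
    qed
  qed
qed

text \<open>
  Smoothness refers to directional derivatives; compactness bounds the finitely many ones in
  basis directions, and these bound the others.
\<close>

lemma smooth_on_derivative_bound:
  fixes f :: "'e::euclidean_space \<Rightarrow> 'b::real_normed_vector"
  assumes "smooth_on S f" "compact W" "W \<subseteq> S"
  obtains L where "L \<ge> 0" "\<And>x v. x \<in> W \<Longrightarrow> norm (frechet_derivative f (at x) v) \<le> L * norm v"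
proof -
  let ?D = "\<lambda>x. frechet_derivative f (at x)"
  have "\<exists>M\<ge>0. \<forall>x\<in>W. norm (?D x b) \<le> M" for b
  proof -
    have "continuous_on W (\<lambda>x. ?D x b)"
      using smooth_on_imp_continuous_on[OF smooth_on_imp_derivative(2)[OF assms(1)]] assms(3)
        continuous_on_subset by blast
    then have "bounded ((\<lambda>x. ?D x b) ` W)"
      using assms(2) compact_imp_bounded compact_continuous_image by blast
    then show ?thesis unfolding bounded_iff by (metis image_eqI norm_ge_zero order_trans linear)
  qed
  then obtain M where M: "\<And>b. M b \<ge> 0" "\<And>b x. x \<in> W \<Longrightarrow> norm (?D x b) \<le> M b" by metis
  show thesis
  proof (rule that[of "\<Sum>b\<in>Basis. M b"])
    fix x v assume x: "x \<in> W"
    have "linear (?D x)"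
      using smooth_on_imp_derivative(1)[OF assms(1), of x] x assms(3) has_derivative_linear by blast
    from linear_expand_Basis[OF this, of v]
    have "norm (?D x v) = norm (\<Sum>b\<in>Basis. (v \<bullet> b) *\<^sub>R ?D x b)" by simp
    also have "\<dots> \<le> (\<Sum>b\<in>Basis. norm v * M b)"
      by (rule sum_norm_le) (auto intro!: mult_mono M x Basis_le_norm)
    finally show "norm (?D x v) \<le> (\<Sum>b\<in>Basis. M b) * norm v"
      by (simp add: sum_distrib_left mult.commute)
  qed (auto intro: sum_nonneg M)
qed

lemma smooth_on_lipschitz_compact:
  fixes f :: "'e::euclidean_space \<Rightarrow> 'b::real_normed_vector"
  assumes "smooth_on S f" "compact W" "W \<subseteq> S" "convex W"
  obtains L where "L \<ge> 0" "\<And>x y. x \<in> W \<Longrightarrow> y \<in> W \<Longrightarrow> norm (f x - f y) \<le> L * norm (x - y)"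
proof -
  obtain L where L: "L \<ge> 0" "\<And>x v. x \<in> W \<Longrightarrow> norm (frechet_derivative f (at x) v) \<le> L * norm v"
    using smooth_on_derivative_bound[OF assms(1-3)] by blast
  have "norm (f x - f y) \<le> L * norm (x - y)" if "x \<in> W" "y \<in> W" for x y
  proof (rule differentiable_bound[OF assms(4) _ _ that])
    show "(f has_derivative frechet_derivative f (at x)) (at x within W)" if "x \<in> W" for x
      using smooth_on_imp_derivative(1)[OF assms(1)] assms(3) that has_derivative_at_withinI by blast
    show "onorm (frechet_derivative f (at x)) \<le> L" if "x \<in> W" for x
      by (rule onorm_le) (rule L(2)[OF that])
  qed
  with L(1) that show thesis by blast
qed

lemma smooth_on_derivative_lipschitz:
  fixes f :: "'e::euclidean_space \<Rightarrow> 'b::real_normed_vector"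
  assumes "smooth_on S f" "compact W" "W \<subseteq> S" "convex W"
  obtains L where "L \<ge> 0" "\<And>x y v. x \<in> W \<Longrightarrow> y \<in> W \<Longrightarrow>
     norm (frechet_derivative f (at x) v - frechet_derivative f (at y) v) \<le> L * norm (x - y) * norm v"
proof -
  let ?D = "\<lambda>x. frechet_derivative f (at x)"
  have "\<exists>M\<ge>0. \<forall>x\<in>W. \<forall>y\<in>W. norm (?D x b - ?D y b) \<le> M * norm (x - y)" for b
    using smooth_on_lipschitz_compact[OF smooth_on_imp_derivative(2)[OF assms(1)] assms(2-4)] by metis
  then obtain M where M: "\<And>b. M b \<ge> 0"
    "\<And>b x y. x \<in> W \<Longrightarrow> y \<in> W \<Longrightarrow> norm (?D x b - ?D y b) \<le> M b * norm (x - y)" by metis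
  show thesis
  proof (rule that[of "\<Sum>b\<in>Basis. M b"])
    fix x y v assume x: "x \<in> W" "y \<in> W"
    have lin: "linear (?D x)" "linear (?D y)"
      using smooth_on_imp_derivative(1)[OF assms(1)] x assms(3) has_derivative_linear by blast+
    have "norm (?D x v - ?D y v) = norm (\<Sum>b\<in>Basis. (v \<bullet> b) *\<^sub>R (?D x b - ?D y b))"
      using linear_expand_Basis[OF lin(1), of v] linear_expand_Basis[OF lin(2), of v]
      by (simp add: sum_subtractf scaleR_diff_right)
    also have "\<dots> \<le> (\<Sum>b\<in>Basis. norm v * (M b * norm (x - y)))"
      by (rule sum_norm_le) (auto intro!: mult_mono M x Basis_le_norm)
    finally show "norm (?D x v - ?D y v) \<le> (\<Sum>b\<in>Basis. M b) * norm (x - y) * norm v"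
      by (simp add: sum_distrib_left sum_distrib_right mult_ac)
  qed (auto intro: sum_nonneg M)
qed

lemma smooth_on_taylor:
  fixes f :: "'e::euclidean_space \<Rightarrow> 'b::real_normed_vector"
  assumes "smooth_on S f" "compact W" "W \<subseteq> S" "convex W"
  obtains L where "L \<ge> 0" "\<And>x y. x \<in> W \<Longrightarrow> y \<in> W \<Longrightarrow>
     norm (f x - f y - frechet_derivative f (at y) (x - y)) \<le> L * (norm (x - y))\<^sup>2"
proof -
  let ?D = "\<lambda>x. frechet_derivative f (at x)"
  obtain L where L: "L \<ge> 0" "\<And>x y v. x \<in> W \<Longrightarrow> y \<in> W \<Longrightarrow>
     norm (?D x v - ?D y v) \<le> L * norm (x - y) * norm v"
    using smooth_on_derivative_lipschitz[OF assms] by blast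
  have "norm (f x - f y - ?D y (x - y)) \<le> L * (norm (x - y))\<^sup>2" if xy: "x \<in> W" "y \<in> W" for x y
  proof -
    have seg: "closed_segment y x \<subseteq> W" using xy assms(4) by (simp add: closed_segment_subset)
    have lin: "bounded_linear (?D y)"
      using smooth_on_imp_derivative(1)[OF assms(1), of y] xy assms(3) has_derivative_bounded_linear by blast
    have "norm ((f x - ?D y x) - (f y - ?D y y)) \<le> L * norm (x - y) * norm (x - y)"
    proof (rule differentiable_bound[OF convex_closed_segment[of y x], where f' = "\<lambda>z v. ?D z v - ?D y v"])
      fix z assume z: "z \<in> closed_segment y x"
      show "((\<lambda>z. f z - ?D y z) has_derivative (\<lambda>v. ?D z v - ?D y v)) (at z within closed_segment y x)"
        using smooth_on_imp_derivative(1)[OF assms(1), of z] seg z assms(3)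
        by (intro has_derivative_diff bounded_linear_imp_has_derivative lin)
           (auto intro: has_derivative_at_withinI)
      show "onorm (\<lambda>v. ?D z v - ?D y v) \<le> L * norm (x - y)"
      proof (rule onorm_le)
        fix v
        have "norm (?D z v - ?D y v) \<le> L * norm (z - y) * norm v" using L(2) z seg xy by blast
        also have "\<dots> \<le> L * norm (x - y) * norm v"
          using segment_bound[OF z] L(1) by (intro mult_right_mono mult_left_mono) (auto simp: norm_minus_commute)
        finally show "norm (?D z v - ?D y v) \<le> L * norm (x - y) * norm v" .
      qed
    qed auto
    moreover have "(f x - ?D y x) - (f y - ?D y y) = f x - f y - ?D y (x - y)"
      using linear_diff[OF bounded_linear.linear[OF lin], of x y]
      by simp
    ultimately show ?thesis by (simp add: power2_eq_square mult.assoc)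
  qed
  with L(1) that show thesis by blast
qed

text \<open>
  A smooth field is Lipschitz only on compact convex sets. Composing it with the nearest point
  projection onto \<open>W\<close> gives a globally Lipschitz field with the same solutions as long as they stay
  in \<open>W\<close>, which they do for a time that is uniform over the compact set \<open>W0\<close> of initial values.
\<close>

lemma local_flow:
  fixes f :: "'z::euclidean_space \<Rightarrow> 'z"
  assumes f: "smooth_on S f" and W: "compact W" "convex W" "W \<subseteq> S"
    and W0: "compact W0" "W0 \<subseteq> interior W"
  obtains h C :: real and \<phi> :: "'z \<Rightarrow> real \<Rightarrow> 'z" where "h > 0" "C \<ge> 0" "\<And>z. \<phi> z 0 = z"
    "\<And>z t. z \<in> W0 \<Longrightarrow> \<bar>t\<bar> < h \<Longrightarrow> \<phi> z t \<in> interior W"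
    "\<And>z t. z \<in> W0 \<Longrightarrow> \<bar>t\<bar> < h \<Longrightarrow> (\<phi> z has_vector_derivative f (\<phi> z t)) (at t)"
    "\<And>t. continuous_on UNIV (\<lambda>z. \<phi> z t)"
    "\<And>z t. z \<in> W0 \<Longrightarrow> \<bar>t\<bar> < h \<Longrightarrow> norm (\<phi> z t - z - t *\<^sub>R f z) \<le> C * t\<^sup>2"
proof (cases "W0 = {}")
  case True
  show ?thesis by (rule that[of 1 0 "\<lambda>z t. z"]) (use True in auto)
next
  case False
  then have ne: "W \<noteq> {}" using W0 interior_subset by blast
  obtain L where L: "L \<ge> 0" "\<And>x y. x \<in> W \<Longrightarrow> y \<in> W \<Longrightarrow> norm (f x - f y) \<le> L * norm (x - y)"
    using smooth_on_lipschitz_compact[OF f W(1,3,2)] by blast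
  define F where "F z = f (closest_point W z)" for z
  note cW = compact_imp_closed[OF W(1)]
  have cp: "closest_point W z \<in> W" for z using closest_point_in_set[OF cW ne] .
  have "L-lipschitz_on UNIV F"
  proof (rule lipschitz_onI)
    fix x y
    have "dist (F x) (F y) \<le> L * dist (closest_point W x) (closest_point W y)"
      unfolding F_def using L(2)[OF cp cp] by (simp add: dist_norm)
    also have "\<dots> \<le> L * dist x y"
      using closest_point_lipschitz[OF W(2) cW ne] L(1) by (intro mult_left_mono)
    finally show "dist (F x) (F y) \<le> L * dist x y" .
  qed fact
  then obtain h \<phi> where h: "h > 0" and \<phi>: "\<And>z. \<phi> z 0 = z"
    "\<And>z t. \<bar>t\<bar> < h \<Longrightarrow> (\<phi> z has_vector_derivative F (\<phi> z t)) (at t)"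
    "\<And>z w t. norm (\<phi> z t - \<phi> w t) \<le> 2 * norm (z - w)"
    using picard_lindeloef by metis
  have "bounded (f ` W)"
    using compact_imp_bounded[OF compact_continuous_image] W(1,3) smooth_on_imp_continuous_on[OF f]
      continuous_on_subset by blast
  then obtain B where B: "B > 0" "\<And>z. z \<in> W \<Longrightarrow> norm (f z) \<le> B" by (auto simp: bounded_pos)
  have FB: "norm (F z) \<le> B" for z unfolding F_def by (rule B(2)[OF cp])
  obtain e where e: "e > 0" "(\<Union>x\<in>W0. ball x e) \<subseteq> interior W"
    using compact_subset_open_imp_ball_epsilon_subset[OF W0(1) open_interior W0(2)] by blast
  define h' where "h' = min h (e / B)"
  have h': "h' > 0" "h' \<le> h" "h' * B \<le> e" using h e(1) B(1) by (auto simp: h'_def min_def field_simps)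
  have dw: "(\<phi> z has_vector_derivative F (\<phi> z t)) (at t within T)" if "\<bar>t\<bar> < h'" for z t T
    using \<phi>(2)[of t z] that h'(2) by (simp add: has_vector_derivative_at_within)
  have move: "norm (\<phi> z t - z) \<le> B * \<bar>t\<bar>" if "\<bar>t\<bar> < h'" for z t
    using vector_derivative_bound[of "{-h'<..<h'}" "\<phi> z" "\<lambda>t. F (\<phi> z t)" B t 0] dw FB that h'(1)
    by (simp add: \<phi>(1) abs_less_iff)
  have inW: "\<phi> z t \<in> interior W" if "z \<in> W0" "\<bar>t\<bar> < h'" for z t
  proof -
    have "norm (\<phi> z t - z) < e"
      using move[OF that(2), of z] that(2) h'(3) B(1) by (smt (verit) mult_strict_right_mono mult.commute)
    then have "\<phi> z t \<in> ball z e" by (simp add: dist_norm norm_minus_commute)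
    then show ?thesis using e(2) that(1) by blast
  qed
  have Ff: "F z = f z" if "z \<in> W" for z using closest_point_self[OF that] by (simp add: F_def)
  have iW: "z \<in> interior W \<Longrightarrow> z \<in> W" for z using interior_subset by blast
  show ?thesis
  proof (rule that[OF h'(1), of "L * B" \<phi>])
    show "0 \<le> L * B" using L(1) B(1) by simp
    show "continuous_on UNIV (\<lambda>z. \<phi> z t)" for t
      using \<phi>(3) by (intro lipschitz_on_continuous_on[of 2] lipschitz_onI) (auto simp: dist_norm)
    show "(\<phi> z has_vector_derivative f (\<phi> z t)) (at t)" if "z \<in> W0" "\<bar>t\<bar> < h'" for z t
      using dw[OF that(2), of z UNIV] Ff[OF iW[OF inW[OF that]]] by simp
    show "norm (\<phi> z t - z - t *\<^sub>R f z) \<le> L * B * t\<^sup>2" if "z \<in> W0" "\<bar>t\<bar> < h'" for z t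
    proof -
      let ?S = "{-\<bar>t\<bar>..\<bar>t\<bar>}"
      have "norm ((\<phi> z t - t *\<^sub>R f z) - (\<phi> z 0 - 0 *\<^sub>R f z)) \<le> (L * (B * \<bar>t\<bar>)) * norm (t - 0)"
      proof (rule vector_derivative_bound[of ?S, where f' = "\<lambda>s. F (\<phi> z s) - f z"])
        fix s assume s: "s \<in> ?S"
        then have s': "\<bar>s\<bar> < h'" "\<bar>s\<bar> \<le> \<bar>t\<bar>" using that by auto
        show "((\<lambda>t. \<phi> z t - t *\<^sub>R f z) has_vector_derivative F (\<phi> z s) - f z) (at s within ?S)"
          using dw[OF s'(1)] by (auto intro!: derivative_eq_intros)
        have zW: "z \<in> W" using that W0(2) interior_subset by blast
        have "norm (F (\<phi> z s) - f z) \<le> L * norm (\<phi> z s - z)"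
          using Ff[OF iW[OF inW[OF that(1) s'(1)]]] L(2)[OF iW[OF inW[OF that(1) s'(1)]] zW] by simp
        also have "\<dots> \<le> L * (B * \<bar>t\<bar>)"
          using move[OF s'(1), of z] s'(2) B(1) L(1)
          by (intro mult_left_mono order_trans[OF move[OF s'(1), of z]]) auto
        finally show "norm (F (\<phi> z s) - f z) \<le> L * (B * \<bar>t\<bar>)" .
      qed auto
      then show ?thesis by (simp add: \<phi>(1) power2_eq_square algebra_simps)
    qed
  qed (use inW \<phi>(1) in auto)
qed

text \<open>
  Bootstrapping: if the solution is of class \<open>C\<^sup>n\<close>, then its derivative \<open>f \<circ> z\<close> is as well.
\<close>

lemma smooth_on_ode_solution:
  fixes f :: "'z::euclidean_space \<Rightarrow> 'z"
  assumes "open S" "smooth_on S f" "open J" "\<And>t. t \<in> J \<Longrightarrow> z t \<in> S"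
    "\<And>t. t \<in> J \<Longrightarrow> (z has_vector_derivative f (z t)) (at t)"
  shows "smooth_on J z"
proof -
  have "diff_class n J z" for n
  proof (induction n)
    case 0
    show ?case using assms(5)
      by (auto intro!: continuous_at_imp_continuous_on has_vector_derivative_continuous)
  next
    case (Suc n)
    show ?case
    proof (rule diff_class_SucI[OF assms(3), where f' = "\<lambda>t v. v *\<^sub>R f (z t)"])
      show "(z has_derivative (\<lambda>v. v *\<^sub>R f (z t))) (at t)" if "t \<in> J" for t
        using assms(5)[OF that] by (simp add: has_vector_derivative_def)
      have "diff_class n J (\<lambda>t. f (z t))"
        by (rule diff_class_compose[OF assms(1,3) _ Suc])
           (use assms(2,4) in \<open>auto simp: smooth_on_def\<close>)
      then show "diff_class n J (\<lambda>t. v *\<^sub>R f (z t))" for v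
        by (rule diff_class_bounded_linear[OF bounded_linear_scaleR_right assms(3)])
    qed
  qed
  then show ?thesis by (simp add: smooth_on_def)
qed

section \<open>Fields along which points can be moved\<close>

text \<open>
  A continuous family of moves along \<open>R\<close> that follows the prescribed maps \<open>W p\<close> up to an error \<open>e\<close>.
  Continuity in the parameter and the starting point together is what Brouwer's theorem asks for
  in the end, and it survives composition.
\<close>

definition near_map :: "('e \<Rightarrow> 'e \<Rightarrow> bool) \<Rightarrow> 'p::topological_space set \<Rightarrow> 'e::euclidean_space set \<Rightarrow>
    ('p \<Rightarrow> 'e \<Rightarrow> 'e) \<Rightarrow> real \<Rightarrow> bool" where
  "near_map R P X W e \<longleftrightarrow> (\<exists>\<Phi>. continuous_on (P \<times> X) \<Phi> \<and>
     (\<forall>p\<in>P. \<forall>y\<in>X. R y (\<Phi> (p, y)) \<and> norm (\<Phi> (p, y) - W p y) \<le> e))"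

text \<open>
  The field can be imitated to first order: for short times \<open>h\<close> there are moves along \<open>R\<close> from \<open>y\<close> to
  \<open>y + h Z(y) + o(h)\<close>. The moves for different \<open>h\<close> may
  be unrelated.
\<close>

definition attainable :: "('e \<Rightarrow> 'e \<Rightarrow> bool) \<Rightarrow> 'e::euclidean_space \<Rightarrow> 'p::topological_space set \<Rightarrow>
    ('p \<Rightarrow> 'e \<Rightarrow> 'e) \<Rightarrow> bool" where
  "attainable R x0 P Z \<longleftrightarrow> (\<exists>r>0. \<forall>\<eta>>0. \<forall>\<^sub>F h in at_right 0.
     near_map R P (cball x0 r) (\<lambda>p y. y + h *\<^sub>R Z p y) (\<eta> * h))"

text \<open>
  Imitation of \<open>y + s a(y) + s\<^sup>2 b(y)\<close> up to \<open>O(s\<^sup>3)\<close>, the accuracy that commutators need.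
\<close>

definition second_order_attainable :: "('e \<Rightarrow> 'e \<Rightarrow> bool) \<Rightarrow> 'e::euclidean_space \<Rightarrow> 'p::topological_space set \<Rightarrow>
    ('p \<Rightarrow> 'e \<Rightarrow> 'e) \<Rightarrow> ('p \<Rightarrow> 'e \<Rightarrow> 'e) \<Rightarrow> bool" where
  "second_order_attainable R x0 P a b \<longleftrightarrow> (\<exists>r>0. \<exists>C\<ge>0. \<forall>\<^sub>F s in at_right 0.
     near_map R P (cball x0 r) (\<lambda>p y. y + s *\<^sub>R a p y + s\<^sup>2 *\<^sub>R b p y) (C * s ^ 3))"

lemma near_map_weaken:
  assumes "near_map R P X W e" "X' \<subseteq> X"
    "\<And>p y. p \<in> P \<Longrightarrow> y \<in> X' \<Longrightarrow> norm (W p y - W' p y) + e \<le> e'"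
  shows "near_map R P X' W' e'"
proof -
  obtain \<Phi> where \<Phi>: "continuous_on (P \<times> X) \<Phi>"
    "\<And>p y. p \<in> P \<Longrightarrow> y \<in> X \<Longrightarrow> R y (\<Phi> (p, y)) \<and> norm (\<Phi> (p, y) - W p y) \<le> e"
    using assms(1) unfolding near_map_def by metis
  have "norm (\<Phi> (p, y) - W' p y) \<le> e'" if "p \<in> P" "y \<in> X'" for p y
    using norm_triangle_ineq[of "\<Phi> (p, y) - W p y" "W p y - W' p y"] \<Phi>(2)[of p y] assms(2)
      assms(3)[OF that] that by force
  moreover have "continuous_on (P \<times> X') \<Phi>"
    using \<Phi>(1) assms(2) by (metis Sigma_mono continuous_on_subset order_refl)
  ultimately show ?thesis unfolding near_map_def using \<Phi>(2) assms(2) by blast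
qed

lemma near_map_reparam:
  assumes "near_map R P X W e" "continuous_on Q \<theta>" "\<theta> ` Q \<subseteq> P"
  shows "near_map R Q X (\<lambda>q. W (\<theta> q)) e"
proof -
  obtain \<Phi> where \<Phi>: "continuous_on (P \<times> X) \<Phi>"
    "\<And>p y. p \<in> P \<Longrightarrow> y \<in> X \<Longrightarrow> R y (\<Phi> (p, y)) \<and> norm (\<Phi> (p, y) - W p y) \<le> e"
    using assms(1) unfolding near_map_def by metis
  have "continuous_on (Q \<times> X) (\<lambda>z. \<Phi> (\<theta> (fst z), snd z))"
    by (rule continuous_on_compose2[OF \<Phi>(1)])
       (use assms(3) in \<open>auto intro!: continuous_intros continuous_on_compose2[OF assms(2)]\<close>)
  then show ?thesis unfolding near_map_def
    by (intro exI[of _ "\<lambda>z. \<Phi> (\<theta> (fst z), snd z)"]) (use \<Phi>(2) assms(3) in auto)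
qed

text \<open>
  A move that starts from the end of the first one meets the second family at a slightly wrong
  point \<open>u\<close>; the last assumption is the estimate that absorbs this.
\<close>

lemma near_map_compose:
  assumes "transp R" "near_map R P X W1 e1" "near_map R P X' W2 e2"
    and "\<And>p y u. p \<in> P \<Longrightarrow> y \<in> X \<Longrightarrow> norm (u - W1 p y) \<le> e1 \<Longrightarrow>
      u \<in> X' \<and> norm (W2 p u - W p y) + e2 \<le> e"
  shows "near_map R P X W e"
proof -
  obtain \<Phi> where \<Phi>: "continuous_on (P \<times> X) \<Phi>"
    "\<And>p y. p \<in> P \<Longrightarrow> y \<in> X \<Longrightarrow> R y (\<Phi> (p, y)) \<and> norm (\<Phi> (p, y) - W1 p y) \<le> e1"
    using assms(2) unfolding near_map_def by metis
  obtain \<Psi> where \<Psi>: "continuous_on (P \<times> X') \<Psi>"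
    "\<And>p y. p \<in> P \<Longrightarrow> y \<in> X' \<Longrightarrow> R y (\<Psi> (p, y)) \<and> norm (\<Psi> (p, y) - W2 p y) \<le> e2"
    using assms(3) unfolding near_map_def by metis
  have "continuous_on (P \<times> X) (\<lambda>z. \<Psi> (fst z, \<Phi> z))"
    by (rule continuous_on_compose2[OF \<Psi>(1)])
       (use \<Phi> assms(4) in \<open>auto intro!: continuous_intros\<close>)
  moreover have "R y (\<Psi> (p, \<Phi> (p, y))) \<and> norm (\<Psi> (p, \<Phi> (p, y)) - W p y) \<le> e"
    if py: "p \<in> P" "y \<in> X" for p y
  proof -
    let ?u = "\<Phi> (p, y)"
    have u: "R y ?u" "?u \<in> X'" "norm (W2 p ?u - W p y) + e2 \<le> e"
      using \<Phi>(2)[OF py] assms(4)[OF py] by auto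
    show ?thesis
      using norm_triangle_ineq[of "\<Psi> (p, ?u) - W2 p ?u" "W2 p ?u - W p y"] \<Psi>(2)[OF py(1) u(2)] u(1,3)
        transpD[OF assms(1)] by fastforce
  qed
  ultimately show ?thesis unfolding near_map_def
    by (intro exI[of _ "\<lambda>z. \<Psi> (fst z, \<Phi> z)"]) simp
qed

lemma eventually_small: "\<epsilon> > 0 \<Longrightarrow> \<forall>\<^sub>F h in at_right (0::real). K * h \<le> \<epsilon>"
proof -
  assume "\<epsilon> > 0"
  have "\<forall>\<^sub>F h in at_right 0. h < \<epsilon> / (\<bar>K\<bar> + 1)"
    unfolding eventually_at_right_field
    by (rule exI[of _ "\<epsilon> / (\<bar>K\<bar> + 1)"]) (use \<open>\<epsilon> > 0\<close> in auto)
  moreover have "\<forall>\<^sub>F h in at_right (0::real). h > 0" by (rule eventually_at_right_less)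
  ultimately show ?thesis
  proof eventually_elim
    case (elim h)
    have "K * h \<le> (\<bar>K\<bar> + 1) * h" using elim by (intro mult_right_mono) auto
    also have "\<dots> \<le> \<epsilon>" using elim by (simp add: field_simps)
    finally show ?case .
  qed
qed

definition lip_family :: "'e::euclidean_space \<Rightarrow> 'p set \<Rightarrow> ('p \<Rightarrow> 'e \<Rightarrow> 'e) \<Rightarrow> bool" where
  "lip_family x0 P Z \<longleftrightarrow> (\<exists>r>0. \<exists>M\<ge>0. \<forall>p\<in>P. \<forall>y\<in>cball x0 r. norm (Z p y) \<le> M \<and>
     (\<forall>z\<in>cball x0 r. norm (Z p z - Z p y) \<le> M * norm (z - y)))"

text \<open>
  The quantitative form of twice continuous differentiability that the expansions below consume;
  \<open>D\<close> is the derivative in the second argument.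
\<close>

definition c2_family :: "'e::euclidean_space \<Rightarrow> 'p set \<Rightarrow> ('p \<Rightarrow> 'e \<Rightarrow> 'e) \<Rightarrow>
    ('p \<Rightarrow> 'e \<Rightarrow> 'e \<Rightarrow> 'e) \<Rightarrow> bool" where
  "c2_family x0 P Z D \<longleftrightarrow> (\<exists>r>0. \<exists>M\<ge>0. \<forall>p\<in>P. \<forall>y\<in>cball x0 r.
     norm (Z p y) \<le> M \<and> linear (D p y) \<and> (\<forall>u. norm (D p y u) \<le> M * norm u) \<and>
     (\<forall>z\<in>cball x0 r. norm (Z p z - Z p y - D p y (z - y)) \<le> M * (norm (z - y))\<^sup>2 \<and>
        (\<forall>u. norm (D p z u - D p y u) \<le> M * norm (z - y) * norm u)))"

lemma lip_familyI:
  assumes "r > 0" "M \<ge> 0" "\<And>p y. p \<in> P \<Longrightarrow> y \<in> cball x0 r \<Longrightarrow> norm (Z p y) \<le> M"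
    "\<And>p y z. p \<in> P \<Longrightarrow> y \<in> cball x0 r \<Longrightarrow> z \<in> cball x0 r \<Longrightarrow> norm (Z p z - Z p y) \<le> M * norm (z - y)"
  shows "lip_family x0 P Z"
  unfolding lip_family_def using assms by blast

lemma lip_familyE:
  assumes "lip_family x0 P Z"
  obtains r M where "r > 0" "M \<ge> 0" "\<And>p y. p \<in> P \<Longrightarrow> y \<in> cball x0 r \<Longrightarrow> norm (Z p y) \<le> M"
    "\<And>p y z. p \<in> P \<Longrightarrow> y \<in> cball x0 r \<Longrightarrow> z \<in> cball x0 r \<Longrightarrow> norm (Z p z - Z p y) \<le> M * norm (z - y)"
  using assms unfolding lip_family_def by blast

lemma c2_familyE:
  assumes "c2_family x0 P Z D"
  obtains r M where "r > 0" "M \<ge> 0" "\<And>p y. p \<in> P \<Longrightarrow> y \<in> cball x0 r \<Longrightarrow> norm (Z p y) \<le> M"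
    "\<And>p y. p \<in> P \<Longrightarrow> y \<in> cball x0 r \<Longrightarrow> linear (D p y)"
    "\<And>p y u. p \<in> P \<Longrightarrow> y \<in> cball x0 r \<Longrightarrow> norm (D p y u) \<le> M * norm u"
    "\<And>p y z. p \<in> P \<Longrightarrow> y \<in> cball x0 r \<Longrightarrow> z \<in> cball x0 r \<Longrightarrow>
      norm (Z p z - Z p y - D p y (z - y)) \<le> M * (norm (z - y))\<^sup>2"
    "\<And>p y z u. p \<in> P \<Longrightarrow> y \<in> cball x0 r \<Longrightarrow> z \<in> cball x0 r \<Longrightarrow>
      norm (D p z u - D p y u) \<le> M * norm (z - y) * norm u"
proof -
  obtain r M where "r > 0" "M \<ge> 0" "\<forall>p\<in>P. \<forall>y\<in>cball x0 r.
     norm (Z p y) \<le> M \<and> linear (D p y) \<and> (\<forall>u. norm (D p y u) \<le> M * norm u) \<and>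
     (\<forall>z\<in>cball x0 r. norm (Z p z - Z p y - D p y (z - y)) \<le> M * (norm (z - y))\<^sup>2 \<and>
        (\<forall>u. norm (D p z u - D p y u) \<le> M * norm (z - y) * norm u))"
    using assms unfolding c2_family_def by blast
  then show thesis by (intro that[of r M]) blast+
qed

lemma lip_family_add:
  assumes "lip_family x0 P Z" "lip_family x0 P Z'"
  shows "lip_family x0 P (\<lambda>p y. Z p y + Z' p y)"
proof -
  obtain r M where 1: "r > 0" "M \<ge> 0" "\<And>p y. p \<in> P \<Longrightarrow> y \<in> cball x0 r \<Longrightarrow> norm (Z p y) \<le> M"
    "\<And>p y z. p \<in> P \<Longrightarrow> y \<in> cball x0 r \<Longrightarrow> z \<in> cball x0 r \<Longrightarrow> norm (Z p z - Z p y) \<le> M * norm (z - y)"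
    by (rule lip_familyE[OF assms(1)]) (rule that)
  obtain r' M' where 2: "r' > 0" "M' \<ge> 0" "\<And>p y. p \<in> P \<Longrightarrow> y \<in> cball x0 r' \<Longrightarrow> norm (Z' p y) \<le> M'"
    "\<And>p y z. p \<in> P \<Longrightarrow> y \<in> cball x0 r' \<Longrightarrow> z \<in> cball x0 r' \<Longrightarrow> norm (Z' p z - Z' p y) \<le> M' * norm (z - y)"
    by (rule lip_familyE[OF assms(2)]) (rule that)
  show ?thesis
  proof (rule lip_familyI[of "min r r'" "M + M'"])
    fix p y z assume p: "p \<in> P" "y \<in> cball x0 (min r r')"
    then have y: "y \<in> cball x0 r" "y \<in> cball x0 r'" by auto
    show "norm (Z p y + Z' p y) \<le> M + M'"
      using 1(3)[OF p(1) y(1)] 2(3)[OF p(1) y(2)] norm_triangle_mono by blast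
    assume "z \<in> cball x0 (min r r')"
    then have z: "z \<in> cball x0 r" "z \<in> cball x0 r'" by auto
    have "Z p z + Z' p z - (Z p y + Z' p y) = (Z p z - Z p y) + (Z' p z - Z' p y)" by simp
    then show "norm (Z p z + Z' p z - (Z p y + Z' p y)) \<le> (M + M') * norm (z - y)"
      using norm_triangle_mono[OF 1(4)[OF p(1) y(1) z(1)] 2(4)[OF p(1) y(2) z(2)]]
      by (simp only: distrib_right)
  qed (use 1 2 in auto)
qed

lemma lip_family_scaleR:
  assumes "lip_family x0 P Z"
  shows "lip_family x0 P (\<lambda>p y. c *\<^sub>R Z p y)"
proof -
  obtain r M where 1: "r > 0" "M \<ge> 0" "\<And>p y. p \<in> P \<Longrightarrow> y \<in> cball x0 r \<Longrightarrow> norm (Z p y) \<le> M"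
    "\<And>p y z. p \<in> P \<Longrightarrow> y \<in> cball x0 r \<Longrightarrow> z \<in> cball x0 r \<Longrightarrow> norm (Z p z - Z p y) \<le> M * norm (z - y)"
    by (rule lip_familyE[OF assms(1)]) (rule that)
  show ?thesis
    by (rule lip_familyI[of r "\<bar>c\<bar> * M"])
       (use 1 in \<open>simp_all add: scaleR_diff_right[symmetric] mult.assoc mult_left_mono del: scaleR_diff_right mem_cball\<close>)
qed

lemma lip_family_c2:
  assumes "c2_family x0 P Z D"
  shows "lip_family x0 P Z"
proof -
  obtain r M where c: "r > 0" "M \<ge> 0" "\<And>p y. p \<in> P \<Longrightarrow> y \<in> cball x0 r \<Longrightarrow> norm (Z p y) \<le> M"
    "\<And>p y. p \<in> P \<Longrightarrow> y \<in> cball x0 r \<Longrightarrow> linear (D p y)"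
    "\<And>p y u. p \<in> P \<Longrightarrow> y \<in> cball x0 r \<Longrightarrow> norm (D p y u) \<le> M * norm u"
    "\<And>p y z. p \<in> P \<Longrightarrow> y \<in> cball x0 r \<Longrightarrow> z \<in> cball x0 r \<Longrightarrow>
      norm (Z p z - Z p y - D p y (z - y)) \<le> M * (norm (z - y))\<^sup>2"
    "\<And>p y z u. p \<in> P \<Longrightarrow> y \<in> cball x0 r \<Longrightarrow> z \<in> cball x0 r \<Longrightarrow>
      norm (D p z u - D p y u) \<le> M * norm (z - y) * norm u"
    by (rule c2_familyE[OF assms]) (rule that)
  show ?thesis
  proof (rule lip_familyI[of r "M + M * (2 * r)"])
    fix p y z assume p: "p \<in> P" "y \<in> cball x0 r"
    show "norm (Z p y) \<le> M + M * (2 * r)" using c(1,2) order_trans[OF c(3)[OF p], of "M + M * (2 * r)"] by simp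
    assume z: "z \<in> cball x0 r"
    have d: "norm (z - y) \<le> 2 * r"
      using p(2) z dist_triangle2[of z y x0] by (simp add: dist_norm norm_minus_commute)
    have "norm (Z p z - Z p y) \<le> M * norm (z - y) + M * (norm (z - y))\<^sup>2"
      using norm_triangle_mono[OF c(5)[OF p, of "z - y"] c(6)[OF p z]] by (simp add: algebra_simps)
    also have "\<dots> \<le> M * norm (z - y) + M * (2 * r) * norm (z - y)"
      using mult_left_mono[OF mult_right_mono[OF d, of "norm (z - y)"] c(2)]
      by (simp add: power2_eq_square mult.assoc)
    finally show "norm (Z p z - Z p y) \<le> (M + M * (2 * r)) * norm (z - y)" by (simp add: algebra_simps)
  qed (use c in auto)
qed

lemma lip_family_deriv:
  assumes "c2_family x0 P Z D" "lip_family x0 P a"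
  shows "lip_family x0 P (\<lambda>p y. D p y (a p y))"
proof -
  obtain r M where c: "r > 0" "M \<ge> 0" "\<And>p y. p \<in> P \<Longrightarrow> y \<in> cball x0 r \<Longrightarrow> norm (Z p y) \<le> M"
    "\<And>p y. p \<in> P \<Longrightarrow> y \<in> cball x0 r \<Longrightarrow> linear (D p y)"
    "\<And>p y u. p \<in> P \<Longrightarrow> y \<in> cball x0 r \<Longrightarrow> norm (D p y u) \<le> M * norm u"
    "\<And>p y z. p \<in> P \<Longrightarrow> y \<in> cball x0 r \<Longrightarrow> z \<in> cball x0 r \<Longrightarrow>
      norm (Z p z - Z p y - D p y (z - y)) \<le> M * (norm (z - y))\<^sup>2"
    "\<And>p y z u. p \<in> P \<Longrightarrow> y \<in> cball x0 r \<Longrightarrow> z \<in> cball x0 r \<Longrightarrow>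
      norm (D p z u - D p y u) \<le> M * norm (z - y) * norm u"
    by (rule c2_familyE[OF assms(1)]) (rule that)
  obtain r' M' where 2: "r' > 0" "M' \<ge> 0" "\<And>p y. p \<in> P \<Longrightarrow> y \<in> cball x0 r' \<Longrightarrow> norm (a p y) \<le> M'"
    "\<And>p y z. p \<in> P \<Longrightarrow> y \<in> cball x0 r' \<Longrightarrow> z \<in> cball x0 r' \<Longrightarrow> norm (a p z - a p y) \<le> M' * norm (z - y)"
    by (rule lip_familyE[OF assms(2)]) (rule that)
  show ?thesis
  proof (rule lip_familyI[of "min r r'" "M * M' + M * M'"])
    fix p y z assume p: "p \<in> P" "y \<in> cball x0 (min r r')"
    then have y: "y \<in> cball x0 r" "y \<in> cball x0 r'" by auto
    have "norm (D p y (a p y)) \<le> M * M'"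
      using c(5)[OF p(1) y(1), of "a p y"] 2(3)[OF p(1) y(2)] c(2) mult_left_mono order_trans by blast
    then show "norm (D p y (a p y)) \<le> M * M' + M * M'" using c(2) 2(2) by (smt (verit) mult_nonneg_nonneg)
    assume "z \<in> cball x0 (min r r')"
    then have z: "z \<in> cball x0 r" "z \<in> cball x0 r'" by auto
    have 3: "norm (D p z (a p z) - D p y (a p z)) \<le> M * norm (z - y) * M'"
      by (rule order_trans[OF c(7)[OF p(1) y(1) z(1)]])
         (use 2(3)[OF p(1) z(2)] c(2) in \<open>auto intro: mult_left_mono\<close>)
    have 4: "norm (D p y (a p z - a p y)) \<le> M * (M' * norm (z - y))"
      by (rule order_trans[OF c(5)[OF p(1) y(1)] mult_left_mono[OF 2(4)[OF p(1) y(2) z(2)] c(2)]])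
    show "norm (D p z (a p z) - D p y (a p y)) \<le> (M * M' + M * M') * norm (z - y)"
      using norm_triangle_mono[OF 3 4] linear_diff[OF c(4)[OF p(1) y(1)]] by (simp add: algebra_simps)
  qed (use c 2 in auto)
qed

lemma c2_family_smooth:
  assumes "open U" "smooth_on U X" "x0 \<in> U" "\<And>p. p \<in> P \<Longrightarrow> \<bar>c p\<bar> \<le> 1"
  shows "c2_family x0 P (\<lambda>p y. c p *\<^sub>R X y) (\<lambda>p y u. c p *\<^sub>R frechet_derivative X (at y) u)"
proof -
  let ?D = "\<lambda>y. frechet_derivative X (at y)"
  obtain r where r: "r > 0" "cball x0 r \<subseteq> U" using assms(1,3) open_contains_cball by blast
  have "bounded (X ` cball x0 r)"
    using compact_imp_bounded compact_continuous_image smooth_on_imp_continuous_on[OF assms(2)] r(2)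
      continuous_on_subset compact_cball by metis
  then obtain M1 where M1: "\<And>y. y \<in> cball x0 r \<Longrightarrow> norm (X y) \<le> M1" unfolding bounded_iff by blast
  obtain M2 where M2: "\<And>y u. y \<in> cball x0 r \<Longrightarrow> norm (?D y u) \<le> M2 * norm u"
    using smooth_on_derivative_bound[OF assms(2) compact_cball r(2)] by metis
  obtain M3 where M3: "\<And>z y. z \<in> cball x0 r \<Longrightarrow> y \<in> cball x0 r \<Longrightarrow>
      norm (X z - X y - ?D y (z - y)) \<le> M3 * (norm (z - y))\<^sup>2"
    using smooth_on_taylor[OF assms(2) compact_cball r(2) convex_cball] by metis
  obtain M4 where M4: "\<And>z y u. z \<in> cball x0 r \<Longrightarrow> y \<in> cball x0 r \<Longrightarrow>
      norm (?D z u - ?D y u) \<le> M4 * norm (z - y) * norm u"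
    using smooth_on_derivative_lipschitz[OF assms(2) compact_cball r(2) convex_cball] by metis
  define M where "M = \<bar>M1\<bar> + \<bar>M2\<bar> + \<bar>M3\<bar> + \<bar>M4\<bar>"
  have MM: "0 \<le> M" "M1 \<le> M" "M2 \<le> M" "M3 \<le> M" "M4 \<le> M" by (auto simp: M_def)
  have sc: "norm (c p *\<^sub>R v) \<le> K" if "p \<in> P" "norm v \<le> K" for p v K
    using assms(4)[OF that(1)] that(2) mult_mono[of "\<bar>c p\<bar>" 1 "norm v" K] by simp
  show ?thesis unfolding c2_family_def
  proof (rule exI[of _ r], intro conjI, rule r(1), rule exI[of _ M], intro conjI ballI allI)
    fix p y assume p: "p \<in> P" and y: "y \<in> cball x0 r"
    show "norm (c p *\<^sub>R X y) \<le> M" by (rule sc[OF p]) (use M1[OF y] MM in simp)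
    have "linear (?D y)"
      using smooth_on_imp_derivative(1)[OF assms(2)] y r(2) has_derivative_linear by blast
    then show "linear (\<lambda>u. c p *\<^sub>R ?D y u)" by (rule linear_compose_scale_right)
    show "norm (c p *\<^sub>R ?D y u) \<le> M * norm u" for u
      by (rule sc[OF p], rule order_trans[OF M2[OF y]]) (intro mult_right_mono MM norm_ge_zero)
    fix z assume z: "z \<in> cball x0 r"
    show "norm (c p *\<^sub>R X z - c p *\<^sub>R X y - c p *\<^sub>R ?D y (z - y)) \<le> M * (norm (z - y))\<^sup>2"
      unfolding scaleR_diff_right[symmetric]
      by (rule sc[OF p], rule order_trans[OF M3[OF z y]]) (intro mult_right_mono MM zero_le_power2)
    show "norm (c p *\<^sub>R ?D z u - c p *\<^sub>R ?D y u) \<le> M * norm (z - y) * norm u" for u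
      unfolding scaleR_diff_right[symmetric]
      by (rule sc[OF p], rule order_trans[OF M4[OF z y]]) (intro mult_right_mono MM norm_ge_zero)
  qed (use MM in auto)
qed

lemma attainable_reparam:
  assumes "attainable R x0 P Z" "continuous_on Q \<theta>" "\<theta> ` Q \<subseteq> P"
  shows "attainable R x0 Q (\<lambda>q. Z (\<theta> q))"
proof -
  obtain r where r: "r > 0" "\<And>\<eta>. \<eta> > 0 \<Longrightarrow> \<forall>\<^sub>F h in at_right 0.
     near_map R P (cball x0 r) (\<lambda>p y. y + h *\<^sub>R Z p y) (\<eta> * h)"
    using assms(1) unfolding attainable_def by blast
  show ?thesis unfolding attainable_def
  proof (intro exI[of _ r] conjI allI impI r(1))
    fix \<eta> :: real assume "\<eta> > 0"
    from r(2)[OF this] show "\<forall>\<^sub>F h in at_right 0.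
     near_map R Q (cball x0 r) (\<lambda>q y. y + h *\<^sub>R Z (\<theta> q) y) (\<eta> * h)"
      by eventually_elim (rule near_map_reparam[OF _ assms(2,3)])
  qed
qed

lemma attainable_cong:
  assumes "attainable R x0 P Z" "e > 0"
    "\<And>p y. p \<in> P \<Longrightarrow> y \<in> cball x0 e \<Longrightarrow> Z p y = Z' p y"
  shows "attainable R x0 P Z'"
proof -
  obtain r where r: "r > 0" "\<And>\<eta>. \<eta> > 0 \<Longrightarrow> \<forall>\<^sub>F h in at_right 0.
     near_map R P (cball x0 r) (\<lambda>p y. y + h *\<^sub>R Z p y) (\<eta> * h)"
    using assms(1) unfolding attainable_def by blast
  show ?thesis unfolding attainable_def
  proof (intro exI[of _ "min r e"] conjI allI impI)
    fix \<eta> :: real assume "\<eta> > 0"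
    from r(2)[OF this] show "\<forall>\<^sub>F h in at_right 0.
     near_map R P (cball x0 (min r e)) (\<lambda>q y. y + h *\<^sub>R Z' q y) (\<eta> * h)"
      by eventually_elim (erule near_map_weaken, use assms(3) in auto)
  qed (use r assms(2) in auto)
qed

lemma attainable_pos_scale:
  assumes "attainable R x0 P Z" "c > 0"
  shows "attainable R x0 P (\<lambda>p y. c *\<^sub>R Z p y)"
proof -
  obtain r where r: "r > 0" "\<And>\<eta>. \<eta> > 0 \<Longrightarrow> \<forall>\<^sub>F h in at_right 0.
     near_map R P (cball x0 r) (\<lambda>p y. y + h *\<^sub>R Z p y) (\<eta> * h)"
    using assms(1) unfolding attainable_def by blast
  have lim: "filterlim (\<lambda>h. c * h) (at_right 0) (at_right (0::real))"
  proof (unfold filterlim_at, intro conjI)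
    show "\<forall>\<^sub>F h in at_right 0. c * h \<in> {0<..} \<and> c * h \<noteq> 0"
      using eventually_at_right_less[of "0::real"] by eventually_elim (use assms(2) in auto)
    show "((\<lambda>h. c * h) \<longlongrightarrow> 0) (at_right 0)" by (auto intro!: tendsto_eq_intros)
  qed
  show ?thesis unfolding attainable_def
  proof (intro exI[of _ r] conjI allI impI r(1))
    fix \<eta> :: real assume "\<eta> > 0"
    then have "\<forall>\<^sub>F h in at_right 0. near_map R P (cball x0 r) (\<lambda>p y. y + h *\<^sub>R Z p y) (\<eta> / c * h)"
      using r(2)[of "\<eta> / c"] assms(2) by simp
    from eventually_compose_filterlim[OF this lim]
    show "\<forall>\<^sub>F h in at_right 0. near_map R P (cball x0 r) (\<lambda>p y. y + h *\<^sub>R c *\<^sub>R Z p y) (\<eta> * h)"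
      by eventually_elim (use assms(2) in \<open>simp add: mult.commute\<close>)
  qed
qed

text \<open>
  One move after the other: the second field is evaluated at a point that is \<open>O(h)\<close> away, which
  costs only \<open>O(h\<^sup>2)\<close>.
\<close>

lemma attainable_add:
  assumes R: "transp R" and a: "attainable R x0 P Z" "attainable R x0 P Z'"
    and l: "lip_family x0 P Z" "lip_family x0 P Z'"
  shows "attainable R x0 P (\<lambda>p y. Z p y + Z' p y)"
proof -
  obtain r1 where r1: "r1 > 0" "\<And>\<eta>. \<eta> > 0 \<Longrightarrow> \<forall>\<^sub>F h in at_right 0.
     near_map R P (cball x0 r1) (\<lambda>p y. y + h *\<^sub>R Z p y) (\<eta> * h)"
    using a(1) unfolding attainable_def by blast
  obtain r2 where r2: "r2 > 0" "\<And>\<eta>. \<eta> > 0 \<Longrightarrow> \<forall>\<^sub>F h in at_right 0.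
     near_map R P (cball x0 r2) (\<lambda>p y. y + h *\<^sub>R Z' p y) (\<eta> * h)"
    using a(2) unfolding attainable_def by blast
  obtain r3 M where 1: "r3 > 0" "M \<ge> 0" "\<And>p y. p \<in> P \<Longrightarrow> y \<in> cball x0 r3 \<Longrightarrow> norm (Z p y) \<le> M"
    using lip_familyE[OF l(1)] by metis
  obtain r4 M' where 2: "r4 > 0" "M' \<ge> 0" 
    "\<And>p y z. p \<in> P \<Longrightarrow> y \<in> cball x0 r4 \<Longrightarrow> z \<in> cball x0 r4 \<Longrightarrow> norm (Z' p z - Z' p y) \<le> M' * norm (z - y)"
    using lip_familyE[OF l(2)] by metis
  define \<rho> where "\<rho> = min (min r1 r2) (min r3 r4)"
  have \<rho>: "\<rho> > 0" "cball x0 \<rho> \<subseteq> cball x0 r1" "cball x0 \<rho> \<subseteq> cball x0 r2"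
    "cball x0 \<rho> \<subseteq> cball x0 r3" "cball x0 \<rho> \<subseteq> cball x0 r4" using r1 r2 1 2 by (auto simp: \<rho>_def)
  have half: "cball x0 (\<rho>/2) \<subseteq> cball x0 \<rho>" using \<rho>(1) by auto
  show ?thesis unfolding attainable_def
  proof (intro exI[of _ "\<rho>/2"] conjI allI impI)
    fix \<eta> :: real assume \<eta>: "\<eta> > 0"
    define K where "K = M + \<eta> / 3"
    have e3: "\<eta> / 3 > 0" using \<eta> by simp
    have K0: "K \<ge> 0" using 1(2) \<eta> by (simp add: K_def)
    have "\<forall>\<^sub>F h in at_right 0. K * h \<le> \<rho> / 2" "\<forall>\<^sub>F h in at_right 0. (M' * K) * h \<le> \<eta> / 3"
      by (rule eventually_small, use \<rho>(1) \<eta> in simp)+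
    moreover have "\<forall>\<^sub>F h in at_right (0::real). h > 0" by (rule eventually_at_right_less)
    ultimately show "\<forall>\<^sub>F h in at_right 0.
     near_map R P (cball x0 (\<rho>/2)) (\<lambda>p y. y + h *\<^sub>R (Z p y + Z' p y)) (\<eta> * h)"
      using r1(2)[OF e3] r2(2)[OF e3]
    proof eventually_elim
      case (elim h)
      have n1: "near_map R P (cball x0 (\<rho>/2)) (\<lambda>p y. y + h *\<^sub>R Z p y) (\<eta> / 3 * h)"
        by (rule near_map_weaken[OF elim(4)]) (use half \<rho>(2) in auto)
      show ?case
      proof (rule near_map_compose[OF R n1 elim(5)])
        fix p y u assume p: "p \<in> P" and y: "y \<in> cball x0 (\<rho>/2)"
          and u: "norm (u - (y + h *\<^sub>R Z p y)) \<le> \<eta> / 3 * h"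
        have y3: "y \<in> cball x0 r3" "y \<in> cball x0 r4" using y half \<rho>(4,5) by blast+
        have "norm (h *\<^sub>R Z p y) \<le> h * M" using 1(3)[OF p y3(1)] elim(3) by simp
        from norm_triangle_mono[OF u this] have uy: "norm (u - y) \<le> K * h"
          by (simp add: K_def algebra_simps)
        have "dist x0 u \<le> \<rho>"
          using dist_triangle[of x0 u y] y uy elim(1) by (simp add: dist_norm norm_minus_commute)
        then have u\<rho>: "u \<in> cball x0 \<rho>" by simp
        then have u4: "u \<in> cball x0 r2" "u \<in> cball x0 r4" using \<rho>(3,5) by blast+
        have "norm (Z' p u - Z' p y) \<le> M' * (K * h)"
          by (rule order_trans[OF 2(3)[OF p y3(2) u4(2)] mult_left_mono[OF uy 2(2)]])
        then have "norm (Z' p u - Z' p y) \<le> \<eta> / 3" using elim(2) by (simp add: mult.assoc)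
        then have "norm (h *\<^sub>R (Z' p u - Z' p y)) \<le> h * (\<eta> / 3)" using elim(3) by simp
        from norm_triangle_mono[OF u this]
        have "norm (u + h *\<^sub>R Z' p u - (y + h *\<^sub>R (Z p y + Z' p y))) \<le> \<eta> / 3 * h + h * (\<eta> / 3)"
          by (simp add: algebra_simps)
        moreover have "\<eta> / 3 * h + h * (\<eta> / 3) + \<eta> / 3 * h \<le> \<eta> * h" by (simp add: field_simps)
        ultimately show "u \<in> cball x0 r2 \<and>
          norm (u + h *\<^sub>R Z' p u - (y + h *\<^sub>R (Z p y + Z' p y))) + \<eta> / 3 * h \<le> \<eta> * h"
          using u4(1) by linarith
      qed
    qed
  qed (use \<rho> in auto)
qed

section \<open>Lie brackets of attainable fields and local controllability\<close>

lemma second_order_attainableI: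
  assumes "r > 0" "C \<ge> 0" "\<forall>\<^sub>F s in at_right 0.
     near_map R P (cball x0 r) (\<lambda>p y. y + s *\<^sub>R a p y + s\<^sup>2 *\<^sub>R b p y) (C * s ^ 3)"
  shows "second_order_attainable R x0 P a b"
  unfolding second_order_attainable_def using assms by blast

text \<open>
  First order accuracy improves by repetition. A move of length \<open>h = s/N\<close> has an error \<open>s\<^sup>2h\<close> if \<open>h\<close> is
  small compared with \<open>s\<close>, so \<open>N\<close> of them accumulate an error \<open>O(s\<^sup>3)\<close>. In the limit they follow the flow of \<open>Z\<close> for
  time \<open>s\<close>, and \<open>y + s Z + (s\<^sup>2/2) DZ(Z)\<close> is its second order Taylor polynomial.
\<close>

lemma second_order_attainable_iterate:
  assumes R: "transp R" and a: "attainable R x0 P Z" and c2: "c2_family x0 P Z D"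
  shows "second_order_attainable R x0 P Z (\<lambda>p y. (1/2) *\<^sub>R D p y (Z p y))"
proof -
  obtain r1 where r1: "r1 > 0" "\<And>\<eta>. \<eta> > 0 \<Longrightarrow> \<forall>\<^sub>F h in at_right 0.
     near_map R P (cball x0 r1) (\<lambda>p y. y + h *\<^sub>R Z p y) (\<eta> * h)"
    using a unfolding attainable_def by blast
  obtain r2 M where c: "r2 > 0" "M \<ge> 0" "\<And>p y. p \<in> P \<Longrightarrow> y \<in> cball x0 r2 \<Longrightarrow> norm (Z p y) \<le> M"
    "\<And>p y. p \<in> P \<Longrightarrow> y \<in> cball x0 r2 \<Longrightarrow> linear (D p y)"
    "\<And>p y u. p \<in> P \<Longrightarrow> y \<in> cball x0 r2 \<Longrightarrow> norm (D p y u) \<le> M * norm u"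
    "\<And>p y z. p \<in> P \<Longrightarrow> y \<in> cball x0 r2 \<Longrightarrow> z \<in> cball x0 r2 \<Longrightarrow>
      norm (Z p z - Z p y - D p y (z - y)) \<le> M * (norm (z - y))\<^sup>2"
    "\<And>p y z u. p \<in> P \<Longrightarrow> y \<in> cball x0 r2 \<Longrightarrow> z \<in> cball x0 r2 \<Longrightarrow>
      norm (D p z u - D p y u) \<le> M * norm (z - y) * norm u"
    by (rule c2_familyE[OF c2]) (rule that)
  define \<rho> where "\<rho> = min r1 r2"
  have \<rho>: "\<rho> > 0" "cball x0 \<rho> \<subseteq> cball x0 r1" "cball x0 \<rho> \<subseteq> cball x0 r2" using r1 c(1) by (auto simp: \<rho>_def)
  have half: "cball x0 (\<rho>/2) \<subseteq> cball x0 \<rho>" using \<rho>(1) by auto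
  define A where "A p y = D p y (Z p y)" for p y
  define q where "q \<tau> p y = y + \<tau> *\<^sub>R Z p y + (\<tau>\<^sup>2 / 2) *\<^sub>R A p y" for \<tau> :: real and p y
  \<comment> \<open>\<open>K\<close> bounds the displacement per unit time, \<open>C\<close> collects the terms of the local error below.\<close>
  define K where "K = M + M * M + 1"
  define C where "C = M * K\<^sup>2 + M * (M * M) + M * M + 2"
  have K0: "K \<ge> 0" and C0: "C \<ge> 0" using c(2) by (auto simp: K_def C_def)
  have "\<forall>\<^sub>F s in at_right (0::real). s > 0" "\<forall>\<^sub>F s in at_right (0::real). 1 * s \<le> 1"
    "\<forall>\<^sub>F s in at_right (0::real). C * s \<le> 1" "\<forall>\<^sub>F s in at_right (0::real). (M * C) * s \<le> 1"
    "\<forall>\<^sub>F s in at_right (0::real). K * s \<le> \<rho>/2"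
    by (rule eventually_at_right_less, (rule eventually_small, use \<rho>(1) in simp)+)
  then have "\<forall>\<^sub>F s in at_right 0. near_map R P (cball x0 (\<rho>/2)) (q s) (C * s ^ 3)"
  proof eventually_elim
    case (elim s)
    have s: "s > 0" "s \<le> 1" "C * s \<le> 1" "M * C * s \<le> 1" "K * s \<le> \<rho>/2" using elim by auto
    have "\<forall>\<^sub>F h in at_right 0. near_map R P (cball x0 r1) (\<lambda>p y. y + h *\<^sub>R Z p y) (s\<^sup>2 * h)"
      using r1(2)[of "s\<^sup>2"] s(1) by simp
    then obtain d where d: "d > 0" "\<And>h. 0 < h \<Longrightarrow> h < d \<Longrightarrow>
       near_map R P (cball x0 r1) (\<lambda>p y. y + h *\<^sub>R Z p y) (s\<^sup>2 * h)"
      unfolding eventually_at_right_field by blast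
    \<comment> \<open>\<open>N \<ge> 1/s\<close> makes \<open>h \<le> s\<^sup>2\<close>, so that the discretization error is of third order, too.\<close>
    obtain N0 :: nat where N0: "real N0 > max (1 / s) (s / d)" using reals_Archimedean2 by blast
    define N where "N = Suc N0"
    have N: "1 / s \<le> real N" "s / d < real N" "N \<ge> 1" using N0 by (auto simp: N_def)
    define h where "h = s / real N"
    have h: "h > 0" "h < d" "h \<le> s\<^sup>2" "real N * h = s"
      using N s(1) d(1) by (auto simp: h_def field_simps power2_eq_square)
    note step = d(2)[OF h(1,2)]
    have C1: "C * s\<^sup>2 \<le> 1"
      using mult_mono[OF s(3,2)] s(1) by (simp add: power2_eq_square mult.assoc)
    have Ab: "norm (A p y) \<le> M * M" if "p \<in> P" "y \<in> cball x0 r2" for p y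
      unfolding A_def
      by (rule order_trans[OF c(5)[OF that] mult_left_mono[OF c(3)[OF that] c(2)]])
    \<comment> \<open>The relation is not assumed reflexive, hence the induction starts from one move.\<close>
    have main: "near_map R P (cball x0 (\<rho>/2)) (q (real (Suc j) * h)) (C * (real (Suc j) * h) * s\<^sup>2)"
      if "Suc j \<le> N" for j
      using that
    proof (induction j)
      case 0
      show ?case
      proof (rule near_map_weaken[OF step])
        show "cball x0 (\<rho>/2) \<subseteq> cball x0 r1" using half \<rho>(2) by blast
        fix p y assume p: "p \<in> P" and y: "y \<in> cball x0 (\<rho>/2)"
        then have y2: "y \<in> cball x0 r2" using half \<rho>(3) by blast
        have "norm (y + h *\<^sub>R Z p y - q (real (Suc 0) * h) p y) = h\<^sup>2 / 2 * norm (A p y)"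
          by (simp add: q_def)
        also have "\<dots> \<le> h\<^sup>2 / 2 * (M * M)" by (rule mult_left_mono[OF Ab[OF p y2]]) simp
        also have "\<dots> = (h * h) * (M * M) / 2" by (simp add: power2_eq_square)
        also have "\<dots> \<le> (h * s\<^sup>2) * (M * M) / 2"
          using h(1,3) by (intro divide_right_mono mult_right_mono mult_left_mono) auto
        also have "\<dots> \<le> (h * s\<^sup>2) * (C - 1)"
          using h(1) c(2) by (simp add: C_def) (intro mult_left_mono, auto)
        finally show "norm (y + h *\<^sub>R Z p y - q (real (Suc 0) * h) p y) + s\<^sup>2 * h
            \<le> C * (real (Suc 0) * h) * s\<^sup>2"
          by (simp add: algebra_simps)
      qed
    next
      case (Suc j)
      define \<tau> where "\<tau> = real (Suc j) * h"
      have "real (Suc j) * h \<le> real N * h" using Suc.prems h(1) by (intro mult_right_mono) auto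
      then have \<tau>: "0 < \<tau>" "\<tau> \<le> s" using h(1,4) by (auto simp: \<tau>_def)
      have Suc\<tau>: "real (Suc (Suc j)) * h = \<tau> + h" by (simp add: \<tau>_def algebra_simps)
      have IH: "near_map R P (cball x0 (\<rho>/2)) (q \<tau>) (C * \<tau> * s\<^sup>2)"
        using Suc by (simp add: \<tau>_def)
      show ?case unfolding Suc\<tau>
      proof (rule near_map_compose[OF R IH step])
        fix p y u assume p: "p \<in> P" and y: "y \<in> cball x0 (\<rho>/2)" and u: "norm (u - q \<tau> p y) \<le> C * \<tau> * s\<^sup>2"
        have y2: "y \<in> cball x0 r2" using y half \<rho>(3) by blast
        define e where "e = u - q \<tau> p y"
        have e1: "norm e \<le> C * \<tau> * s\<^sup>2" using u by (simp add: e_def)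
        have e2: "norm e \<le> \<tau> * 1"
          using order_trans[OF e1, of "\<tau> * 1"] mult_left_mono[OF C1, of \<tau>] \<tau>(1)
          by (simp only: mult.assoc mult.left_commute[of C \<tau>] less_imp_le simp_thms)
        have n1: "norm (\<tau> *\<^sub>R Z p y) \<le> \<tau> * M" using c(3)[OF p y2] \<tau>(1) by simp
        have t2: "\<tau>\<^sup>2 / 2 \<le> \<tau>" 
          using \<tau> s(2) mult_left_mono[of \<tau> 1 \<tau>] by (simp add: power2_eq_square)
        have n2: "norm ((\<tau>\<^sup>2 / 2) *\<^sub>R A p y) \<le> \<tau> * (M * M)"
          using mult_mono[OF t2 Ab[OF p y2]] \<tau>(1) by simp
        have uy: "u - y = \<tau> *\<^sub>R Z p y + (\<tau>\<^sup>2 / 2) *\<^sub>R A p y + e" by (simp add: e_def q_def)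
        have nuy: "norm (u - y) \<le> \<tau> * K"
          unfolding uy using norm_triangle_mono[OF norm_triangle_mono[OF n1 n2] e2]
          by (simp add: K_def algebra_simps)
        then have "norm (u - y) \<le> s * K" using mult_right_mono[OF \<tau>(2) K0] by linarith
        then have nuys: "norm (u - y) \<le> K * s" by (simp add: mult.commute)
        have "dist x0 u \<le> \<rho>"
          using dist_triangle[of x0 u y] y nuys s(5) by (simp add: dist_norm norm_minus_commute)
        then have u\<rho>: "u \<in> cball x0 r1" "u \<in> cball x0 r2" using \<rho>(2,3) by auto
        define E where "E = Z p u - Z p y - D p y (u - y)"
        have "norm E \<le> M * (norm (u - y))\<^sup>2" unfolding E_def by (rule c(6)[OF p y2 u\<rho>(2)])
        also have "\<dots> \<le> M * (K * s)\<^sup>2" using nuys by (intro mult_left_mono power_mono c(2)) auto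
        finally have m1: "norm E \<le> M * K\<^sup>2 * s\<^sup>2" by (simp add: power_mult_distrib mult.assoc)
        note lin = c(4)[OF p y2]
        have Duy: "D p y (u - y) = \<tau> *\<^sub>R A p y + (\<tau>\<^sup>2 / 2) *\<^sub>R D p y (A p y) + D p y e"
          unfolding uy by (simp add: linear_add[OF lin] linear_scale[OF lin] A_def)
        have ts: "\<tau>\<^sup>2 / 2 \<le> s\<^sup>2" using power_mono[OF \<tau>(2), of 2] \<tau>(1) zero_le_power2[of \<tau>] by linarith
        have "norm (D p y (A p y)) \<le> M * (M * M)"
          by (rule order_trans[OF c(5)[OF p y2] mult_left_mono[OF Ab[OF p y2] c(2)]])
        from mult_mono[OF ts this] have m2: "norm ((\<tau>\<^sup>2 / 2) *\<^sub>R D p y (A p y)) \<le> s\<^sup>2 * (M * (M * M))" by simp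
        have "norm (D p y e) \<le> M * (C * \<tau> * s\<^sup>2)"
          by (rule order_trans[OF c(5)[OF p y2] mult_left_mono[OF e1 c(2)]])
        also have "\<dots> \<le> M * (C * s * s\<^sup>2)"
          using \<tau> C0 c(2) by (intro mult_left_mono mult_right_mono) auto
        also have "\<dots> = (M * C * s) * s\<^sup>2" by (simp add: mult_ac)
        also have "\<dots> \<le> 1 * s\<^sup>2" using s(4) by (intro mult_right_mono) auto
        finally have m3: "norm (D p y e) \<le> s\<^sup>2" by simp
        have h2: "h / 2 \<le> s\<^sup>2" using h(1,3) by simp
        have m4: "norm (- ((h / 2) *\<^sub>R A p y)) \<le> s\<^sup>2 * (M * M)"
          using mult_mono[OF h2 Ab[OF p y2]] h(1) by simp
        have eq: "u + h *\<^sub>R Z p u - q (\<tau> + h) p y =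
            e + h *\<^sub>R (E + (\<tau>\<^sup>2 / 2) *\<^sub>R D p y (A p y) + D p y e + - ((h / 2) *\<^sub>R A p y))"
        proof -
          have "u = y + \<tau> *\<^sub>R Z p y + (\<tau>\<^sup>2 / 2) *\<^sub>R A p y + e" using uy by (simp add: algebra_simps)
          moreover have "Z p u = E + Z p y + (\<tau> *\<^sub>R A p y + (\<tau>\<^sup>2 / 2) *\<^sub>R D p y (A p y) + D p y e)"
            using Duy by (simp add: E_def)
          moreover have "q (\<tau> + h) p y = y + (\<tau> + h) *\<^sub>R Z p y + (\<tau>\<^sup>2 / 2 + h * \<tau> + h * (h / 2)) *\<^sub>R A p y"
            by (simp add: q_def power2_eq_square field_simps)
          ultimately show ?thesis by (simp add: scaleR_add_left scaleR_add_right scaleR_diff_right)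
        qed
        let ?B = "M * K\<^sup>2 * s\<^sup>2 + s\<^sup>2 * (M * (M * M)) + s\<^sup>2 + s\<^sup>2 * (M * M)"
        have "norm (h *\<^sub>R (E + (\<tau>\<^sup>2 / 2) *\<^sub>R D p y (A p y) + D p y e + - ((h / 2) *\<^sub>R A p y))) \<le> h * ?B"
          using norm_triangle_mono[OF norm_triangle_mono[OF norm_triangle_mono[OF m1 m2] m3] m4] h(1)
          by (simp add: mult_left_mono)
        from norm_triangle_mono[OF e1 this]
        have "norm (u + h *\<^sub>R Z p u - q (\<tau> + h) p y) \<le> C * \<tau> * s\<^sup>2 + h * ?B" unfolding eq .
        moreover have "C * \<tau> * s\<^sup>2 + h * ?B + s\<^sup>2 * h = C * (\<tau> + h) * s\<^sup>2"
          by (simp add: C_def algebra_simps)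
        ultimately show "u \<in> cball x0 r1 \<and>
            norm (u + h *\<^sub>R Z p u - q (\<tau> + h) p y) + s\<^sup>2 * h \<le> C * (\<tau> + h) * s\<^sup>2"
          using u\<rho>(1) by linarith
      qed
    qed
    have "near_map R P (cball x0 (\<rho>/2)) (q s) (C * s * s\<^sup>2)"
      using main[of N0] h(4) by (simp add: N_def)
    then show ?case by (simp add: power2_eq_square power3_eq_cube mult.assoc)
  qed
  then show ?thesis
    by (intro second_order_attainableI[of "\<rho>/2" C] C0) (use \<rho>(1) in \<open>simp_all add: q_def[abs_def] A_def\<close>)
qed

text \<open>
  The expansion of a composition: the cross term is the derivative of the second field in the
  direction of the first displacement.
\<close>

lemma second_order_attainable_compose:
  assumes R: "transp R" and at1: "second_order_attainable R x0 P a1 b1" and at2: "second_order_attainable R x0 P a2 b2"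
    and l: "lip_family x0 P a1" "lip_family x0 P b1" "lip_family x0 P b2" and c2: "c2_family x0 P a2 D"
  shows "second_order_attainable R x0 P (\<lambda>p y. a1 p y + a2 p y) (\<lambda>p y. b1 p y + b2 p y + D p y (a1 p y))"
proof -
  obtain r1 C1 where r1: "r1 > 0" "C1 \<ge> 0" "\<forall>\<^sub>F s in at_right 0.
     near_map R P (cball x0 r1) (\<lambda>p y. y + s *\<^sub>R a1 p y + s\<^sup>2 *\<^sub>R b1 p y) (C1 * s ^ 3)"
    using at1 unfolding second_order_attainable_def by blast
  obtain r2 C2 where r2: "r2 > 0" "C2 \<ge> 0" "\<forall>\<^sub>F s in at_right 0.
     near_map R P (cball x0 r2) (\<lambda>p y. y + s *\<^sub>R a2 p y + s\<^sup>2 *\<^sub>R b2 p y) (C2 * s ^ 3)"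
    using at2 unfolding second_order_attainable_def by blast
  obtain r3 Ma where a: "r3 > 0" "Ma \<ge> 0" "\<And>p y. p \<in> P \<Longrightarrow> y \<in> cball x0 r3 \<Longrightarrow> norm (a1 p y) \<le> Ma"
    using lip_familyE[OF l(1)] by metis
  obtain r4 Mb where b: "r4 > 0" "Mb \<ge> 0" "\<And>p y. p \<in> P \<Longrightarrow> y \<in> cball x0 r4 \<Longrightarrow> norm (b1 p y) \<le> Mb"
    using lip_familyE[OF l(2)] by metis
  obtain r5 L where b2: "r5 > 0" "L \<ge> 0"
    "\<And>p y z. p \<in> P \<Longrightarrow> y \<in> cball x0 r5 \<Longrightarrow> z \<in> cball x0 r5 \<Longrightarrow> norm (b2 p z - b2 p y) \<le> L * norm (z - y)"
    using lip_familyE[OF l(3)] by metis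
  obtain r6 M where c: "r6 > 0" "M \<ge> 0" "\<And>p y. p \<in> P \<Longrightarrow> y \<in> cball x0 r6 \<Longrightarrow> norm (a2 p y) \<le> M"
    "\<And>p y. p \<in> P \<Longrightarrow> y \<in> cball x0 r6 \<Longrightarrow> linear (D p y)"
    "\<And>p y u. p \<in> P \<Longrightarrow> y \<in> cball x0 r6 \<Longrightarrow> norm (D p y u) \<le> M * norm u"
    "\<And>p y z. p \<in> P \<Longrightarrow> y \<in> cball x0 r6 \<Longrightarrow> z \<in> cball x0 r6 \<Longrightarrow>
      norm (a2 p z - a2 p y - D p y (z - y)) \<le> M * (norm (z - y))\<^sup>2"
    "\<And>p y z u. p \<in> P \<Longrightarrow> y \<in> cball x0 r6 \<Longrightarrow> z \<in> cball x0 r6 \<Longrightarrow>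
      norm (D p z u - D p y u) \<le> M * norm (z - y) * norm u"
    by (rule c2_familyE[OF c2]) (rule that)
  define \<rho> where "\<rho> = Min {r1, r2, r3, r4, r5, r6}"
  have "\<rho> > 0" using r1(1) r2(1) a(1) b(1) b2(1) c(1) by (simp add: \<rho>_def)
  moreover have "\<rho> \<le> r" if "r \<in> {r1, r2, r3, r4, r5, r6}" for r
    unfolding \<rho>_def by (rule Min_le[OF _ that]) simp
  ultimately have \<rho>: "\<rho> > 0" "cball x0 \<rho> \<subseteq> cball x0 r1" "cball x0 \<rho> \<subseteq> cball x0 r2"
    "cball x0 \<rho> \<subseteq> cball x0 r3" "cball x0 \<rho> \<subseteq> cball x0 r4" "cball x0 \<rho> \<subseteq> cball x0 r5"
    "cball x0 \<rho> \<subseteq> cball x0 r6"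
    by (simp_all add: subset_cball)
  have half: "cball x0 (\<rho>/2) \<subseteq> cball x0 \<rho>" using \<rho>(1) by auto
  define K where "K = Ma + Mb + C1"
  define C where "C = C1 + C2 + M * K\<^sup>2 + M * (Mb + C1) + L * K"
  have K0: "K \<ge> 0" and C0: "C \<ge> 0" using r1(2) r2(2) a(2) b(2) b2(2) c(2) by (auto simp: K_def C_def)
  have "\<forall>\<^sub>F s in at_right (0::real). s > 0" "\<forall>\<^sub>F s in at_right (0::real). 1 * s \<le> 1"
    "\<forall>\<^sub>F s in at_right (0::real). K * s \<le> \<rho>/2"
    by (rule eventually_at_right_less, (rule eventually_small, use \<rho>(1) in simp)+)
  then have "\<forall>\<^sub>F s in at_right 0. near_map R P (cball x0 (\<rho>/2))
    (\<lambda>p y. y + s *\<^sub>R (a1 p y + a2 p y) + s\<^sup>2 *\<^sub>R (b1 p y + b2 p y + D p y (a1 p y))) (C * s ^ 3)"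
    using r1(3) r2(3)
  proof eventually_elim
    case (elim s)
    have s: "s > 0" "s \<le> 1" "K * s \<le> \<rho>/2" using elim by auto
    have s23: "s\<^sup>2 \<le> s" "s^3 \<le> s\<^sup>2" "s^3 \<le> s" "0 \<le> s^3"
      using power_decreasing[of 1 2 s] power_decreasing[of 2 3 s] power_decreasing[of 1 3 s] s by auto
    have n1: "near_map R P (cball x0 (\<rho>/2)) (\<lambda>p y. y + s *\<^sub>R a1 p y + s\<^sup>2 *\<^sub>R b1 p y) (C1 * s ^ 3)"
      by (rule near_map_weaken[OF elim(4)]) (use half \<rho>(2) in auto)
    show ?case
    proof (rule near_map_compose[OF R n1 elim(5)])
      fix p y u assume p: "p \<in> P" and y: "y \<in> cball x0 (\<rho>/2)"
        and u: "norm (u - (y + s *\<^sub>R a1 p y + s\<^sup>2 *\<^sub>R b1 p y)) \<le> C1 * s ^ 3"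
      have yr: "y \<in> cball x0 r3" "y \<in> cball x0 r4" "y \<in> cball x0 r5" "y \<in> cball x0 r6"
        using y half \<rho> by blast+
      define e where "e = u - (y + s *\<^sub>R a1 p y + s\<^sup>2 *\<^sub>R b1 p y)"
      have e1: "norm e \<le> C1 * s ^ 3" using u by (simp add: e_def)
      have uy: "u - y = s *\<^sub>R a1 p y + s\<^sup>2 *\<^sub>R b1 p y + e" by (simp add: e_def)
      have na: "norm (s *\<^sub>R a1 p y) \<le> s * Ma" using a(3)[OF p yr(1)] s(1) by simp
      have nb: "norm (s\<^sup>2 *\<^sub>R b1 p y) \<le> s\<^sup>2 * Mb" using b(3)[OF p yr(2)] by (simp add: mult_left_mono)
      have "norm (u - y) \<le> s * Ma + s\<^sup>2 * Mb + C1 * s ^ 3"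
        unfolding uy by (rule norm_triangle_mono[OF norm_triangle_mono[OF na nb] e1])
      also have "\<dots> \<le> s * Ma + s * Mb + C1 * s"
        using s23 b(2) r1(2) by (intro add_mono mult_right_mono mult_left_mono) auto
      finally have nuy: "norm (u - y) \<le> K * s" by (simp add: K_def algebra_simps)
      have "dist x0 u \<le> \<rho>"
        using dist_triangle[of x0 u y] y nuy s(3) by (simp add: dist_norm norm_minus_commute)
      then have ur: "u \<in> cball x0 r2" "u \<in> cball x0 r5" "u \<in> cball x0 r6" using \<rho> by auto
      define E where "E = a2 p u - a2 p y - D p y (u - y)"
      have "norm E \<le> M * (norm (u - y))\<^sup>2" unfolding E_def by (rule c(6)[OF p yr(4) ur(3)])
      also have "\<dots> \<le> M * (K * s)\<^sup>2" using nuy by (intro mult_left_mono power_mono c(2)) auto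
      finally have "norm E \<le> M * K\<^sup>2 * s\<^sup>2" by (simp add: power_mult_distrib mult.assoc)
      then have m1: "norm (s *\<^sub>R E) \<le> M * K\<^sup>2 * s ^ 3"
        using s(1) mult_left_mono[of "norm E" _ s] by (simp add: power2_eq_square power3_eq_cube mult_ac)
      have "norm (s\<^sup>2 *\<^sub>R b1 p y + e) \<le> s\<^sup>2 * Mb + C1 * s\<^sup>2"
        using norm_triangle_mono[OF nb e1] mult_left_mono[OF s23(2) r1(2)] by linarith
      from order_trans[OF c(5)[OF p yr(4)] mult_left_mono[OF this c(2)]]
      have "norm (D p y (s\<^sup>2 *\<^sub>R b1 p y + e)) \<le> M * (Mb + C1) * s\<^sup>2" by (simp add: algebra_simps)
      then have m2: "norm (s *\<^sub>R D p y (s\<^sup>2 *\<^sub>R b1 p y + e)) \<le> M * (Mb + C1) * s ^ 3"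
        using s(1) mult_left_mono[of "norm (D p y (s\<^sup>2 *\<^sub>R b1 p y + e))" _ s]
        by (simp add: power2_eq_square power3_eq_cube mult_ac)
      have "norm (b2 p u - b2 p y) \<le> L * (K * s)"
        by (rule order_trans[OF b2(3)[OF p yr(3) ur(2)] mult_left_mono[OF nuy b2(2)]])
      then have m3: "norm (s\<^sup>2 *\<^sub>R (b2 p u - b2 p y)) \<le> L * K * s ^ 3"
        using mult_left_mono[of "norm (b2 p u - b2 p y)" "L * (K * s)" "s\<^sup>2"]
        by (simp add: power2_eq_square power3_eq_cube mult_ac)
      note lin = c(4)[OF p yr(4)]
      have "D p y (u - y) = s *\<^sub>R D p y (a1 p y) + D p y (s\<^sup>2 *\<^sub>R b1 p y + e)"
        unfolding uy by (simp add: linear_add[OF lin] linear_scale[OF lin] add.assoc)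
      then have "a2 p u = E + a2 p y + (s *\<^sub>R D p y (a1 p y) + D p y (s\<^sup>2 *\<^sub>R b1 p y + e))"
        by (simp add: E_def)
      moreover have "u = y + s *\<^sub>R a1 p y + s\<^sup>2 *\<^sub>R b1 p y + e" by (simp add: e_def)
      ultimately have eq: "u + s *\<^sub>R a2 p u + s\<^sup>2 *\<^sub>R b2 p u -
          (y + s *\<^sub>R (a1 p y + a2 p y) + s\<^sup>2 *\<^sub>R (b1 p y + b2 p y + D p y (a1 p y))) =
          e + s *\<^sub>R E + s *\<^sub>R D p y (s\<^sup>2 *\<^sub>R b1 p y + e) + s\<^sup>2 *\<^sub>R (b2 p u - b2 p y)"
        by (simp add: scaleR_add_left scaleR_add_right scaleR_diff_right power2_eq_square)
      have "norm (u + s *\<^sub>R a2 p u + s\<^sup>2 *\<^sub>R b2 p u -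
          (y + s *\<^sub>R (a1 p y + a2 p y) + s\<^sup>2 *\<^sub>R (b1 p y + b2 p y + D p y (a1 p y)))) \<le>
          C1 * s ^ 3 + M * K\<^sup>2 * s ^ 3 + M * (Mb + C1) * s ^ 3 + L * K * s ^ 3"
        unfolding eq by (intro norm_triangle_mono e1 m1 m2 m3)
      then show "u \<in> cball x0 r2 \<and> norm (u + s *\<^sub>R a2 p u + s\<^sup>2 *\<^sub>R b2 p u -
          (y + s *\<^sub>R (a1 p y + a2 p y) + s\<^sup>2 *\<^sub>R (b1 p y + b2 p y + D p y (a1 p y)))) + C2 * s ^ 3 \<le> C * s ^ 3"
        using ur(1) by (simp add: C_def algebra_simps)
    qed
  qed
  then show ?thesis by (intro second_order_attainableI[of "\<rho>/2" C] C0) (use \<rho>(1) in simp_all)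
qed

text \<open>
  If the first order term vanishes, the displacement is \<open>s\<^sup>2b\<close>, and \<open>h = s\<^sup>2\<close> is the natural time.
\<close>

lemma attainable_of_second_order:
  assumes "second_order_attainable R x0 P (\<lambda>_ _. 0) b"
  shows "attainable R x0 P b"
proof -
  obtain r C where r: "r > 0" "C \<ge> 0" "\<forall>\<^sub>F s in at_right 0.
     near_map R P (cball x0 r) (\<lambda>p y. y + s *\<^sub>R 0 + s\<^sup>2 *\<^sub>R b p y) (C * s ^ 3)"
    using assms unfolding second_order_attainable_def by blast
  have lim: "filterlim sqrt (at_right 0) (at_right (0::real))"
  proof (unfold filterlim_at, intro conjI)
    show "\<forall>\<^sub>F h in at_right 0. sqrt h \<in> {0<..} \<and> sqrt h \<noteq> 0"
      using eventually_at_right_less[of "0::real"] by eventually_elim auto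
    show "(sqrt \<longlongrightarrow> 0) (at_right 0)"
      using tendsto_real_sqrt[OF tendsto_ident_at[of 0 "{0<..}"]] by simp
  qed
  show ?thesis unfolding attainable_def
  proof (intro exI[of _ r] conjI allI impI r(1))
    fix \<eta> :: real assume "\<eta> > 0"
    then have "\<forall>\<^sub>F s in at_right 0. C * s \<le> \<eta>" by (rule eventually_small)
    from eventually_compose_filterlim[OF this lim] eventually_compose_filterlim[OF r(3) lim]
      eventually_at_right_less[of "0::real"]
    show "\<forall>\<^sub>F h in at_right 0. near_map R P (cball x0 r) (\<lambda>p y. y + h *\<^sub>R b p y) (\<eta> * h)"
    proof eventually_elim
      case (elim h)
      have "C * sqrt h ^ 3 = (C * sqrt h) * h" using elim(3) by (simp add: power3_eq_cube mult.assoc)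
      also have "\<dots> \<le> \<eta> * h" using elim(1,3) by (intro mult_right_mono) auto
      finally show ?case
        by (intro near_map_weaken[OF elim(2)]) (use elim(3) in auto)
    qed
  qed
qed

text \<open>
  Follow \<open>\<sigma>X\<close>, \<open>\<tau>Y\<close>, \<open>-\<sigma>X\<close>, \<open>-\<tau>Y\<close> in turn, each for time \<open>s\<close>. The first order terms cancel, and the second order
  terms add up to \<open>\<sigma>\<tau>[X, Y]\<close>. Both signs of the bracket are reached by a parametrization
  that is continuous at \<open>0\<close>.
\<close>

lemma attainable_bracket:
  assumes R: "transp R" and U: "open U" "x0 \<in> U" and sm: "smooth_on U X" "smooth_on U Y"
    and aX: "attainable R x0 {-1..1} (\<lambda>t y. t *\<^sub>R X y)"
    and aY: "attainable R x0 {-1..1} (\<lambda>t y. t *\<^sub>R Y y)"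
  shows "attainable R x0 {-1..1} (\<lambda>t y. t *\<^sub>R coord_bracket X Y y)"
proof -
  let ?P = "{-1..1::real} \<times> {-1..1::real}"
  let ?DX = "\<lambda>y. frechet_derivative X (at y)" and ?DY = "\<lambda>y. frechet_derivative Y (at y)"
  have *: "second_order_attainable R x0 ?P (\<lambda>p y. c p *\<^sub>R V y)
        (\<lambda>p y. (1/2) *\<^sub>R c p *\<^sub>R frechet_derivative V (at y) (c p *\<^sub>R V y))"
      "c2_family x0 ?P (\<lambda>p y. c p *\<^sub>R V y) (\<lambda>p y u. c p *\<^sub>R frechet_derivative V (at y) u)"
      "lip_family x0 ?P (\<lambda>p y. (1/2) *\<^sub>R c p *\<^sub>R frechet_derivative V (at y) (c p *\<^sub>R V y))"
    if c: "continuous_on ?P c" "c ` ?P \<subseteq> {-1..1}" and V: "smooth_on U V"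
      and aV: "attainable R x0 {-1..1} (\<lambda>t y. t *\<^sub>R V y)" for c :: "real \<times> real \<Rightarrow> real" and V
  proof -
    show c2: "c2_family x0 ?P (\<lambda>p y. c p *\<^sub>R V y) (\<lambda>p y u. c p *\<^sub>R frechet_derivative V (at y) u)"
    proof (rule c2_family_smooth[OF U(1) V U(2)])
      show "\<bar>c p\<bar> \<le> 1" if "p \<in> ?P" for p using c(2) that by (force simp: abs_le_iff image_subset_iff)
    qed
    show "second_order_attainable R x0 ?P (\<lambda>p y. c p *\<^sub>R V y)
        (\<lambda>p y. (1/2) *\<^sub>R c p *\<^sub>R frechet_derivative V (at y) (c p *\<^sub>R V y))"
      by (rule second_order_attainable_iterate[OF R attainable_reparam[OF aV c] c2])
    show "lip_family x0 ?P (\<lambda>p y. (1/2) *\<^sub>R c p *\<^sub>R frechet_derivative V (at y) (c p *\<^sub>R V y))"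
      by (rule lip_family_scaleR[OF lip_family_deriv[OF c2 lip_family_c2[OF c2]]])
  qed
  have cont: "continuous_on ?P fst" "continuous_on ?P snd" "continuous_on ?P (\<lambda>p. - fst p)"
    "continuous_on ?P (\<lambda>p. - snd p)" by (intro continuous_intros)+
  have im: "fst ` ?P \<subseteq> {-1..1}" "snd ` ?P \<subseteq> {-1..1}" "(\<lambda>p. - fst p) ` ?P \<subseteq> {-1..1}"
    "(\<lambda>p. - snd p) ` ?P \<subseteq> {-1..1}" by auto
  note x = *[OF cont(1) im(1) sm(1) aX] and y = *[OF cont(2) im(2) sm(2) aY]
    and x' = *[OF cont(3) im(3) sm(1) aX] and y' = *[OF cont(4) im(4) sm(2) aY]
  note l1 = lip_family_c2[OF x(2)]
  note s2 = second_order_attainable_compose[OF R x(1) y(1) l1 x(3) y(3) y(2)]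
  note l2 = lip_family_add[OF l1 lip_family_c2[OF y(2)]]
    lip_family_add[OF lip_family_add[OF x(3) y(3)] lip_family_deriv[OF y(2) l1]]
  note s3 = second_order_attainable_compose[OF R s2 x'(1) l2 x'(3) x'(2)]
  note l3 = lip_family_add[OF l2(1) lip_family_c2[OF x'(2)]]
    lip_family_add[OF lip_family_add[OF l2(2) x'(3)] lip_family_deriv[OF x'(2) l2(1)]]
  note s4 = second_order_attainable_compose[OF R s3 y'(1) l3 y'(3) y'(2)]
  let ?b = "\<lambda>p y. ((1/2) *\<^sub>R fst p *\<^sub>R ?DX y (fst p *\<^sub>R X y) + (1/2) *\<^sub>R snd p *\<^sub>R ?DY y (snd p *\<^sub>R Y y) +
     snd p *\<^sub>R ?DY y (fst p *\<^sub>R X y) + (1/2) *\<^sub>R (- fst p) *\<^sub>R ?DX y (- fst p *\<^sub>R X y) +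
     (- fst p) *\<^sub>R ?DX y (fst p *\<^sub>R X y + snd p *\<^sub>R Y y)) + (1/2) *\<^sub>R (- snd p) *\<^sub>R ?DY y (- snd p *\<^sub>R Y y) +
     (- snd p) *\<^sub>R ?DY y (fst p *\<^sub>R X y + snd p *\<^sub>R Y y + (- fst p) *\<^sub>R X y)"
  have "second_order_attainable R x0 ?P (\<lambda>_ _. 0) ?b" using s4 by simp
  from attainable_of_second_order[OF this]
  have b: "attainable R x0 ?P ?b" .
  obtain e where e: "e > 0" "cball x0 e \<subseteq> U" using U open_contains_cball by blast
  have comm: "attainable R x0 ?P (\<lambda>p y. (fst p * snd p) *\<^sub>R coord_bracket X Y y)"
  proof (rule attainable_cong[OF b e(1)])
    fix p :: "real \<times> real" and y assume "y \<in> cball x0 e"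
    then have lX: "linear (?DX y)" and lY: "linear (?DY y)"
      using smooth_on_imp_derivative(1) sm e(2) has_derivative_linear by blast+
    show "?b p y = (fst p * snd p) *\<^sub>R coord_bracket X Y y"
      by (simp add: coord_bracket_def linear_add[OF lX] linear_scale[OF lX] linear_add[OF lY]
          linear_scale[OF lY] linear_neg[OF lX] linear_neg[OF lY] algebra_simps
          scaleR_add_left[symmetric] del: scaleR_add_left)
  qed
  \<comment> \<open>\<open>sqrt\<close> is odd, so the product of the two components is \<open>t\<close> for either sign.\<close>
  let ?t = "\<lambda>t::real. (sqrt t, sqrt \<bar>t\<bar>)"
  have "attainable R x0 {-1..1} (\<lambda>t y. (fst (?t t) * snd (?t t)) *\<^sub>R coord_bracket X Y y)"
  proof (rule attainable_reparam[OF comm, of "{-1..1}" ?t])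
    show "continuous_on {-1..1} ?t" by (intro continuous_intros)
    show "?t ` {-1..1} \<subseteq> ?P"
    proof safe
      fix t :: real assume t: "t \<in> {-1..1}"
      then have "sqrt (-t) \<le> 1" "sqrt t \<le> 1" "sqrt \<bar>t\<bar> \<le> 1" by auto
      moreover have "-1 \<le> sqrt \<bar>t\<bar>" by (rule order_trans[of _ 0]) auto
      ultimately show "sqrt t \<in> {-1..1}" "sqrt \<bar>t\<bar> \<in> {-1..1}" by (auto simp: real_sqrt_minus)
    qed
  qed
  moreover have "sqrt t * sqrt \<bar>t\<bar> = t" for t :: real
    using real_sqrt_minus[of "-t"] real_sqrt_pow2[of "\<bar>t\<bar>"]
    by (cases "t \<ge> 0") (auto simp: power2_eq_square)
  ultimately show ?thesis by simp
qed

text \<open>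
  A factor of modulus at most \<open>1\<close> is a reparametrization; a factor of at least \<open>1\<close> is a rescaling of time.
\<close>

lemma attainable_scale:
  assumes "attainable R x0 {-1..1} (\<lambda>t y. t *\<^sub>R X y)"
  shows "attainable R x0 {-1..1} (\<lambda>t y. t *\<^sub>R (c *\<^sub>R X y))"
proof -
  define k where "k = max 1 \<bar>c\<bar>"
  have k: "k \<ge> 1" "\<bar>c\<bar> \<le> k" by (auto simp: k_def)
  have "attainable R x0 {-1..1} (\<lambda>t y. (c / k * t) *\<^sub>R X y)"
  proof (rule attainable_reparam[OF assms])
    show "(\<lambda>t. c / k * t) ` {-1..1} \<subseteq> {-1..1}"
    proof safe
      fix t :: real assume "t \<in> {-1..1}"
      then have "\<bar>t\<bar> \<le> 1" by auto
      moreover have "\<bar>c / k\<bar> \<le> 1" using k by (simp add: field_simps)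
      ultimately have "\<bar>c / k * t\<bar> \<le> 1" unfolding abs_mult by (intro mult_le_one) auto
      then show "c / k * t \<in> {-1..1}" unfolding abs_le_iff by simp
    qed
  qed (intro continuous_intros)
  from attainable_pos_scale[OF this, of k] k(1) show ?thesis by (simp add: mult.commute)
qed

text \<open>
  The fields \<open>\<Sum>\<^sub>b p\<^sub>b Z\<^sub>b\<close> move \<open>y\<close> near \<open>x0\<close> to about \<open>y + h p\<close>, continuously in \<open>p\<close>. For fixed small \<open>h\<close> the
  endpoint map is a perturbation of a dilation by less than its radius, so that Brouwer's theorem makes it hit every
  target \<open>q\<close> near \<open>x0\<close>. Allowing \<open>y\<close> to vary gives reachability in both directions.
\<close>

lemma local_controllability:
  fixes Z :: "'e::euclidean_space \<Rightarrow> 'e \<Rightarrow> 'e"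
  assumes R: "transp R" and U: "open U" "x0 \<in> U"
    and sm: "\<And>b. b \<in> Basis \<Longrightarrow> smooth_on U (Z b)"
    and at: "\<And>b. b \<in> Basis \<Longrightarrow> attainable R x0 {-1..1} (\<lambda>t y. t *\<^sub>R Z b y)"
    and Zb: "\<And>b. b \<in> Basis \<Longrightarrow> Z b x0 = b"
  obtains \<delta> where "\<delta> > 0" "\<And>y q. y \<in> ball x0 \<delta> \<Longrightarrow> q \<in> ball x0 \<delta> \<Longrightarrow> R y q"
proof -
  let ?P = "cball (0::'e) 1"
  have c1: "\<bar>p \<bullet> b\<bar> \<le> 1" if "p \<in> ?P" "b \<in> Basis" for p b :: 'e
    using Basis_le_norm[OF that(2), of p] that(1) by simp
  have 1: "attainable R x0 ?P (\<lambda>p y. (p \<bullet> b) *\<^sub>R Z b y)" if b: "b \<in> Basis" for b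
    by (rule attainable_reparam[OF at[OF b]])
       (use c1[OF _ b] in \<open>auto intro!: continuous_intros simp: abs_le_iff minus_le_iff\<close>)
  have 2: "lip_family x0 ?P (\<lambda>p y. (p \<bullet> b) *\<^sub>R Z b y)" if b: "b \<in> Basis" for b
    by (rule lip_family_c2[OF c2_family_smooth[OF U(1) sm[OF b] U(2) c1[OF _ b]]])
  have "attainable R x0 ?P (\<lambda>p y. \<Sum>b\<in>B. (p \<bullet> b) *\<^sub>R Z b y) \<and>
      lip_family x0 ?P (\<lambda>p y. \<Sum>b\<in>B. (p \<bullet> b) *\<^sub>R Z b y)"
    if "finite B" "B \<noteq> {}" "B \<subseteq> Basis" for B
    using that
  proof (induction B rule: finite_ne_induct)
    case (singleton b)
    then show ?case using 1 2 by simp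
  next
    case (insert b B)
    then have "b \<in> Basis" "B \<subseteq> Basis" by auto
    then show ?case
      using attainable_add[OF R 1 _ 2] lip_family_add[OF 2] insert by simp
  qed
  from this[of Basis] obtain r where r: "r > 0" "\<And>\<eta>. \<eta> > 0 \<Longrightarrow> \<forall>\<^sub>F h in at_right 0.
     near_map R ?P (cball x0 r) (\<lambda>p y. y + h *\<^sub>R (\<Sum>b\<in>Basis. (p \<bullet> b) *\<^sub>R Z b y)) (\<eta> * h)"
    unfolding attainable_def by auto
  have "((\<lambda>y. \<Sum>b\<in>Basis. norm (Z b y - b)) \<longlongrightarrow> (\<Sum>b\<in>Basis. norm (Z b x0 - b))) (at x0)"
    using smooth_on_imp_continuous_on[OF sm] U
    by (intro tendsto_intros) (metis continuous_on_eq_continuous_at isCont_def)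
  moreover have "(\<Sum>b\<in>Basis. norm (Z b x0 - b)) = 0" using Zb by simp
  ultimately have "\<forall>\<^sub>F y in at x0. (\<Sum>b\<in>Basis. norm (Z b y - b)) < 1/4"
    by (intro order_tendstoD(2)[where y = 0]) simp_all
  then obtain d where d: "d > 0" "\<And>y. y \<noteq> x0 \<Longrightarrow> dist y x0 < d \<Longrightarrow> (\<Sum>b\<in>Basis. norm (Z b y - b)) < 1/4"
    unfolding eventually_at by auto
  have d': "(\<Sum>b\<in>Basis. norm (Z b y - b)) \<le> 1/4" if "dist x0 y < d" for y
    using d(2)[of y] that Zb by (cases "y = x0") (auto simp: dist_commute less_imp_le)
  have "\<forall>\<^sub>F h in at_right (0::real). h > 0 \<and>
     near_map R ?P (cball x0 r) (\<lambda>p y. y + h *\<^sub>R (\<Sum>b\<in>Basis. (p \<bullet> b) *\<^sub>R Z b y)) (1/4 * h)"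
    using r(2)[of "1/4"] eventually_at_right_less[of "0::real"] by (auto intro: eventually_conj)
  then obtain h where h: "h > 0"
    "near_map R ?P (cball x0 r) (\<lambda>p y. y + h *\<^sub>R (\<Sum>b\<in>Basis. (p \<bullet> b) *\<^sub>R Z b y)) (1/4 * h)"
    using eventually_happens[of _ "at_right (0::real)"] trivial_limit_at_right_real by blast
  obtain \<Phi> where \<Phi>0: "continuous_on (?P \<times> cball x0 r) \<Phi>"
    "\<forall>p\<in>?P. \<forall>y\<in>cball x0 r. R y (\<Phi> (p, y)) \<and>
       norm (\<Phi> (p, y) - (y + h *\<^sub>R (\<Sum>b\<in>Basis. (p \<bullet> b) *\<^sub>R Z b y))) \<le> 1/4 * h"
    using h(2)[unfolded near_map_def] by (elim exE conjE) (rule that)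
  note \<Phi> = \<Phi>0(1) \<Phi>0(2)[rule_format]
  define \<delta> where "\<delta> = Min {r, d, h / 4}"
  have \<delta>: "\<delta> > 0" "\<delta> \<le> r" "\<delta> \<le> d" "\<delta> \<le> h / 4" using r(1) d(1) h(1) by (auto simp: \<delta>_def)
  show thesis
  proof (rule that[OF \<delta>(1)])
    fix y q assume y: "y \<in> ball x0 \<delta>" and q: "q \<in> ball x0 \<delta>"
    have yr: "y \<in> cball x0 r" using y \<delta>(2) by auto
    \<comment> \<open>A fixed point of this map is a parameter whose move ends in \<open>q\<close>.\<close>
    let ?f = "\<lambda>p. p - (1/h) *\<^sub>R (\<Phi> (p, y) - q)"
    have cf: "continuous_on ?P ?f"
      by (intro continuous_intros continuous_on_compose2[OF \<Phi>(1)]) (use yr in auto)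
    have qy: "norm (q - y) \<le> h / 2"
      using y q \<delta>(4) dist_triangle2[of q y x0] by (simp add: dist_norm norm_minus_commute)
    have maps: "?f p \<in> ?P" if p: "p \<in> ?P" for p
    proof -
      let ?w = "\<Sum>b\<in>Basis. (p \<bullet> b) *\<^sub>R (Z b y - b)"
      have "norm ?w \<le> (\<Sum>b\<in>Basis. norm (Z b y - b))"
        by (rule sum_norm_le) (use c1[OF p] in \<open>auto intro: mult_left_le_one_le\<close>)
      also have "\<dots> \<le> 1/4" using d'[of y] y \<delta>(3) by simp
      finally have w: "norm (h *\<^sub>R ?w) \<le> h * (1/4)" using h(1) by simp
      have "(\<Sum>b\<in>Basis. (p \<bullet> b) *\<^sub>R Z b y) = ?w + p"
        by (simp add: scaleR_diff_right sum_subtractf euclidean_representation)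
      then have "norm (\<Phi> (p, y) - (y + h *\<^sub>R (?w + p))) \<le> 1/4 * h" using \<Phi>(2)[OF p yr] by simp
      from norm_triangle_mono[OF this w] have "norm (\<Phi> (p, y) - y - h *\<^sub>R p) \<le> h / 2"
        by (simp add: algebra_simps)
      from norm_triangle_mono[OF qy this[unfolded norm_minus_commute[of "\<Phi> (p, y) - y"]]]
      have n: "norm (q - \<Phi> (p, y) + h *\<^sub>R p) \<le> h" by (simp add: algebra_simps)
      have "?f p = (1/h) *\<^sub>R (q - \<Phi> (p, y) + h *\<^sub>R p)"
        using h(1) by (simp add: algebra_simps)
      then have "norm (?f p) \<le> (1/h) * h" using n h(1) by (simp add: divide_le_eq)
      then show ?thesis using h(1) by simp
    qed
    obtain p where p: "p \<in> ?P" "?f p = p"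
      using brouwer_ball[of 1 0 ?f] cf maps by auto
    then have "\<Phi> (p, y) = q" using h(1) by simp
    then show "R y q" using \<Phi>(2)[OF p(1) yr] by metis
  qed
qed

section \<open>Nonholonomic geodesics in coordinates\<close>

lemma smooth_on_apply_fst:
  fixes f :: "'e::euclidean_space \<Rightarrow> 'b::real_normed_vector"
  assumes "open V" "smooth_on V f"
  shows "smooth_on (V \<times> (UNIV :: 'd::euclidean_space set)) (\<lambda>z. f (fst z))"
  by (rule smooth_on_compose[OF assms(1) _ assms(2) smooth_on_fst[OF _ smooth_on_id]])
     (use assms(1) in \<open>auto intro: open_Times\<close>)

locale riemannian_distribution =
  fixes A :: "('a::{t2_space, second_countable_topology}, 'e::euclidean_space) chart set"
    and k :: nat and \<Sigma> :: "('a, 'e) distr" and g :: "('a, 'e) metric" and \<Gamma> :: "('a, 'e) conn"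
  assumes struct: "smooth_structure A" and distr: "distribution A k \<Sigma>"
    and metric: "riemannian_metric A g" and conn: "affine_connection A \<Gamma>"
begin

lemma chart:
  assumes "c \<in> A"
  shows "open (cdom c)" "open (cimg c)" "continuous_on (cdom c) (cmap c)"
    "continuous_on (cimg c) (cinv c)" "p \<in> cdom c \<Longrightarrow> cinv c (cmap c p) = p"
    "x \<in> cimg c \<Longrightarrow> cmap c (cinv c x) = x" "x \<in> cimg c \<Longrightarrow> cinv c x \<in> cdom c"
    "p \<in> cdom c \<Longrightarrow> cmap c p \<in> cimg c"
proof -
  have "is_chart c" using struct assms by (auto simp: smooth_structure_def)
  then have "open (cdom c)" "open (cimg c)" and h: "homeomorphism (cdom c) (cimg c) (cmap c) (cinv c)"
    by (auto simp: is_chart_def)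
  then show "open (cdom c)" "open (cimg c)" by auto
  show "continuous_on (cdom c) (cmap c)" "continuous_on (cimg c) (cinv c)"
    "p \<in> cdom c \<Longrightarrow> cinv c (cmap c p) = p"
    "x \<in> cimg c \<Longrightarrow> cmap c (cinv c x) = x" "x \<in> cimg c \<Longrightarrow> cinv c x \<in> cdom c"
    "p \<in> cdom c \<Longrightarrow> cmap c p \<in> cimg c"
    using h by (auto simp: homeomorphism_def)
qed

lemma overlap_iff: "c \<in> A \<Longrightarrow> x \<in> overlap c d \<longleftrightarrow> x \<in> cimg c \<and> cinv c x \<in> cdom d"
  using chart[of c] by (fastforce simp: overlap_def cimg_def)

lemma open_overlap:
  assumes "c \<in> A" "d \<in> A"
  shows "open (overlap c d)"
proof -
  have "overlap c d = cimg c \<inter> cinv c -` cdom d" by (intro set_eqI) (simp add: overlap_iff[OF assms(1)])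
  then show ?thesis using continuous_open_preimage[OF chart(4,2)[OF assms(1)] chart(1)[OF assms(2)]] by simp
qed

lemma smooth_transition:
  assumes "c \<in> A" "d \<in> A"
  shows "smooth_on (overlap c d) (transition c d)"
  using struct assms by (auto simp: smooth_structure_def compatible_def)

lemma inner_product_metric: "c \<in> A \<Longrightarrow> x \<in> cimg c \<Longrightarrow> inner_product_on UNIV (g c x)"
  using metric by (auto simp: riemannian_metric_def bundle_metric_def)

lemma metric_linear:
  assumes "c \<in> A" "x \<in> cimg c"
  shows "linear (\<lambda>u. g c x u w)" "linear (\<lambda>w. g c x u w)" "g c x u w = g c x w u"
    "g c x u u = 0 \<Longrightarrow> u = 0"
proof -
  note ip = inner_product_metric[OF assms, unfolded inner_product_on_def]
  show 1: "linear (\<lambda>u. g c x u w)" for w by (rule linearI) (use ip in auto)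
  show sym: "g c x u w = g c x w u" for u w using ip by auto
  show "linear (\<lambda>w. g c x u w)" using 1[of u] sym by (simp add: linear_iff)
  have "u \<noteq> 0 \<Longrightarrow> g c x u u > 0" using ip by blast
  then show "g c x u u = 0 \<Longrightarrow> u = 0" by force
qed

lemma subspace_distr: "c \<in> A \<Longrightarrow> x \<in> cimg c \<Longrightarrow> subspace (\<Sigma> c x)"
  using distr by (auto simp: distribution_def)

lemma orthogonal_unique:
  assumes "c \<in> A" "x \<in> cimg c" "w \<in> \<Sigma> c x" "\<forall>v\<in>\<Sigma> c x. g c x (u - w) v = 0"
    "w' \<in> \<Sigma> c x" "\<forall>v\<in>\<Sigma> c x. g c x (u - w') v = 0"
  shows "w = w'"
proof -
  have d: "w' - w \<in> \<Sigma> c x" using subspace_distr[OF assms(1,2)] assms(3,5) subspace_diff by blast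
  have "w' - w = (u - w) - (u - w')" by simp
  then have "g c x (w' - w) (w' - w) = 0"
    using linear_diff[OF metric_linear(1)[OF assms(1,2)], of "u - w" "u - w'" "w' - w"] assms(4,6) d by simp
  then show ?thesis using metric_linear(4)[OF assms(1,2)] by force
qed

lemma hor_proj_eq_0:
  assumes "c \<in> A" "x \<in> cimg c" "\<forall>v\<in>\<Sigma> c x. g c x u v = 0"
  shows "hor_proj \<Sigma> g c x u = 0"
  unfolding hor_proj_def
proof (rule the_equality)
  have 0: "0 \<in> \<Sigma> c x" using subspace_distr[OF assms(1,2)] subspace_0 by blast
  then show z: "0 \<in> \<Sigma> c x \<and> (\<forall>v\<in>\<Sigma> c x. g c x (u - 0) v = 0)" using assms(3) by simp
  show "w = 0" if "w \<in> \<Sigma> c x \<and> (\<forall>v\<in>\<Sigma> c x. g c x (u - w) v = 0)" for w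
    using orthogonal_unique[OF assms(1,2)] that z by metis
qed

lemma smooth_metric:
  assumes "c \<in> A" "open V" "V \<subseteq> cimg c" "smooth_on V X" "smooth_on V Y"
  shows "smooth_on V (\<lambda>x. g c x (X x) (Y x))"
  using metric assms by (auto simp: riemannian_metric_def bundle_metric_def)

text \<open>
  Each step divides only by \<open>g(F, F)\<close> for the newly orthogonalized vector \<open>F\<close>, so that the
  projection stays smooth without normalizing.
\<close>

lemma gram_schmidt:
  fixes E :: "nat \<Rightarrow> 'e \<Rightarrow> 'e" and j :: nat
  assumes c: "c \<in> A" and V: "open V" "V \<subseteq> cimg c"
    and E: "\<And>i. i < j \<Longrightarrow> smooth_on V (E i)"
    and ind: "\<And>i x. i < j \<Longrightarrow> x \<in> V \<Longrightarrow> E i x \<notin> span ((\<lambda>l. E l x) ` {..<i})"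
  shows "\<exists>P. (\<forall>x\<in>V. linear (P x) \<and> (\<forall>u. P x u \<in> span ((\<lambda>i. E i x) ` {..<j})) \<and>
      (\<forall>u. \<forall>w\<in>span ((\<lambda>i. E i x) ` {..<j}). g c x (u - P x u) w = 0)) \<and>
      (\<forall>u. smooth_on V (\<lambda>x. P x u))"
  using E ind
proof (induction j rule: nat_induct)
  case 0
  have "g c x u 0 = 0" if "x \<in> V" for x u
    using linear_0[OF metric_linear(2)[OF c]] that V(2) by blast
  then show ?case
    by (intro exI[of _ "\<lambda>_ _. 0"])
       (auto simp: linear_iff intro!: smooth_on_const V(1))
next
  case (Suc j)
  obtain P where P0: "\<forall>x\<in>V. linear (P x) \<and> (\<forall>u. P x u \<in> span ((\<lambda>i. E i x) ` {..<j})) \<and>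
      (\<forall>u. \<forall>w\<in>span ((\<lambda>i. E i x) ` {..<j}). g c x (u - P x u) w = 0)"
    "\<forall>u. smooth_on V (\<lambda>x. P x u)"
    using Suc.IH[OF Suc.prems(1)[OF less_SucI] Suc.prems(2)[OF less_SucI]]
    by simp (elim exE conjE, rule that, assumption+)
  have P: "\<And>x. x \<in> V \<Longrightarrow> linear (P x)"
    "\<And>x u. x \<in> V \<Longrightarrow> P x u \<in> span ((\<lambda>i. E i x) ` {..<j})"
    "\<And>x u w. x \<in> V \<Longrightarrow> w \<in> span ((\<lambda>i. E i x) ` {..<j}) \<Longrightarrow> g c x (u - P x u) w = 0"
    "\<And>u. smooth_on V (\<lambda>x. P x u)"
    by (use P0 in blast)+
  have Ej: "smooth_on V (E j)" using Suc.prems(1) by simp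
  define F where "F x = E j x - P x (E j x)" for x
  have sF: "smooth_on V F" unfolding F_def
    by (rule smooth_on_diff[OF V(1) Ej smooth_on_apply_linear[OF V(1) P(1) P(4) Ej]])
  have FE: "E j x = F x + P x (E j x)" for x by (simp add: F_def)
  have F0: "F x \<noteq> 0" if "x \<in> V" for x
    using Suc.prems(2)[of j x] P(2)[OF that, of "E j x"] that by (auto simp: F_def)
  have gF: "g c x (F x) (F x) \<noteq> 0" if "x \<in> V" for x
    using F0[OF that] metric_linear(4)[OF c] that V(2) by blast
  define P' where "P' x u = P x u + (g c x u (F x) * inverse (g c x (F x) (F x))) *\<^sub>R F x" for x u
  have sp: "span ((\<lambda>i. E i x) ` {..<j}) \<subseteq> span ((\<lambda>i. E i x) ` {..<Suc j})" for x
    by (rule span_mono) auto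
  have spF: "F x \<in> span ((\<lambda>i. E i x) ` {..<Suc j})" if "x \<in> V" for x
    unfolding F_def by (rule span_diff[OF span_base]) (use sp P(2)[OF that] in auto)
  have "linear (P' x)" if "x \<in> V" for x
  proof -
    have "x \<in> cimg c" using that V by auto
    note l = metric_linear(1)[OF c this, of "F x"] and lP = P(1)[OF that]
    show ?thesis unfolding P'_def
      by (rule linearI)
         (simp_all add: linear_add[OF l] linear_scale[OF l] linear_add[OF lP] linear_scale[OF lP]
           algebra_simps)
  qed
  moreover have "P' x u \<in> span ((\<lambda>i. E i x) ` {..<Suc j})" if "x \<in> V" for x u
    unfolding P'_def using sp P(2)[OF that] spF[OF that] by (auto intro!: span_add span_scale)
  moreover have "g c x (u - P' x u) w = 0"
    if x: "x \<in> V" and w: "w \<in> span ((\<lambda>i. E i x) ` {..<Suc j})" for x u w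
  proof -
    have xc: "x \<in> cimg c" using x V by auto
    note l = metric_linear(1)[OF c xc] and l2 = metric_linear(2)[OF c xc] and sym = metric_linear(3)[OF c xc]
    let ?k = "g c x u (F x) * inverse (g c x (F x) (F x))"
    have 1: "g c x (u - P' x u) v = g c x (u - P x u) v - ?k * g c x (F x) v" for v
      using linear_diff[OF l, of "u - P x u" "?k *\<^sub>R F x" v] linear_scale[OF l, of ?k "F x" v]
      by (simp add: P'_def algebra_simps)
    have orth: "g c x (u - P' x u) v = 0" if "v \<in> span ((\<lambda>i. E i x) ` {..<j})" for v
      unfolding 1 using P(3)[OF x that, of u] P(3)[OF x that, of "E j x"] by (simp add: F_def)
    have "g c x (P x u) (F x) = 0"
      using P(3)[OF x P(2)[OF x, of u], of "E j x"] sym by (simp add: F_def)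
    then have "g c x (u - P x u) (F x) = g c x u (F x)"
      using linear_diff[OF l, of u "P x u" "F x"] by simp
    then have "g c x (u - P' x u) (F x) = 0" unfolding 1 using gF[OF x] by simp
    then have "g c x (u - P' x u) (E j x) = 0"
      using orth[OF P(2)[OF x, of "E j x"]] linear_add[OF l2, of "u - P' x u" "F x" "P x (E j x)"] FE[of x]
      by simp
    moreover have "g c x (u - P' x u) (E i x) = 0" if "i < j" for i
      by (rule orth[OF span_base]) (use that in auto)
    ultimately have "g c x (u - P' x u) v = 0" if "v \<in> (\<lambda>i. E i x) ` {..<Suc j}" for v
      using that by (auto simp: less_Suc_eq)
    from linear_eq_0_on_span[OF l2 this w] show ?thesis .
  qed
  moreover have "smooth_on V (\<lambda>x. P' x u)" for u
    unfolding P'_def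
    by (intro smooth_on_add smooth_on_scaleR smooth_on_mult smooth_on_inverse smooth_metric[OF c]
        V P(4) sF smooth_on_const gF)
  ultimately show ?case by (intro exI[of _ P']) blast
qed

text \<open>
  The local frame is linearly independent because it spans a space of dimension \<open>k\<close> with \<open>k\<close> vectors; this
  is what keeps the Gram-Schmidt vectors away from zero.
\<close>

lemma smooth_projection:
  assumes c: "c \<in> A" and x0: "x0 \<in> cimg c"
  obtains V P where "open V" "x0 \<in> V" "V \<subseteq> cimg c"
    "\<And>x. x \<in> V \<Longrightarrow> linear (P x)" "\<And>x u. x \<in> V \<Longrightarrow> P x u \<in> \<Sigma> c x"
    "\<And>x u w. x \<in> V \<Longrightarrow> w \<in> \<Sigma> c x \<Longrightarrow> g c x (u - P x u) w = 0"
    "\<And>u. smooth_on V (\<lambda>x. P x u)"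
proof -
  obtain V E where V: "open V" "x0 \<in> V" "V \<subseteq> cimg c" and E: "\<And>i. i < k \<Longrightarrow> smooth_on V (E i)"
    and sp: "\<And>y. y \<in> V \<Longrightarrow> \<Sigma> c y = span ((\<lambda>i. E i y) ` {..<k})"
    using distr c x0 unfolding distribution_def by metis
  have ind: "E i x \<notin> span ((\<lambda>l. E l x) ` {..<i})" if "i < k" "x \<in> V" for i x
  proof
    assume a: "E i x \<in> span ((\<lambda>l. E l x) ` {..<i})"
    let ?B = "(\<lambda>l. E l x) ` ({..<k} - {i})"
    have "E i x \<in> span ?B" using a span_mono[of "(\<lambda>l. E l x) ` {..<i}" ?B] that(1) by force
    then have "span (insert (E i x) ?B) = span ?B" by (rule span_redundant)
    moreover have "insert (E i x) ?B = (\<lambda>l. E l x) ` {..<k}" using that(1) by auto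
    ultimately have "\<Sigma> c x = span ?B" using sp[OF that(2)] by simp
    then have "dim (\<Sigma> c x) \<le> card ?B" using dim_le_card[of "\<Sigma> c x" ?B] by auto
    also have "\<dots> \<le> card ({..<k} - {i})" by (rule card_image_le) simp
    also have "\<dots> < k" using that(1) by simp
    finally show False using distr c that(2) V(3) by (auto simp: distribution_def)
  qed
  obtain P where P: "\<forall>x\<in>V. linear (P x) \<and> (\<forall>u. P x u \<in> span ((\<lambda>i. E i x) ` {..<k})) \<and>
      (\<forall>u. \<forall>w\<in>span ((\<lambda>i. E i x) ` {..<k}). g c x (u - P x u) w = 0)"
      "\<forall>u. smooth_on V (\<lambda>x. P x u)"
    using gram_schmidt[OF c V(1,3) E ind] by blast
  show thesis
    by (rule that[OF V]) (use P sp in auto)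
qed

text \<open>
  The horizontal geodesic equation may be checked in a single chart. Under a change of coordinates
  the second derivative of the transition map in the acceleration cancels against the
  inhomogeneous term of the connection, so \<open>x'' + \<Gamma>(x', x')\<close> transforms like a vector, and
  orthogonality to the distribution is invariant.
\<close>

lemma chart_geodesic:
  assumes c: "c \<in> A" and J: "open J" "{a..b} \<subseteq> J" and sm: "smooth_on J x"
    and x: "\<And>t. t \<in> J \<Longrightarrow> x t \<in> cimg c"
    and dx: "\<And>t. t \<in> J \<Longrightarrow> (x has_vector_derivative v t) (at t)"
    and dv: "\<And>t. t \<in> J \<Longrightarrow> (v has_vector_derivative w t) (at t)"
    and hor: "\<And>t. t \<in> J \<Longrightarrow> v t \<in> \<Sigma> c (x t)"
    and geo: "\<And>t u. t \<in> J \<Longrightarrow> u \<in> \<Sigma> c (x t) \<Longrightarrow> g c (x t) (w t + \<Gamma> c (x t) (v t) (v t)) u = 0"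
  shows "nonholonomic_geodesic A \<Sigma> g \<Gamma> a b (\<lambda>t. cinv c (x t))"
proof -
  let ?\<sigma> = "\<lambda>t. cinv c (x t)"
  have co: "continuous_on J ?\<sigma>"
    by (rule continuous_on_compose2[OF chart(4)[OF c] smooth_on_imp_continuous_on[OF sm]]) (use x in auto)
  define T where "T d = {t \<in> J. ?\<sigma> t \<in> cdom d}" for d :: "('a, 'e) chart"
  have T: "open (T d)" if "d \<in> A" for d
  proof -
    have "T d = J \<inter> ?\<sigma> -` cdom d" by (auto simp: T_def)
    then show ?thesis using continuous_open_preimage[OF co J(1) chart(1)[OF that]] by simp
  qed
  have TJ: "T d \<subseteq> J" for d by (auto simp: T_def)
  have ov: "x t \<in> overlap c d" if "t \<in> T d" for t d
    using that x by (auto simp: T_def overlap_iff[OF c])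
  have smc: "smooth_curve A J ?\<sigma>"
    unfolding smooth_curve_def
  proof (intro conjI ballI J(1) co)
    fix d assume d: "d \<in> A"
    have "smooth_on (T d) (\<lambda>t. transition c d (x t))"
      by (rule smooth_on_compose[OF open_overlap[OF c d] T[OF d] smooth_transition[OF c d]
            smooth_on_subset[OF sm]]) (rule TJ, rule image_subsetI, rule ov)
    then show "smooth_on {t \<in> J. ?\<sigma> t \<in> cdom d} (\<lambda>t. cmap d (?\<sigma> t))"
      by (simp add: T_def transition_def)
  qed
  have "velocity d ?\<sigma> t \<in> \<Sigma> d (cmap d (?\<sigma> t)) \<and>
      hor_deriv_along \<Sigma> g \<Gamma> d ?\<sigma> (velocity d ?\<sigma>) t = 0"
    if tJ: "t \<in> J" and d: "d \<in> A" and td: "?\<sigma> t \<in> cdom d" for t d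
  proof -
    let ?D = "\<lambda>y. dtrans c d y"
    have t: "t \<in> T d" using tJ td by (simp add: T_def)
    have TJ: "s \<in> J" if "s \<in> T d" for s using that TJ[of d] by blast
    have der: "(transition c d has_derivative ?D y) (at y)" if "y \<in> overlap c d" for y
      using smooth_on_imp_derivative(1)[OF smooth_transition[OF c d] that] by (simp add: dtrans_def)
    have lin: "linear (?D y)" if "y \<in> overlap c d" for y using der[OF that] has_derivative_linear by blast
    have vel1: "((\<lambda>s. cmap d (?\<sigma> s)) has_vector_derivative ?D (x s) (v s)) (at s)" if "s \<in> T d" for s
      using has_derivative_compose[OF dx[OF TJ[OF that], unfolded has_vector_derivative_def] der[OF ov[OF that]]]
        linear_scale[OF lin[OF ov[OF that]]]
      by (simp add: has_vector_derivative_def transition_def)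
    have vel: "velocity d ?\<sigma> s = ?D (x s) (v s)" if "s \<in> T d" for s
      unfolding velocity_def by (rule vector_derivative_at[OF vel1[OF that]])
    let ?D2 = "\<lambda>u. frechet_derivative (\<lambda>y. ?D y u) (at (x t))"
    have der2: "((\<lambda>y. ?D y u) has_derivative ?D2 u) (at (x t))" for u
      using smooth_on_imp_derivative(1)[OF smooth_on_imp_derivative(2)[OF smooth_transition[OF c d], of u] ov[OF t]]
      by (simp add: dtrans_def)
    have Dt: "((\<lambda>s. ?D (x s) u) has_vector_derivative ?D2 u (v t)) (at t)" for u
      using has_derivative_compose[OF dx[OF tJ, unfolded has_vector_derivative_def] der2[of u]]
        linear_scale[OF has_derivative_linear[OF der2[of u]]]
      by (simp add: has_vector_derivative_def)
    have D2lin: "?D2 (v t) (v t) = (\<Sum>b\<in>Basis. (v t \<bullet> b) *\<^sub>R ?D2 b (v t))"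
    proof -
      have "((\<lambda>y. \<Sum>b\<in>Basis. (v t \<bullet> b) *\<^sub>R ?D y b) has_derivative
          (\<lambda>h. \<Sum>b\<in>Basis. (v t \<bullet> b) *\<^sub>R ?D2 b h)) (at (x t))"
        by (intro has_derivative_sum has_derivative_scaleR_right der2)
      then have "((\<lambda>y. ?D y (v t)) has_derivative (\<lambda>h. \<Sum>b\<in>Basis. (v t \<bullet> b) *\<^sub>R ?D2 b h)) (at (x t))"
        by (rule has_derivative_transform_within_open[OF _ open_overlap[OF c d] ov[OF t]])
           (use linear_expand_Basis[OF lin, of _ "v t"] in simp)
      from has_derivative_unique[OF this der2[of "v t"]] show ?thesis by (simp add: fun_eq_iff)
    qed
    have "((\<lambda>s. \<Sum>b\<in>Basis. (v s \<bullet> b) *\<^sub>R ?D (x s) b) has_vector_derivative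
        (\<Sum>b\<in>Basis. (v t \<bullet> b) *\<^sub>R ?D2 b (v t) + (w t \<bullet> b) *\<^sub>R ?D (x t) b)) (at t)"
    proof (intro has_vector_derivative_sum)
      fix b :: 'e
      have "((\<lambda>s. v s \<bullet> b) has_real_derivative (w t \<bullet> b)) (at t)"
        using bounded_linear.has_vector_derivative[OF bounded_linear_inner_left dv[OF tJ]]
        by (simp add: has_real_derivative_iff_has_vector_derivative)
      from has_vector_derivative_scaleR[OF this Dt[of b]]
      show "((\<lambda>s. (v s \<bullet> b) *\<^sub>R ?D (x s) b) has_vector_derivative
        (v t \<bullet> b) *\<^sub>R ?D2 b (v t) + (w t \<bullet> b) *\<^sub>R ?D (x t) b) (at t)" .
    qed
    moreover have "(\<Sum>b\<in>Basis. (v t \<bullet> b) *\<^sub>R ?D2 b (v t) + (w t \<bullet> b) *\<^sub>R ?D (x t) b) =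
        ?D2 (v t) (v t) + ?D (x t) (w t)"
      unfolding D2lin linear_expand_Basis[OF lin[OF ov[OF t]], of "w t"] by (simp add: sum.distrib)
    ultimately have "((\<lambda>s. \<Sum>b\<in>Basis. (v s \<bullet> b) *\<^sub>R ?D (x s) b) has_vector_derivative
        ?D2 (v t) (v t) + ?D (x t) (w t)) (at t)" by simp
    then have "(velocity d ?\<sigma> has_vector_derivative ?D2 (v t) (v t) + ?D (x t) (w t)) (at t)"
      by (rule has_vector_derivative_transform_within_open[OF _ T[OF d] t])
         (metis vel linear_expand_Basis lin ov)
    then have acc: "vector_derivative (velocity d ?\<sigma>) (at t) = ?D2 (v t) (v t) + ?D (x t) (w t)"
      by (rule vector_derivative_at)
    have pos: "cmap d (?\<sigma> t) = transition c d (x t)" by (simp add: transition_def)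
    have \<Sigma>d: "\<Sigma> d (transition c d (x t)) = ?D (x t) ` \<Sigma> c (x t)"
      using distr c d ov[OF t] by (auto simp: distribution_def)
    have \<Gamma>d: "\<Gamma> d (transition c d (x t)) (?D (x t) (v t)) (?D (x t) (v t)) =
        ?D (x t) (\<Gamma> c (x t) (v t) (v t)) - ?D2 (v t) (v t)"
      using conn c d ov[OF t] by (auto simp: affine_connection_def)
    have "hor_deriv_along \<Sigma> g \<Gamma> d ?\<sigma> (velocity d ?\<sigma>) t =
        hor_proj \<Sigma> g d (transition c d (x t)) (?D (x t) (w t + \<Gamma> c (x t) (v t) (v t)))"
      unfolding hor_deriv_along_def pos acc vel[OF t] \<Gamma>d linear_add[OF lin[OF ov[OF t]]]
      by (simp add: algebra_simps)
    also have "\<dots> = 0"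
    proof (rule hor_proj_eq_0[OF d])
      show "transition c d (x t) \<in> cimg d" using chart(8)[OF d td] pos by simp
      show "\<forall>u\<in>\<Sigma> d (transition c d (x t)).
          g d (transition c d (x t)) (?D (x t) (w t + \<Gamma> c (x t) (v t) (v t))) u = 0"
      proof
        fix u assume "u \<in> \<Sigma> d (transition c d (x t))"
        then obtain u' where u': "u' \<in> \<Sigma> c (x t)" "u = ?D (x t) u'" unfolding \<Sigma>d by blast
        have "g d (transition c d (x t)) (?D (x t) z) (?D (x t) u') = g c (x t) z u'" for z
          using metric c d ov[OF t] by (auto simp: riemannian_metric_def bundle_metric_def)
        then show "g d (transition c d (x t)) (?D (x t) (w t + \<Gamma> c (x t) (v t) (v t))) u = 0"
          using geo[OF tJ u'(1)] u'(2) by simp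
      qed
    qed
    finally show ?thesis unfolding vel[OF t] pos \<Sigma>d using hor[OF tJ] by simp
  qed
  then show ?thesis
    unfolding nonholonomic_geodesic_def smooth_extension_def
    by (intro exI[of _ ?\<sigma>] conjI exI[of _ J] J(2) smc) (use J(2) in auto)
qed

text \<open>
  The starting time is left free so that segments can be placed one after the other without
  reparametrizing them.
\<close>

definition geodesic_step :: "'a \<Rightarrow> 'a \<Rightarrow> bool" where
  "geodesic_step p q \<longleftrightarrow> (\<exists>h>0. \<forall>a. \<exists>\<gamma>. nonholonomic_geodesic A \<Sigma> g \<Gamma> a (a + h) \<gamma> \<and> \<gamma> a = p \<and> \<gamma> (a + h) = q)"

text \<open>
  The moves are the geodesics with initial velocity \<open>t X(y)\<close>, followed for time \<open>h\<close>. To keep the constraint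
  built in, velocities are written as \<open>v = P(x) a\<close> with an unconstrained \<open>a\<close>, where \<open>P\<close> is the orthogonal
  projection. With the equations \<open>x' = v\<close> and \<open>a' = -DP(x)(v) a - \<Gamma>(v, v)\<close>, the vector \<open>x'' + \<Gamma>(x', x')\<close> equals
  \<open>(1 - P)(DP(x)(v) a + \<Gamma>(v, v))\<close>, which is orthogonal to the distribution.
\<close>

lemma horizontal_attainable:
  assumes c: "c \<in> A" and x0: "x0 \<in> cimg c" and X: "smooth_on (cimg c) X"
    and hX: "\<And>x. x \<in> cimg c \<Longrightarrow> X x \<in> \<Sigma> c x"
    and R: "\<And>y z. geodesic_step (cinv c y) (cinv c z) \<Longrightarrow> R y z"
  shows "attainable R x0 {-1..1} (\<lambda>t y. t *\<^sub>R X y)"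
proof -
  obtain V P where V: "open V" "x0 \<in> V" "V \<subseteq> cimg c" and
    P: "\<And>x. x \<in> V \<Longrightarrow> linear (P x)" "\<And>x u. x \<in> V \<Longrightarrow> P x u \<in> \<Sigma> c x"
    "\<And>x u w. x \<in> V \<Longrightarrow> w \<in> \<Sigma> c x \<Longrightarrow> g c x (u - P x u) w = 0"
    "\<And>u. smooth_on V (\<lambda>x. P x u)"
    using smooth_projection[OF c x0] by blast
  have Pid: "P x u = u" if "x \<in> V" "u \<in> \<Sigma> c x" for x u
  proof -
    have "x \<in> cimg c" using that V by auto
    have "g c x (u - u) w = 0" for w using linear_0[OF metric_linear(1)[OF c \<open>x \<in> cimg c\<close>]] by simp
    then show ?thesis
      using orthogonal_unique[OF c \<open>x \<in> cimg c\<close> P(2)[OF that(1), of u] _ that(2), of u] P(3)[OF that(1), of _ u]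
      by blast
  qed
  let ?S = "V \<times> (UNIV :: 'e set)"
  have S: "open ?S" using V(1) by (simp add: open_Times)
  let ?dP = "\<lambda>b x. frechet_derivative (\<lambda>y. P y b) (at x)"
  define v where "v z = P (fst z) (snd z)" for z :: "'e \<times> 'e"
  \<comment> \<open>\<open>K (x, a)\<close> is \<open>DP(x)(v) a\<close>, written through the smooth fields \<open>x \<mapsto> P x b\<close>.\<close>
  define K where "K z = (\<Sum>b\<in>Basis. (snd z \<bullet> b) *\<^sub>R ?dP b (fst z) (v z))" for z :: "'e \<times> 'e"
  define G where "G z = \<Gamma> c (fst z) (v z) (v z)" for z :: "'e \<times> 'e"
  define F where "F z = (v z, - (K z + G z))" for z
  have dP: "((\<lambda>y. P y b) has_derivative ?dP b x) (at x)" if "x \<in> V" for x b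
    by (rule smooth_on_imp_derivative(1)[OF P(4) that])
  have sv: "smooth_on ?S v" unfolding v_def
    by (rule smooth_on_apply_linear[OF S _ smooth_on_apply_fst[OF V(1) P(4)]])
       (use P(1) in \<open>auto intro!: smooth_on_snd smooth_on_id S\<close>)
  have sK: "smooth_on ?S K" unfolding K_def
  proof (intro smooth_on_sum smooth_on_scaleR smooth_on_inner smooth_on_snd smooth_on_id S)
    fix b :: 'e
    show "smooth_on ?S (\<lambda>z. ?dP b (fst z) (v z))"
      by (rule smooth_on_apply_linear[OF S _ smooth_on_apply_fst[OF V(1) smooth_on_imp_derivative(2)[OF P(4)]] sv])
         (use dP has_derivative_linear in force)
  qed
  have bil: "bilinear (\<Gamma> c x)" if "x \<in> cimg c" for x using conn c that by (auto simp: affine_connection_def)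
  have s\<Gamma>: "smooth_on V (\<lambda>x. \<Gamma> c x u w)" for u w
    by (rule smooth_on_subset[OF _ V(3)]) (use conn c in \<open>auto simp: affine_connection_def\<close>)
  have sG: "smooth_on ?S G" unfolding G_def
  proof (rule smooth_on_apply_linear[where L = "\<lambda>z. \<Gamma> c (fst z) (v z)", OF S _ _ sv])
    show "linear (\<Gamma> c (fst z) (v z))" if "z \<in> ?S" for z
      using bil[of "fst z"] that V(3) by (auto simp: bilinear_def)
    fix b :: 'e
    show "smooth_on ?S (\<lambda>z. \<Gamma> c (fst z) (v z) b)"
    proof (rule smooth_on_apply_linear[where L = "\<lambda>z u. \<Gamma> c (fst z) u b", OF S _ _ sv])
      show "linear (\<lambda>u. \<Gamma> c (fst z) u b)" if "z \<in> ?S" for z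
        using bil[of "fst z"] that V(3) by (auto simp: bilinear_def)
    qed (rule smooth_on_apply_fst[OF V(1) s\<Gamma>])
  qed
  have sF: "smooth_on ?S F" unfolding F_def
    by (intro smooth_on_Pair smooth_on_uminus smooth_on_add S sv sK sG)
  obtain r where r: "r > 0" "cball x0 r \<subseteq> V" using V(1,2) open_contains_cball by blast
  have cX: "continuous_on (cball x0 r) X"
    using continuous_on_subset[OF smooth_on_imp_continuous_on[OF X]] r(2) V(3) by blast
  have "bounded (X ` cball x0 r)"
    by (intro compact_imp_bounded compact_continuous_image cX compact_cball)
  then obtain M where M: "M > 0" "\<And>y. y \<in> cball x0 r \<Longrightarrow> norm (X y) \<le> M"
    by (auto simp: bounded_pos)
  let ?W = "cball x0 r \<times> cball (0::'e) (M + 1)" and ?Winit = "cball x0 (r/2) \<times> cball (0::'e) M"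
  have W: "compact ?W" "convex ?W" "?W \<subseteq> ?S"
    using r(2) by (auto intro!: compact_Times convex_Times simp: subset_iff)
  have W0: "compact ?Winit" "?Winit \<subseteq> interior ?W"
    using r(1) by (auto intro!: compact_Times simp: interior_Times)
  obtain h0 C \<phi> where h0: "h0 > 0" and C: "C \<ge> 0" and \<phi>: "\<And>z. \<phi> z 0 = z"
    "\<And>z t. z \<in> ?Winit \<Longrightarrow> \<bar>t\<bar> < h0 \<Longrightarrow> \<phi> z t \<in> interior ?W"
    "\<And>z t. z \<in> ?Winit \<Longrightarrow> \<bar>t\<bar> < h0 \<Longrightarrow> (\<phi> z has_vector_derivative F (\<phi> z t)) (at t)"
    "\<And>t. continuous_on UNIV (\<lambda>z. \<phi> z t)"
    "\<And>z t. z \<in> ?Winit \<Longrightarrow> \<bar>t\<bar> < h0 \<Longrightarrow> norm (\<phi> z t - z - t *\<^sub>R F z) \<le> C * t\<^sup>2"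
    by (rule local_flow[OF sF W W0]) (rule that)
  have step: "geodesic_step (cinv c (fst z)) (cinv c (fst (\<phi> z h)))" if z: "z \<in> ?Winit" and h: "0 < h" "h < h0" for z h
    unfolding geodesic_step_def
  proof (intro exI[of _ h] conjI allI h(1))
    fix a :: real
    let ?J = "{a - h0<..<a + h0}"
    define \<zeta> where "\<zeta> t = \<phi> z (t - a)" for t
    have \<zeta>S: "\<zeta> t \<in> ?S" if "t \<in> ?J" for t
    proof -
      have "\<bar>t - a\<bar> < h0" using that by auto
      from \<phi>(2)[OF z this] show ?thesis using W(3) interior_subset unfolding \<zeta>_def by blast
    qed
    have d\<zeta>: "(\<zeta> has_vector_derivative F (\<zeta> t)) (at t)" if "t \<in> ?J" for t
    proof -
      have "\<bar>t - a\<bar> < h0" using that by auto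
      have "((\<lambda>s. s - a) has_vector_derivative 1) (at t)" by (auto intro!: derivative_eq_intros)
      from vector_diff_chain_at[OF this \<phi>(3)[OF z \<open>\<bar>t - a\<bar> < h0\<close>]]
      show ?thesis by (simp add: \<zeta>_def[abs_def] o_def)
    qed
    let ?x = "\<lambda>t. fst (\<zeta> t)" and ?a = "\<lambda>t. snd (\<zeta> t)"
    have xV: "?x t \<in> V" if "t \<in> ?J" for t using \<zeta>S[OF that] by auto
    have dx: "(?x has_vector_derivative v (\<zeta> t)) (at t)" if "t \<in> ?J" for t
      using bounded_linear.has_vector_derivative[OF bounded_linear_fst d\<zeta>[OF that]] by (simp add: F_def)
    have da: "(?a has_vector_derivative - (K (\<zeta> t) + G (\<zeta> t))) (at t)" if "t \<in> ?J" for t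
      using bounded_linear.has_vector_derivative[OF bounded_linear_snd d\<zeta>[OF that]] by (simp add: F_def)
    have dv: "((\<lambda>s. v (\<zeta> s)) has_vector_derivative K (\<zeta> t) + P (?x t) (- (K (\<zeta> t) + G (\<zeta> t)))) (at t)"
      if t: "t \<in> ?J" for t
    proof (rule has_vector_derivative_transform_within_open)
      have "((\<lambda>s. \<Sum>b\<in>Basis. (?a s \<bullet> b) *\<^sub>R P (?x s) b) has_vector_derivative
        (\<Sum>b\<in>Basis. (?a t \<bullet> b) *\<^sub>R ?dP b (?x t) (v (\<zeta> t)) + (- (K (\<zeta> t) + G (\<zeta> t)) \<bullet> b) *\<^sub>R P (?x t) b)) (at t)"
      proof (intro has_vector_derivative_sum)
        fix b :: 'e
        have 1: "((\<lambda>s. ?a s \<bullet> b) has_real_derivative (- (K (\<zeta> t) + G (\<zeta> t)) \<bullet> b)) (at t)"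
          using bounded_linear.has_vector_derivative[OF bounded_linear_inner_left da[OF t]]
          by (simp add: has_real_derivative_iff_has_vector_derivative)
        have 2: "((\<lambda>s. P (?x s) b) has_vector_derivative ?dP b (?x t) (v (\<zeta> t))) (at t)"
          using has_derivative_compose[OF dx[OF t, unfolded has_vector_derivative_def] dP[OF xV[OF t], of b]]
            linear_scale[OF has_derivative_linear[OF dP[OF xV[OF t], of b]]]
          by (simp add: has_vector_derivative_def)
        show "((\<lambda>s. (?a s \<bullet> b) *\<^sub>R P (?x s) b) has_vector_derivative
          (?a t \<bullet> b) *\<^sub>R ?dP b (?x t) (v (\<zeta> t)) + (- (K (\<zeta> t) + G (\<zeta> t)) \<bullet> b) *\<^sub>R P (?x t) b) (at t)"
          by (rule has_vector_derivative_scaleR[OF 1 2])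
      qed
      then show "((\<lambda>s. \<Sum>b\<in>Basis. (?a s \<bullet> b) *\<^sub>R P (?x s) b) has_vector_derivative
          K (\<zeta> t) + P (?x t) (- (K (\<zeta> t) + G (\<zeta> t)))) (at t)"
        unfolding sum.distrib K_def[of "\<zeta> t", symmetric]
          linear_expand_Basis[OF P(1)[OF xV[OF t]], of "- (K (\<zeta> t) + G (\<zeta> t))", symmetric] .
      show "(\<Sum>b\<in>Basis. (?a s \<bullet> b) *\<^sub>R P (?x s) b) = v (\<zeta> s)" if "s \<in> ?J" for s
        unfolding v_def using linear_expand_Basis[OF P(1)[OF xV[OF that]], of "?a s"] by simp
    qed (use t in auto)
    have "nonholonomic_geodesic A \<Sigma> g \<Gamma> a (a + h) (\<lambda>t. cinv c (?x t))"
    proof (rule chart_geodesic[OF c, of ?J, where v = "\<lambda>s. v (\<zeta> s)" and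
          w = "\<lambda>t. K (\<zeta> t) + P (?x t) (- (K (\<zeta> t) + G (\<zeta> t)))"])
      show "smooth_on ?J ?x"
        by (intro smooth_on_fst smooth_on_ode_solution[OF S sF _ \<zeta>S d\<zeta>]) auto
      show "v (\<zeta> t) \<in> \<Sigma> c (?x t)" if "t \<in> ?J" for t
        unfolding v_def by (rule P(2)[OF xV[OF that]])
      show "g c (?x t) (K (\<zeta> t) + P (?x t) (- (K (\<zeta> t) + G (\<zeta> t))) + \<Gamma> c (?x t) (v (\<zeta> t)) (v (\<zeta> t))) u = 0"
        if "t \<in> ?J" "u \<in> \<Sigma> c (?x t)" for t u
        using P(3)[OF xV[OF that(1)] that(2), of "K (\<zeta> t) + G (\<zeta> t)"]
          linear_neg[OF P(1)[OF xV[OF that(1)]], of "K (\<zeta> t) + G (\<zeta> t)"]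
        by (simp add: G_def algebra_simps)
    qed (use h dx dv xV V(3) in auto)
    then show "\<exists>\<gamma>. nonholonomic_geodesic A \<Sigma> g \<Gamma> a (a + h) \<gamma> \<and> \<gamma> a = cinv c (fst z) \<and>
        \<gamma> (a + h) = cinv c (fst (\<phi> z h))"
      by (intro exI[of _ "\<lambda>t. cinv c (?x t)"]) (simp add: \<zeta>_def \<phi>(1))
  qed
  have half: "cball x0 (r/2) \<subseteq> cball x0 r" using r(1) by auto
  show ?thesis unfolding attainable_def
  proof (intro exI[of _ "r/2"] conjI allI impI)
    fix \<eta> :: real assume "\<eta> > 0"
    then have "\<forall>\<^sub>F h in at_right 0. C * h \<le> \<eta>" by (rule eventually_small)
    moreover have "\<forall>\<^sub>F h in at_right 0. h < h0"
      unfolding eventually_at_right_field using h0 by blast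
    ultimately show "\<forall>\<^sub>F h in at_right 0.
        near_map R {-1..1} (cball x0 (r/2)) (\<lambda>t y. y + h *\<^sub>R t *\<^sub>R X y) (\<eta> * h)"
      using eventually_at_right_less[of "0::real"]
    proof eventually_elim
      case (elim h)
      let ?Q = "{-1..1::real} \<times> cball x0 (r/2)"
      let ?z = "\<lambda>q. (snd q, fst q *\<^sub>R X (snd q))"
      have "continuous_on ?Q (\<lambda>q. X (snd q))"
        by (rule continuous_on_compose2[OF cX]) (use half in \<open>auto intro!: continuous_intros\<close>)
      then have "continuous_on ?Q ?z" by (intro continuous_intros)
      then have "continuous_on ?Q (\<lambda>q. \<phi> (?z q) h)"
        by (rule continuous_on_compose2[OF \<phi>(4)]) auto
      then have cont: "continuous_on ?Q (\<lambda>q. fst (\<phi> (?z q) h))" by (rule continuous_on_fst)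
      have "R y (fst (\<phi> (y, t *\<^sub>R X y) h)) \<and>
          norm (fst (\<phi> (y, t *\<^sub>R X y) h) - (y + h *\<^sub>R t *\<^sub>R X y)) \<le> \<eta> * h"
        if t: "t \<in> {-1..1}" and y: "y \<in> cball x0 (r/2)" for t y
      proof -
        let ?p = "(y, t *\<^sub>R X y)"
        have y': "y \<in> cball x0 r" "y \<in> V" using y half r(2) by blast+
        have "\<bar>t\<bar> \<le> 1" using t by auto
        then have "norm (t *\<^sub>R X y) \<le> M"
          using M(2)[OF y'(1)] mult_mono[of "\<bar>t\<bar>" 1 "norm (X y)" M] by simp
        then have p: "?p \<in> ?Winit" using y by simp
        have Ry: "R y (fst (\<phi> ?p h))" by (rule R) (use step[OF p elim(3,2)] in simp)
        have "v ?p = t *\<^sub>R X y"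
        proof -
          have yc: "y \<in> cimg c" using y'(2) V(3) by blast
          have "t *\<^sub>R X y \<in> \<Sigma> c y" using hX[OF yc] subspace_distr[OF c yc] subspace_scale by blast
          then show ?thesis using Pid[OF y'(2)] by (simp add: v_def)
        qed
        then have "fst (\<phi> ?p h - ?p - h *\<^sub>R F ?p) = fst (\<phi> ?p h) - (y + h *\<^sub>R t *\<^sub>R X y)"
          by (simp add: F_def algebra_simps)
        then have "norm (fst (\<phi> ?p h) - (y + h *\<^sub>R t *\<^sub>R X y)) \<le> norm (\<phi> ?p h - ?p - h *\<^sub>R F ?p)"
          by (metis norm_fst_le prod.collapse)
        also have "\<dots> \<le> C * h\<^sup>2" using \<phi>(5)[OF p, of h] elim(2,3) by simp
        also have "\<dots> = (C * h) * h" by (simp add: power2_eq_square)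
        also have "\<dots> \<le> \<eta> * h" using elim(1,3) by (intro mult_right_mono) auto
        finally have "norm (fst (\<phi> ?p h) - (y + h *\<^sub>R t *\<^sub>R X y)) \<le> \<eta> * h" .
        with Ry show ?thesis by blast
      qed
      then show ?case unfolding near_map_def
        by (intro exI[of _ "\<lambda>q. fst (\<phi> (?z q) h)"]) (use cont in auto)
    qed
  qed (use r(1) in auto)
qed

end

section \<open>Reachability by chains of geodesics\<close>

context riemannian_distribution
begin

abbreviation reachable :: "'a \<Rightarrow> 'a \<Rightarrow> bool" where
  "reachable \<equiv> geodesic_step\<^sup>+\<^sup>+"

abbreviation chart_reachable :: "('a, 'e) chart \<Rightarrow> 'e \<Rightarrow> 'e \<Rightarrow> bool" where
  "chart_reachable c y z \<equiv> reachable (cinv c y) (cinv c z)"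

lemma transp_chart_reachable: "transp (chart_reachable c)"
  by (rule transpI) (rule tranclp_trans)

lemma iterated_commutator_attainable:
  assumes "iterated_commutator A \<Sigma> i X" "c \<in> A"
  shows "smooth_on (cimg c) (X c) \<and>
    (\<forall>x0\<in>cimg c. attainable (chart_reachable c) x0 {-1..1} (\<lambda>t y. t *\<^sub>R X c y))"
  using assms(1)
proof induction
  case (base X)
  then have s: "smooth_on (cimg c) (X c)" and h: "\<And>x. x \<in> cimg c \<Longrightarrow> X c x \<in> \<Sigma> c x"
    using assms(2) by (auto simp: horizontal_field_def vector_field_def)
  then show ?case
    using horizontal_attainable[OF assms(2) _ s h, of _ "chart_reachable c"] tranclp.r_into_trancl by blast
next
  case (bracket i X j Y)
  then show ?case
    using smooth_on_coord_bracket[OF chart(2)[OF assms(2)]]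
      attainable_bracket[OF transp_chart_reachable chart(2)[OF assms(2)]]
    by (auto simp: lie_bracket_def)
qed

lemma sigma_field_attainable:
  assumes "sigma_field A \<Sigma> i X" "c \<in> A"
  shows "smooth_on (cimg c) (X c) \<and>
    (\<forall>x0\<in>cimg c. attainable (chart_reachable c) x0 {-1..1} (\<lambda>t y. t *\<^sub>R X c y))"
  using assms(1)
proof induction
  case (comm j X)
  then show ?case using iterated_commutator_attainable assms(2) by blast
next
  case (add X Y)
  have lip: "lip_family x0 {-1..1} (\<lambda>t y. t *\<^sub>R Z y)" if "smooth_on (cimg c) Z" "x0 \<in> cimg c" for x0 Z
    by (rule lip_family_c2[OF c2_family_smooth[OF chart(2)[OF assms(2)] that]]) auto
  have s: "smooth_on (cimg c) (X c)" "smooth_on (cimg c) (Y c)" using add.IH by auto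
  have "attainable (chart_reachable c) x0 {-1..1} (\<lambda>t y. t *\<^sub>R X c y + t *\<^sub>R Y c y)" if "x0 \<in> cimg c" for x0
    by (rule attainable_add[OF transp_chart_reachable _ _ lip[OF s(1) that] lip[OF s(2) that]])
       (use add.IH that in simp_all)
  then show ?case using smooth_on_add[OF chart(2)[OF assms(2)] s] by (simp add: scaleR_add_right)
next
  case (scale X r)
  then show ?case
    by (intro conjI ballI smooth_on_scaleR_const[OF chart(2)[OF assms(2)]] attainable_scale) simp_all
qed

text \<open>
  The bracket generating condition supplies, for each basis vector, an attainable field with that
  value at the given point.
\<close>

lemma reachable_neighbourhood:
  assumes "bracket_generating A \<Sigma>"
  obtains N where "open N" "p \<in> N" "\<And>q q'. q \<in> N \<Longrightarrow> q' \<in> N \<Longrightarrow> reachable q q'"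
proof -
  obtain c where c: "c \<in> A" "p \<in> cdom c" using struct unfolding smooth_structure_def by blast
  obtain l where l: "sigma_at A \<Sigma> l c (cmap c p) = UNIV"
    using assms c unfolding bracket_generating_def by blast
  have "b \<in> sigma_at A \<Sigma> l c (cmap c p)" for b unfolding l by (rule UNIV_I)
  then have "\<exists>X. b = X c (cmap c p) \<and> sigma_field A \<Sigma> l X" for b
    unfolding sigma_at_def by (rule CollectD)
  then have "\<forall>b. \<exists>X. b = X c (cmap c p) \<and> sigma_field A \<Sigma> l X" by (rule allI)
  then obtain X where "\<forall>b. b = X b c (cmap c p) \<and> sigma_field A \<Sigma> l (X b)" by (rule choice[THEN exE])
  then have X: "\<And>b. sigma_field A \<Sigma> l (X b)" "\<And>b. X b c (cmap c p) = b" by (metis, metis)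
  have x0: "cmap c p \<in> cimg c" by (rule chart(8)[OF c])
  obtain \<delta> where \<delta>: "\<delta> > 0" "\<And>y q. y \<in> ball (cmap c p) \<delta> \<Longrightarrow> q \<in> ball (cmap c p) \<delta> \<Longrightarrow> chart_reachable c y q"
    using local_controllability[OF transp_chart_reachable chart(2)[OF c(1)] x0, of "\<lambda>b. X b c"]
      sigma_field_attainable[OF X(1) c(1)] X(2) x0 by metis
  show thesis
  proof (rule that)
    let ?N = "cdom c \<inter> cmap c -` ball (cmap c p) \<delta>"
    show "open ?N" using continuous_open_preimage[OF chart(3,1)[OF c(1)] open_ball] by blast
    show "p \<in> ?N" using c(2) \<delta>(1) by simp
    show "reachable q q'" if "q \<in> ?N" "q' \<in> ?N" for q q'
      using \<delta>(2)[of "cmap c q" "cmap c q'"] that chart(5)[OF c(1)] by auto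
  qed
qed

text \<open>
  The points reachable from \<open>p\<close> form an open set, and so do the others, since reachability within
  a neighbourhood goes in both directions.
\<close>

lemma all_reachable:
  assumes "bracket_generating A \<Sigma>" "connected (UNIV :: 'a set)"
  shows "reachable p q"
proof -
  have "open {q. reachable p q}"
    unfolding open_subopen[of "{q. reachable p q}"]
    using reachable_neighbourhood[OF assms(1)] tranclp_trans by (metis mem_Collect_eq subsetI)
  moreover have "open (- {q. reachable p q})"
    unfolding open_subopen[of "- {q. reachable p q}"]
    using reachable_neighbourhood[OF assms(1)] tranclp_trans by (metis ComplD ComplI mem_Collect_eq subsetI)
  moreover have "reachable p p" using reachable_neighbourhood[OF assms(1)] by metis
  ultimately have "{q. reachable p q} = UNIV"
    using assms(2) connected_clopen[of "UNIV :: 'a set"] by (auto simp: closed_def)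
  then show ?thesis by blast
qed

lemma nonholonomic_geodesic_cong:
  "nonholonomic_geodesic A \<Sigma> g \<Gamma> a b \<gamma> \<Longrightarrow> (\<And>t. t \<in> {a..b} \<Longrightarrow> \<gamma> t = \<gamma>' t) \<Longrightarrow>
    nonholonomic_geodesic A \<Sigma> g \<Gamma> a b \<gamma>'"
  unfolding nonholonomic_geodesic_def smooth_extension_def by (metis (no_types, lifting))

lemma nonholonomic_geodesic_continuous:
  assumes "nonholonomic_geodesic A \<Sigma> g \<Gamma> a b \<gamma>"
  shows "continuous_on {a..b} \<gamma>"
proof -
  obtain \<sigma> J where "{a..b} \<subseteq> J" "continuous_on J \<sigma>" "\<forall>t\<in>{a..b}. \<gamma> t = \<sigma> t"
    using assms unfolding nonholonomic_geodesic_def smooth_extension_def smooth_curve_def by blast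
  then show ?thesis using continuous_on_subset continuous_on_cong by metis
qed

definition geodesic_chain :: "real \<Rightarrow> real \<Rightarrow> (real \<Rightarrow> 'a) \<Rightarrow> bool" where
  "geodesic_chain a b \<gamma> \<longleftrightarrow> continuous_on {a..b} \<gamma> \<and> (\<exists>n s. subdivision a b n s \<and>
     (\<forall>i<n. nonholonomic_geodesic A \<Sigma> g \<Gamma> (s i) (s (Suc i)) \<gamma>))"

lemma subdivision_mono:
  assumes "subdivision a b n s" "i \<le> j" "j \<le> n"
  shows "s i \<le> s j"
  using assms(2,3)
proof (induction j)
  case (Suc j)
  have "s j < s (Suc j)" using assms(1) Suc.prems by (simp add: subdivision_def)
  then show ?case using Suc by (cases "i = Suc j") auto
qed simp

lemma subdivision_cover:
  assumes "subdivision a b n s" "t \<in> {a..b}" "t \<notin> s ` {..n}"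
  obtains i where "i < n" "s i < t" "t < s (Suc i)"
proof -
  have "\<exists>i<m. s i < t \<and> t < s (Suc i)" if "t < s m" "m \<le> n" for m
    using that
  proof (induction m)
    case 0
    then show ?case using assms(1,2) by (simp add: subdivision_def)
  next
    case (Suc m)
    show ?case
    proof (cases "t < s m")
      case True
      then show ?thesis using Suc by (meson Suc_leD less_SucI)
    next
      case False
      then have "s m < t" using assms(3) Suc.prems(2) by (metis Suc_leD atMost_iff image_eqI linorder_neqE)
      then show ?thesis using Suc.prems(1) by blast
    qed
  qed
  moreover have "t < s n" 
    using assms by (metis atLeastAtMost_iff atMost_iff image_eqI order_le_less order_refl subdivision_def)
  ultimately show thesis using that by blast
qed

lemma geodesic_chain_extend:
  assumes ch: "geodesic_chain a b \<gamma>" and "a \<le> b" "h > 0"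
    and \<sigma>: "nonholonomic_geodesic A \<Sigma> g \<Gamma> b (b + h) \<sigma>" "\<sigma> b = \<gamma> b"
  shows "geodesic_chain a (b + h) (\<lambda>t. if t \<le> b then \<gamma> t else \<sigma> t)"
proof -
  let ?\<gamma> = "\<lambda>t. if t \<le> b then \<gamma> t else \<sigma> t"
  obtain n s where c: "continuous_on {a..b} \<gamma>" and sd: "subdivision a b n s"
    and geo: "\<And>i. i < n \<Longrightarrow> nonholonomic_geodesic A \<Sigma> g \<Gamma> (s i) (s (Suc i)) \<gamma>"
    using ch unfolding geodesic_chain_def by blast
  have "continuous_on ({a..b} \<union> {b..b+h}) ?\<gamma>"
    by (rule continuous_on_If) (use c nonholonomic_geodesic_continuous[OF \<sigma>(1)] \<sigma>(2) in auto)
  moreover have "{a..b} \<union> {b..b+h} = {a..b+h}" using assms(2,3) by auto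
  ultimately have cont: "continuous_on {a..b+h} ?\<gamma>" by simp
  let ?s = "s(Suc n := b + h)"
  have sd': "subdivision a (b + h) (Suc n) ?s"
    using sd assms(3) by (auto simp: subdivision_def less_Suc_eq)
  have "nonholonomic_geodesic A \<Sigma> g \<Gamma> (?s i) (?s (Suc i)) ?\<gamma>" if "i < Suc n" for i
  proof (cases "i = n")
    case True
    have "nonholonomic_geodesic A \<Sigma> g \<Gamma> b (b + h) ?\<gamma>"
      by (rule nonholonomic_geodesic_cong[OF \<sigma>(1)]) (use \<sigma>(2) in auto)
    then show ?thesis using True sd by (simp add: subdivision_def)
  next
    case False
    then have i: "i < n" using that by simp
    have "s (Suc i) \<le> b" using subdivision_mono[OF sd, of "Suc i" n] sd i by (simp add: subdivision_def)
    then have "nonholonomic_geodesic A \<Sigma> g \<Gamma> (s i) (s (Suc i)) ?\<gamma>"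
      by (intro nonholonomic_geodesic_cong[OF geo[OF i]]) auto
    then show ?thesis using i by simp
  qed
  then show ?thesis unfolding geodesic_chain_def using cont sd' by blast
qed

lemma reachable_imp_chain:
  assumes "reachable p q"
  shows "\<exists>b>0. \<exists>\<gamma>. geodesic_chain 0 b \<gamma> \<and> \<gamma> 0 = p \<and> \<gamma> b = q"
  using assms
proof induction
  case (base q)
  then obtain h \<gamma> where h: "h > 0" and \<gamma>: "nonholonomic_geodesic A \<Sigma> g \<Gamma> 0 (0 + h) \<gamma>" "\<gamma> 0 = p" "\<gamma> (0 + h) = q"
    unfolding geodesic_step_def by metis
  have "geodesic_chain 0 h \<gamma>" unfolding geodesic_chain_def
  proof (intro conjI exI)
    show "continuous_on {0..h} \<gamma>" using nonholonomic_geodesic_continuous[OF \<gamma>(1)] by simp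
    show "subdivision 0 h 1 (\<lambda>i. if i = 0 then 0 else h)" using h by (simp add: subdivision_def)
  qed (use \<gamma> in auto)
  then show ?case using h \<gamma> by auto
next
  case (step q r)
  then obtain b \<gamma> where b: "b > 0" "geodesic_chain 0 b \<gamma>" "\<gamma> 0 = p" "\<gamma> b = q" by blast
  from step(2) obtain h \<sigma> where h: "h > 0" and \<sigma>: "nonholonomic_geodesic A \<Sigma> g \<Gamma> b (b + h) \<sigma>" "\<sigma> b = q" "\<sigma> (b + h) = r"
    unfolding geodesic_step_def by metis
  have "geodesic_chain 0 (b + h) (\<lambda>t. if t \<le> b then \<gamma> t else \<sigma> t)"
    by (rule geodesic_chain_extend[OF b(2)]) (use b h \<sigma> in auto)
  then show ?case
    by (intro exI[of _ "b + h"] conjI exI[of _ "\<lambda>t. if t \<le> b then \<gamma> t else \<sigma> t"]) (use b h \<sigma> in auto)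
qed

text \<open>
  Horizontality almost everywhere: away from the finitely many break points the curve agrees locally
  with one of its smooth segments, hence has the same velocity.
\<close>

lemma geodesic_chain_imp_broken_geodesic:
  assumes "geodesic_chain a b \<gamma>"
  shows "broken_geodesic A \<Sigma> g \<Gamma> a b \<gamma>"
proof -
  obtain n s where c: "continuous_on {a..b} \<gamma>" and sd: "subdivision a b n s"
    and geo: "\<And>i. i < n \<Longrightarrow> nonholonomic_geodesic A \<Sigma> g \<Gamma> (s i) (s (Suc i)) \<gamma>"
    using assms unfolding geodesic_chain_def by blast
  have "piecewise_smooth_curve A a b \<gamma>"
    unfolding piecewise_smooth_curve_def using c sd geo unfolding nonholonomic_geodesic_def by blast
  moreover have "AE t in lebesgue. t \<in> {a..b} \<longrightarrow>
      (\<forall>c\<in>A. \<gamma> t \<in> cdom c \<longrightarrow> velocity c \<gamma> t \<in> \<Sigma> c (cmap c (\<gamma> t)))"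
  proof (rule AE_I')
    show "s ` {..n} \<in> null_sets lebesgue"
      using negligible_finite[of "s ` {..n}"] by (simp add: negligible_iff_null_sets)
    show "{t \<in> space lebesgue. \<not> (t \<in> {a..b} \<longrightarrow>
      (\<forall>c\<in>A. \<gamma> t \<in> cdom c \<longrightarrow> velocity c \<gamma> t \<in> \<Sigma> c (cmap c (\<gamma> t))))} \<subseteq> s ` {..n}"
    proof (rule subsetI, rule ccontr)
      fix t assume "t \<in> {t \<in> space lebesgue. \<not> (t \<in> {a..b} \<longrightarrow>
        (\<forall>c\<in>A. \<gamma> t \<in> cdom c \<longrightarrow> velocity c \<gamma> t \<in> \<Sigma> c (cmap c (\<gamma> t))))}" and nt: "t \<notin> s ` {..n}"
      then obtain d where t: "t \<in> {a..b}" and d: "d \<in> A" "\<gamma> t \<in> cdom d" "velocity d \<gamma> t \<notin> \<Sigma> d (cmap d (\<gamma> t))"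
        by blast
      obtain i where i: "i < n" "s i < t" "t < s (Suc i)" using subdivision_cover[OF sd t nt] .
      obtain \<sigma> where eq: "\<forall>t\<in>{s i..s (Suc i)}. \<gamma> t = \<sigma> t" and hor: "\<forall>t\<in>{s i..s (Suc i)}. \<forall>c\<in>A. \<sigma> t \<in> cdom c \<longrightarrow>
          velocity c \<sigma> t \<in> \<Sigma> c (cmap c (\<sigma> t))"
        using geo[OF i(1)] unfolding nonholonomic_geodesic_def smooth_extension_def by blast
      have "\<forall>\<^sub>F u in nhds t. cmap d (\<gamma> u) = cmap d (\<sigma> u)"
        unfolding eventually_nhds
        by (rule exI[of _ "{s i<..<s (Suc i)}"]) (use i eq in auto)
      then have "velocity d \<gamma> t = velocity d \<sigma> t"
        unfolding velocity_def by (intro vector_derivative_cong_eq) (auto simp: eventually_at_filter elim: eventually_mono)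
      then show False using d hor eq i by auto
    qed
  qed
  ultimately show ?thesis
    unfolding broken_geodesic_def horizontal_curve_def using c sd geo by blast
qed

end

theorem theorem3p6:
  fixes A :: "('a::{t2_space, second_countable_topology}, 'e::euclidean_space) chart set"
    and k :: nat
    and \<Sigma> :: "('a, 'e) distr"
    and gc g :: "('a, 'e) metric"
    and \<Gamma> :: "('a, 'e) conn"
  assumes "sub_riemannian_manifold A k \<Sigma> gc"
    and "riemannian_metric A g"
    and "metric_restricts A \<Sigma> g gc"
    and "levi_civita A g \<Gamma>"
    and "bracket_generating A \<Sigma>"
    and "connected (UNIV :: 'a set)"
  shows "\<forall>p q. \<exists>a b \<gamma>. a < b \<and> broken_geodesic A \<Sigma> g \<Gamma> a b \<gamma> \<and> \<gamma> a = p \<and> \<gamma> b = q"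
proof (intro allI)
  fix p q :: 'a
  interpret riemannian_distribution A k \<Sigma> g \<Gamma>
    using assms(1,2,4)
    by unfold_locales (auto simp: sub_riemannian_manifold_def levi_civita_def)
  obtain b \<gamma> where "b > 0" "geodesic_chain 0 b \<gamma>" "\<gamma> 0 = p" "\<gamma> b = q"
    using reachable_imp_chain[OF all_reachable[OF assms(5,6)]] by metis
  then show "\<exists>a b \<gamma>. a < b \<and> broken_geodesic A \<Sigma> g \<Gamma> a b \<gamma> \<and> \<gamma> a = p \<and> \<gamma> b = q"
    using geodesic_chain_imp_broken_geodesic by blast
qed

end
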